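(* Let $q_+,q_-$ be parameters such that either $q_+=\frac{\epsilon}{M+N}$, $q_-=\frac{M-N}{M+N}$ with $M,N\in\{0,1,2,\dots\}$, $M+N\neq0$, $\epsilon\in\{1,-1\}$, or $q_+=0$, $-1\le q_-\le1$. Let $x\in H_{\mathbb R}$ with $\|x\otimes x\|=1$, and let $\kappa_{q_+,q_-}$ be the probability distribution of the cyclic Gaussian operator $G(x)$ with respect to the vacuum state. Then $\kappa_{q_+,q_-}=\mu_{q_+,q_-}$.
   Context: **Fock space.** $[\pm n]=\{\overline n,\dots,\overline1,1,\dots,n\}$ with $\overline i=-i$. $B(n)$ is the group of permutations $\sigma$ of $[\pm n]$ with $\sigma(\overline i)=\overline{\sigma(i)}$. Decompose $\sigma$ into disjoint cycles: pairs of disjoint cycles $c=(a_1\dots a_k)$, $\overline c=(\overline{a_1}\dots\overline{a_k})$ form one positive cycle of length $k$, and a cycle $c=\overline c$ of $2m$ elements is one negative cycle of length $m$. $\rho^+,\rho^-$ are the partitions of lengths of positive and negative cycles, $\|\rho\|=|\rho|-\ell(\rho)$ (size minus number of parts), and $\phi_{q_+,q_-}(\sigma)=q_+^{\|\rho^+\|+\|\rho^-\|}q_-^{\ell(\rho^-)}$ (with $0^0=1$). $H$ is the complexification of a separable real Hilbert space $H_{\mathbb R}$ (inner product linear in the second argument), $\mathcal K=H\otimes H$, $\mathcal K_n=H^{\otimes2n}$ with simple tensors $x_{\overline n}\otimes\cdots\otimes x_{\overline1}\otimes x_1\otimes\cdots\otimes x_n$, on which $B(n)$ acts by $\sigma(x_{\overline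 n}\otimes\cdots\otimes x_n)=x_{\sigma(\overline n)}\otimes\cdots\otimes x_{\sigma(n)}$. $\mathcal F(\mathcal K)=\bigoplus_{n\ge0}\mathcal K_n$ (algebraic), $\mathcal K_0=\mathbb C\,\Omega\otimes\Omega$ with $\Omega\otimes\Omega$ a unit vector; $\langle\cdot,\cdot\rangle_{0,0}$ is the usual inner product. $P^{(n)}_{q_+,q_-}=\sum_{\sigma\in B(n)}\phi_{q_+,q_-}(\sigma)\sigma$, $P^{(0)}_{q_+,q_-}=\mathrm{id}$, and $\langle f,g\rangle_{q_+,q_-}=\delta_{n,m}\langle f,P^{(m)}_{q_+,q_-}g\rangle_{0,0}$ for $f\in\mathcal K_n,g\in\mathcal K_m$ (a semi-inner product). $\mathsf b^*_{q_+,q_-}(x\otimes y)$ maps $x_{\overline n}\otimes\cdots\otimes x_n$ to $x\otimes x_{\overline n}\otimes\cdots\otimes x_n\otimes y$ and $\Omega\otimes\Omega$ to $x\otimes y$; $\mathsf b_{q_+,q_-}(x\otimes y)$ is its adjoint with respect to $\langle\cdot,\cdot\rangle_{q_+,q_-}$ (on the quotient by null vectors if degenerate). $G(x)=\mathsf b_{q_+,q_-}(x\otimes x)+\mathsf b^*_{q_+,q_-}(x\otimes x)$ for $x\in H_{\mathbb R}$. The distribution of $G(x)$ with respect to the vacuum state is the probability measure on $\mathbb R$ whose $n$-th moment is $\langle\Omega\otimes\Omega,G(x)^n\,\Omega\otimes\Omega\rangle_{q_+,q_-}$ for all $n\ge0$. **The measure $\mu_{q_+,q_-}$.** It is the probability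 measure on $\mathbb R$ for which the monic polynomials $Q_n$ given by $Q_{-1}=0$, $Q_0=1$ and $$tQ_n(t)=Q_{n+1}(t)+\lambda(n)Q_{n-1}(t),\quad n\ge0,\qquad \lambda(n)=1+2(n-1)q_++q_-,$$ are the orthogonal polynomials. If $\lambda(n_0)=0$ for some $n_0\ge1$, with $n_0$ minimal, the recursion is used only with $\lambda(1),\dots,\lambda(n_0-1)>0$ (later coefficients being regarded as $0$), and $\mu_{q_+,q_-}$ is the corresponding measure supported on the $n_0$ zeros of $Q_{n_0}$. *)

theory Defs
  imports
    "HOL-Probability.Probability"
    "HOL-Combinatorics.Orbits"
    "HOL-Computational_Algebra.Polynomial"
begin

section \<open>The hyperoctahedral group and the weight function\<close>

definition pm :: "nat \<Rightarrow> int set" where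
  "pm n = {- int n..int n} - {0}"

text \<open>Elements of \<open>B(n)\<close> are functions on all integers fixing everything outside \<open>[\<plusminus>n]\<close>.\<close>

definition hyperoct :: "nat \<Rightarrow> (int \<Rightarrow> int) set" where
  "hyperoct n = {\<sigma>. \<sigma> permutes pm n \<and> (\<forall>i\<in>pm n. \<sigma> (- i) = - \<sigma> i)}"

text \<open>
  A cycle of \<open>\<sigma>\<close> (fixed points included) is represented by its set of entries \<open>c\<close>; the cycle obtained
  by negating the entries is then \<open>uminus ` c\<close>. A positive cycle is an unordered pair of disjoint
  cycles \<open>{c, uminus ` c}\<close>, a negative cycle is a cycle with \<open>uminus ` c = c\<close>.
\<close>

definition cycle_sets :: "nat \<Rightarrow> (int \<Rightarrow> int) \<Rightarrow> int set set" where
  "cycle_sets n \<sigma> = orbit \<sigma> ` pm n"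

definition pos_cycles :: "nat \<Rightarrow> (int \<Rightarrow> int) \<Rightarrow> int set set set" where
  "pos_cycles n \<sigma> = {{c, uminus ` c} |c. c \<in> cycle_sets n \<sigma> \<and> c \<inter> uminus ` c = {}}"

definition neg_cycles :: "nat \<Rightarrow> (int \<Rightarrow> int) \<Rightarrow> int set set" where
  "neg_cycles n \<sigma> = {c \<in> cycle_sets n \<sigma>. uminus ` c = c}"

text \<open>
  The partitions \<open>\<rho>\<^sup>+\<close> and \<open>\<rho>\<^sup>-\<close> as multisets of parts. The union of a pair \<open>{c, uminus ` c}\<close> has
  twice as many elements as \<open>c\<close>.
\<close>

definition rho_pos :: "nat \<Rightarrow> (int \<Rightarrow> int) \<Rightarrow> nat multiset" where
  "rho_pos n \<sigma> = image_mset (\<lambda>p. card (\<Union>p) div 2) (mset_set (pos_cycles n \<sigma>))"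

definition rho_neg :: "nat \<Rightarrow> (int \<Rightarrow> int) \<Rightarrow> nat multiset" where
  "rho_neg n \<sigma> = image_mset (\<lambda>c. card c div 2) (mset_set (neg_cycles n \<sigma>))"

definition part_norm :: "nat multiset \<Rightarrow> nat" where
  "part_norm \<rho> = sum_mset \<rho> - size \<rho>"

definition weight :: "real \<Rightarrow> real \<Rightarrow> nat \<Rightarrow> (int \<Rightarrow> int) \<Rightarrow> real" where
  "weight qp qm n \<sigma> =
     qp ^ (part_norm (rho_pos n \<sigma>) + part_norm (rho_neg n \<sigma>)) * qm ^ size (rho_neg n \<sigma>)"


section \<open>The complexification and its Hilbert space tensor powers\<close>

text \<open>
  The complexification of a real Hilbert space is modelled by pairs: \<open>(u, v)\<close> stands for \<open>u + \<i> v\<close>.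
  Its inner product is linear in the second argument.
\<close>

type_synonym 'h cplx = "'h \<times> 'h"

definition cplx_of :: "'h::real_inner \<Rightarrow> 'h cplx" where
  "cplx_of x = (x, 0)"

definition cplx_inner :: "'h::real_inner cplx \<Rightarrow> 'h cplx \<Rightarrow> complex" where
  "cplx_inner z w = Complex (inner (fst z) (fst w) + inner (snd z) (snd w))
                            (inner (fst z) (snd w) - inner (snd z) (fst w))"

definition orthonormal_basis :: "'h::real_inner set \<Rightarrow> bool" where
  "orthonormal_basis E \<longleftrightarrow>
     pairwise orthogonal E \<and> (\<forall>e\<in>E. norm e = 1) \<and> closure (span E) = UNIV"

text \<open>
  The Hilbert space tensor power \<open>H\<^sup>\<otimes>\<^sup>2\<^sup>n\<close>, with factors indexed by \<open>[\<plusminus>n]\<close>, is realised as the space of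
  square-summable coefficient families with respect to the orthonormal basis
  \<open>e\<^bsub>-n\<^esub> \<otimes> \<dots> \<otimes> e\<^bsub>-1\<^esub> \<otimes> e\<^bsub>1\<^esub> \<otimes> \<dots> \<otimes> e\<^bsub>n\<^esub>\<close>, all factors taken from an orthonormal basis \<open>E\<close> of the real
  Hilbert space. For \<open>n = 0\<close> there is exactly one index, so the space is one-dimensional.
  The lemma \<open>tensor_inner_simple\<close> below is the defining property of the inner product on simple
  tensors of arbitrary vectors.
\<close>

definition idx :: "'h set \<Rightarrow> nat \<Rightarrow> (int \<Rightarrow> 'h) set" where
  "idx E n = (\<Pi>\<^sub>E i\<in>pm n. E)"

type_synonym 'h tvec = "(int \<Rightarrow> 'h) \<Rightarrow> complex"

definition tensor_space :: "'h set \<Rightarrow> nat \<Rightarrow> 'h tvec set" where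
  "tensor_space E n =
     {f. (\<forall>k. k \<notin> idx E n \<longrightarrow> f k = 0) \<and> (\<lambda>k. (cmod (f k))\<^sup>2) summable_on idx E n}"

definition tensor_inner :: "'h set \<Rightarrow> nat \<Rightarrow> 'h tvec \<Rightarrow> 'h tvec \<Rightarrow> complex" where
  "tensor_inner E n f g = (\<Sum>\<^sub>\<infinity>k\<in>idx E n. cnj (f k) * g k)"

definition tensor_norm :: "'h set \<Rightarrow> nat \<Rightarrow> 'h tvec \<Rightarrow> real" where
  "tensor_norm E n f = sqrt (Re (tensor_inner E n f f))"

definition simple_tensor :: "'h::real_inner set \<Rightarrow> nat \<Rightarrow> (int \<Rightarrow> 'h cplx) \<Rightarrow> 'h tvec" where
  "simple_tensor E n x =
     (\<lambda>k. if k \<in> idx E n then \<Prod>i\<in>pm n. cplx_inner (cplx_of (k i)) (x i) else 0)"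

text \<open>The action of \<open>B(n)\<close>; compare \<open>act_simple\<close>.\<close>

definition act :: "(int \<Rightarrow> int) \<Rightarrow> 'h tvec \<Rightarrow> 'h tvec" where
  "act \<sigma> f = (\<lambda>k. f (k \<circ> inv \<sigma>))"

definition sym_op :: "real \<Rightarrow> real \<Rightarrow> nat \<Rightarrow> 'h tvec \<Rightarrow> 'h tvec" where
  "sym_op qp qm n f = (\<lambda>k. \<Sum>\<sigma>\<in>hyperoct n. complex_of_real (weight qp qm n \<sigma>) * act \<sigma> f k)"

text \<open>The map \<open>f \<mapsto> x \<otimes> f \<otimes> y\<close> from \<open>\<K>\<^sub>n\<close> to \<open>\<K>\<^bsub>n+1\<^esub>\<close>; compare \<open>enclose_simple\<close>.\<close>

definition enclose ::
  "'h::real_inner set \<Rightarrow> 'h cplx \<Rightarrow> 'h cplx \<Rightarrow> nat \<Rightarrow> 'h tvec \<Rightarrow> 'h tvec" where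
  "enclose E x y n f = (\<lambda>k. if k \<in> idx E (Suc n)
     then cplx_inner (cplx_of (k (- int (Suc n)))) x * f (restrict k (pm n))
          * cplx_inner (cplx_of (k (int (Suc n)))) y
     else 0)"


section \<open>The Fock space\<close>

type_synonym 'h fvec = "nat \<Rightarrow> 'h tvec"

definition fock :: "'h set \<Rightarrow> 'h fvec set" where
  "fock E = {F. (\<forall>n. F n \<in> tensor_space E n) \<and> finite {n. F n \<noteq> (\<lambda>k. 0)}}"

definition fock_inner :: "real \<Rightarrow> real \<Rightarrow> 'h set \<Rightarrow> 'h fvec \<Rightarrow> 'h fvec \<Rightarrow> complex" where
  "fock_inner qp qm E F G =
     (\<Sum>n | F n \<noteq> (\<lambda>k. 0). tensor_inner E n (F n) (sym_op qp qm n (G n)))"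

definition fock_add :: "'h fvec \<Rightarrow> 'h fvec \<Rightarrow> 'h fvec" where
  "fock_add F G = (\<lambda>n k. F n k + G n k)"

definition fock_diff :: "'h fvec \<Rightarrow> 'h fvec \<Rightarrow> 'h fvec" where
  "fock_diff F G = (\<lambda>n k. F n k - G n k)"

definition vacuum :: "'h set \<Rightarrow> 'h fvec" where
  "vacuum E = (\<lambda>n k. if n = 0 \<and> k \<in> idx E 0 then 1 else 0)"

definition creation :: "'h::real_inner set \<Rightarrow> 'h cplx \<Rightarrow> 'h cplx \<Rightarrow> 'h fvec \<Rightarrow> 'h fvec" where
  "creation E x y F = (\<lambda>n. case n of 0 \<Rightarrow> (\<lambda>k. 0) | Suc m \<Rightarrow> enclose E x y m (F m))"

text \<open>
  The quotient by the null vectors of the semi-inner product. If the form is non-degenerate, all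
  classes are singletons and the quotient is the Fock space itself. Operations on the quotient are
  computed on representatives.
\<close>

definition null_rel :: "real \<Rightarrow> real \<Rightarrow> 'h set \<Rightarrow> ('h fvec \<times> 'h fvec) set" where
  "null_rel qp qm E = {(F, G). F \<in> fock E \<and> G \<in> fock E \<and>
     fock_inner qp qm E (fock_diff F G) (fock_diff F G) = 0}"

definition fclass :: "real \<Rightarrow> real \<Rightarrow> 'h set \<Rightarrow> 'h fvec \<Rightarrow> 'h fvec set" where
  "fclass qp qm E F = null_rel qp qm E `` {F}"

definition qfock :: "real \<Rightarrow> real \<Rightarrow> 'h set \<Rightarrow> 'h fvec set set" where
  "qfock qp qm E = fock E // null_rel qp qm E"

definition repr :: "'h fvec set \<Rightarrow> 'h fvec" where
  "repr X = (SOME F. F \<in> X)"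

definition qinner :: "real \<Rightarrow> real \<Rightarrow> 'h set \<Rightarrow> 'h fvec set \<Rightarrow> 'h fvec set \<Rightarrow> complex" where
  "qinner qp qm E X Y = fock_inner qp qm E (repr X) (repr Y)"

definition qadd ::
  "real \<Rightarrow> real \<Rightarrow> 'h set \<Rightarrow> 'h fvec set \<Rightarrow> 'h fvec set \<Rightarrow> 'h fvec set" where
  "qadd qp qm E X Y = fclass qp qm E (fock_add (repr X) (repr Y))"

definition qcreation ::
  "real \<Rightarrow> real \<Rightarrow> 'h::real_inner set \<Rightarrow> 'h cplx \<Rightarrow> 'h cplx \<Rightarrow> 'h fvec set \<Rightarrow> 'h fvec set" where
  "qcreation qp qm E x y X = fclass qp qm E (creation E x y (repr X))"

definition qannihilation ::
  "real \<Rightarrow> real \<Rightarrow> 'h::real_inner set \<Rightarrow> 'h cplx \<Rightarrow> 'h cplx \<Rightarrow> 'h fvec set \<Rightarrow> 'h fvec set" where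
  "qannihilation qp qm E x y X =
     (THE Z. Z \<in> qfock qp qm E \<and>
        (\<forall>Y\<in>qfock qp qm E. qinner qp qm E Z Y = qinner qp qm E X (qcreation qp qm E x y Y)))"

definition cyclic_gaussian ::
  "real \<Rightarrow> real \<Rightarrow> 'h::real_inner set \<Rightarrow> 'h \<Rightarrow> 'h fvec set \<Rightarrow> 'h fvec set" where
  "cyclic_gaussian qp qm E x X =
     qadd qp qm E (qannihilation qp qm E (cplx_of x) (cplx_of x) X)
                  (qcreation qp qm E (cplx_of x) (cplx_of x) X)"

definition vacuum_moment :: "real \<Rightarrow> real \<Rightarrow> 'h::real_inner set \<Rightarrow> 'h \<Rightarrow> nat \<Rightarrow> complex" where
  "vacuum_moment qp qm E x n =
     (let W = fclass qp qm E (vacuum E) in qinner qp qm E W ((cyclic_gaussian qp qm E x ^^ n) W))"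

definition is_vacuum_distribution ::
  "real \<Rightarrow> real \<Rightarrow> 'h::real_inner set \<Rightarrow> 'h \<Rightarrow> real measure \<Rightarrow> bool" where
  "is_vacuum_distribution qp qm E x \<kappa> \<longleftrightarrow> real_distribution \<kappa> \<and>
     (\<forall>n. integrable \<kappa> (\<lambda>t. t ^ n) \<and>
          complex_of_real (integral\<^sup>L \<kappa> (\<lambda>t. t ^ n)) = vacuum_moment qp qm E x n)"


section \<open>The measure given by the three-term recursion\<close>

definition rec_coeff :: "real \<Rightarrow> real \<Rightarrow> nat \<Rightarrow> real" where
  "rec_coeff qp qm n = 1 + 2 * (real n - 1) * qp + qm"

fun rec_poly :: "real \<Rightarrow> real \<Rightarrow> nat \<Rightarrow> real poly" where
  "rec_poly qp qm 0 = 1"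
| "rec_poly qp qm (Suc 0) = [:0, 1:]"
| "rec_poly qp qm (Suc (Suc n)) =
     [:0, 1:] * rec_poly qp qm (Suc n) - smult (rec_coeff qp qm (Suc n)) (rec_poly qp qm n)"

definition orthogonal_polys_on :: "nat set \<Rightarrow> (nat \<Rightarrow> real poly) \<Rightarrow> real measure \<Rightarrow> bool" where
  "orthogonal_polys_on I Q \<mu> \<longleftrightarrow>
     (\<forall>m\<in>I. \<forall>n\<in>I. m \<noteq> n \<longrightarrow> integral\<^sup>L \<mu> (\<lambda>t. poly (Q m) t * poly (Q n) t) = 0) \<and>
     (\<forall>n\<in>I. integral\<^sup>L \<mu> (\<lambda>t. (poly (Q n) t)\<^sup>2) > 0)"

text \<open>
  If a coefficient vanishes, with \<open>n\<^sub>0\<close> the first such index, only \<open>Q\<^sub>0, \<dots>, Q\<^bsub>n0\<^esub>\<close> are used; these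
  involve the coefficients with index less than \<open>n\<^sub>0\<close> only.
\<close>

definition is_recursion_measure :: "real \<Rightarrow> real \<Rightarrow> real measure \<Rightarrow> bool" where
  "is_recursion_measure qp qm \<mu> \<longleftrightarrow> real_distribution \<mu> \<and> (\<forall>n. integrable \<mu> (\<lambda>t. t ^ n)) \<and>
     (if \<exists>n\<ge>1. rec_coeff qp qm n = 0
      then (let n0 = (LEAST n. n \<ge> 1 \<and> rec_coeff qp qm n = 0)
            in orthogonal_polys_on {..<n0} (rec_poly qp qm) \<mu> \<and>
               (AE t in \<mu>. poly (rec_poly qp qm n0) t = 0))
      else orthogonal_polys_on UNIV (rec_poly qp qm) \<mu>)"


section \<open>The model of the tensor powers on simple tensors\<close>

lemma finite_pm [simp]: "finite (pm n)"
  by (simp add: pm_def)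

lemma act_simple:
  assumes "\<sigma> \<in> hyperoct n"
  shows "act \<sigma> (simple_tensor E n x) = simple_tensor E n (x \<circ> \<sigma>)"
proof
  fix k :: "int \<Rightarrow> 'a"
  from assms have p: "\<sigma> permutes pm n" by (simp add: hyperoct_def)
  have q: "inv \<sigma> permutes pm n" using p by (rule permutes_inv)
  have comp: "h \<circ> \<tau> \<in> idx E n" if "h \<in> idx E n" "\<tau> permutes pm n" for h :: "int \<Rightarrow> 'a" and \<tau>
    using that permutes_in_image[OF that(2)] by (auto simp: idx_def PiE_iff extensional_def)
  have "k \<circ> inv \<sigma> \<circ> \<sigma> = k"
    using permutes_inverses(2)[OF p] by (simp add: fun_eq_iff)
  then have mem: "k \<circ> inv \<sigma> \<in> idx E n \<longleftrightarrow> k \<in> idx E n"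
    using comp[OF _ p, of "k \<circ> inv \<sigma>"] comp[OF _ q, of k] by auto
  have "(\<Prod>i\<in>pm n. cplx_inner (cplx_of (k (inv \<sigma> i))) (x i))
        = (\<Prod>i\<in>pm n. cplx_inner (cplx_of (k (inv \<sigma> (\<sigma> i)))) (x (\<sigma> i)))"
    by (rule prod.permute[OF p, unfolded comp_def])
  also have "\<dots> = (\<Prod>i\<in>pm n. cplx_inner (cplx_of (k i)) (x (\<sigma> i)))"
    using permutes_inverses(2)[OF p] by simp
  finally show "act \<sigma> (simple_tensor E n x) k = simple_tensor E n (x \<circ> \<sigma>) k"
    using mem by (simp add: act_def simple_tensor_def)
qed

lemma enclose_simple:
  "enclose E x y n (simple_tensor E n z) =
   simple_tensor E (Suc n) (z(- int (Suc n) := x, int (Suc n) := y))"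
proof
  fix k :: "int \<Rightarrow> 'a"
  let ?a = "- int (Suc n)" and ?b = "int (Suc n)"
  have s: "pm (Suc n) = insert ?a (insert ?b (pm n))" by (auto simp: pm_def)
  have ni: "?a \<notin> insert ?b (pm n)" "?b \<notin> pm n" by (auto simp: pm_def)
  have r: "k \<in> idx E (Suc n) \<Longrightarrow> restrict k (pm n) \<in> idx E n"
    by (auto simp: idx_def s PiE_def)
  have p: "(\<Prod>i\<in>pm n. cplx_inner (cplx_of (restrict k (pm n) i)) (z i)) =
        (\<Prod>i\<in>pm n. cplx_inner (cplx_of (k i)) ((z(?a := x, ?b := y)) i))"
    by (rule prod.cong) (auto simp: pm_def)
  show "enclose E x y n (simple_tensor E n z) k = simple_tensor E (Suc n) (z(?a := x, ?b := y)) k"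
  proof (cases "k \<in> idx E (Suc n)")
    case True
    have "simple_tensor E (Suc n) (z(?a := x, ?b := y)) k =
      cplx_inner (cplx_of (k ?a)) x * (cplx_inner (cplx_of (k ?b)) y *
       (\<Prod>i\<in>pm n. cplx_inner (cplx_of (k i)) ((z(?a := x, ?b := y)) i)))"
      using True ni by (simp add: simple_tensor_def s del: of_nat_Suc)
    then show ?thesis
      using True r[OF True] p unfolding enclose_def simple_tensor_def by (simp add: mult_ac)
  qed (simp add: enclose_def simple_tensor_def)
qed

lemma parseval:
  fixes u v :: "'h::real_inner"
  assumes E: "orthonormal_basis E"
  shows "((\<lambda>e. inner e u * inner e v) has_sum inner u v) E"
proof -
  define pr where "pr F = (\<Sum>e\<in>F. inner e v *\<^sub>R e)" for F :: "'h set"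
  have ip: "inner e f = (if e = f then 1 else 0)" if "e \<in> E" "f \<in> E" for e f
    using E that
    by (auto simp: orthonormal_basis_def pairwise_def orthogonal_def dot_square_norm)
  have orth: "inner s (v - pr F) = 0" if F: "finite F" "F \<subseteq> E" and s: "s \<in> span F" for s F
  proof -
    have "inner f (v - pr F) = 0" if "f \<in> F" for f
    proof -
      have "inner f (pr F) = (\<Sum>e\<in>F. inner e v * inner f e)"
        by (simp add: pr_def inner_sum_right)
      also have "\<dots> = (\<Sum>e\<in>F. if e = f then inner e v else 0)"
        using F that by (intro sum.cong) (auto simp: ip subset_iff)
      finally show ?thesis using F that by (simp add: inner_diff_right)
    qed
    then show ?thesis
      using orthogonal_to_span[OF s, of "v - pr F"]
      by (simp add: orthogonal_def inner_commute)
  qed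
  show ?thesis
    unfolding has_sum_def tendsto_iff eventually_finite_subsets_at_top
  proof (intro allI impI)
    fix \<epsilon> :: real assume eps: "\<epsilon> > 0"
    define \<delta> where "\<delta> = \<epsilon> / (norm u + 1)"
    have d: "\<delta> > 0" using eps by (simp add: \<delta>_def add_nonneg_pos)
    have "v \<in> closure (span E)" using E by (simp add: orthonormal_basis_def)
    then obtain s where s: "s \<in> span E" "dist s v < \<delta>"
      using d closure_approachable by blast
    from s(1) obtain F r where F: "finite F" "F \<subseteq> E" and sF: "s = (\<Sum>a\<in>F. r a *\<^sub>R a)"
      unfolding span_explicit by blast
    have sF: "s \<in> span F" unfolding sF by (intro span_sum span_scale span_base)
    have "dist (\<Sum>e\<in>G. inner e u * inner e v) (inner u v) < \<epsilon>"
      if G: "finite G" "F \<subseteq> G" "G \<subseteq> E" for G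
    proof -
      have sG: "s \<in> span G" using sF span_mono[OF G(2)] by auto
      have "pr G \<in> span G" unfolding pr_def by (intro span_sum span_scale span_base)
      then have "inner (s - pr G) (v - pr G) = 0"
        using orth[OF G(1,3)] sG span_diff by blast
      then have "(norm (v - pr G))\<^sup>2 = inner (v - s) (v - pr G)"
        unfolding power2_norm_eq_inner by (simp add: inner_diff_left)
      also have "\<dots> \<le> norm (v - s) * norm (v - pr G)" by (rule norm_cauchy_schwarz)
      finally have "norm (v - pr G) \<le> norm (v - s)"
        by (cases "norm (v - pr G) = 0") (auto simp: power2_eq_square mult_le_cancel_right)
      then have n: "norm (v - pr G) < \<delta>" using s(2) by (simp add: dist_norm norm_minus_commute)
      have "(\<Sum>e\<in>G. inner e u * inner e v) = inner u (pr G)"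
        by (simp add: pr_def inner_sum_right inner_commute mult_ac)
      then have "dist (\<Sum>e\<in>G. inner e u * inner e v) (inner u v) = \<bar>inner u (v - pr G)\<bar>"
        by (simp add: dist_real_def inner_diff_right abs_minus_commute)
      also have "\<dots> \<le> norm u * norm (v - pr G)" by (rule Cauchy_Schwarz_ineq2)
      also have "\<dots> \<le> norm u * \<delta>" using n by (intro mult_left_mono) auto
      also have "\<dots> < (norm u + 1) * \<delta>" using d by (simp add: distrib_right)
      also have "\<dots> = \<epsilon>" using norm_ge_zero[of u] by (simp add: \<delta>_def add_nonneg_eq_0_iff)
      finally show ?thesis .
    qed
    then show "\<exists>X. finite X \<and> X \<subseteq> E \<and> (\<forall>Y. finite Y \<and> X \<subseteq> Y \<and> Y \<subseteq> E \<longrightarrow>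
        dist (\<Sum>e\<in>Y. inner e u * inner e v) (inner u v) < \<epsilon>)"
      using F by (intro exI[of _ F]) blast
  qed
qed

lemma parseval_cplx:
  assumes E: "orthonormal_basis E"
  shows "((\<lambda>e. cnj (cplx_inner (cplx_of e) z) * cplx_inner (cplx_of e) w) has_sum cplx_inner z w) E"
proof -
  let ?p = "\<lambda>u v e. complex_of_real (inner e u * inner e v)"
  have h: "(?p u v has_sum complex_of_real (inner u v)) E" for u v
    using has_sum_of_real[OF parseval[OF E]] .
  have "((\<lambda>e. ?p (fst z) (fst w) e + ?p (snd z) (snd w) e +
          (\<i> * ?p (fst z) (snd w) e + (- \<i>) * ?p (snd z) (fst w) e)) has_sum
        complex_of_real (inner (fst z) (fst w)) + complex_of_real (inner (snd z) (snd w)) +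
          (\<i> * complex_of_real (inner (fst z) (snd w)) +
           (- \<i>) * complex_of_real (inner (snd z) (fst w)))) E"
    by (intro has_sum_add has_sum_cmult_right h)
  moreover have "(\<lambda>e. ?p (fst z) (fst w) e + ?p (snd z) (snd w) e +
          (\<i> * ?p (fst z) (snd w) e + (- \<i>) * ?p (snd z) (fst w) e)) =
        (\<lambda>e. cnj (cplx_inner (cplx_of e) z) * cplx_inner (cplx_of e) w)"
    by (auto simp: cplx_inner_def cplx_of_def complex_eq_iff algebra_simps)
  moreover have "complex_of_real (inner (fst z) (fst w)) + complex_of_real (inner (snd z) (snd w)) +
          (\<i> * complex_of_real (inner (fst z) (snd w)) +
           (- \<i>) * complex_of_real (inner (snd z) (fst w))) = cplx_inner z w"
    by (auto simp: cplx_inner_def complex_eq_iff)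
  ultimately show ?thesis by simp
qed

lemma tensor_inner_simple:
  assumes E: "orthonormal_basis E"
  shows "tensor_inner E n (simple_tensor E n x) (simple_tensor E n y) =
         (\<Prod>i\<in>pm n. cplx_inner (x i) (y i))"
proof -
  let ?f = "\<lambda>i e. cnj (cplx_inner (cplx_of e) (x i)) * cplx_inner (cplx_of e) (y i)"
  have "tensor_inner E n (simple_tensor E n x) (simple_tensor E n y) =
        (\<Sum>\<^sub>\<infinity>k\<in>idx E n. \<Prod>i\<in>pm n. ?f i (k i))"
    unfolding tensor_inner_def by (rule infsum_cong) (simp add: simple_tensor_def prod.distrib)
  also have "\<dots> = (\<Prod>i\<in>pm n. infsum (?f i) E)"
    unfolding idx_def
    by (rule infsum_prod_PiE_abs)
       (simp_all only: finite_pm summable_on_iff_abs_summable_on_complex[symmetric]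
          has_sum_imp_summable[OF parseval_cplx[OF E]])
  also have "\<dots> = (\<Prod>i\<in>pm n. cplx_inner (x i) (y i))"
    by (intro prod.cong infsumI parseval_cplx E) auto
  finally show ?thesis .
qed

end

theory Submission
  imports Defs "HOL-Computational_Algebra.Fundamental_Theorem_Algebra"
begin

text \<open>
  Every element of \<open>B(n+1)\<close> is uniquely \<open>\<tau> \<circ> r\<close> with \<open>\<tau> \<in> B(n)\<close> and \<open>r\<close> the identity, the sign change of
  \<open>n+1\<close> or one of the \<open>2n\<close> double transpositions moving \<open>n+1\<close>, and the weight is multiplied by \<open>1\<close>, \<open>q\<^sub>-\<close>
  or \<open>q\<^sub>+\<close> accordingly. Hence the weights of \<open>B(n)\<close> sum to \<open>\<lambda>(1) \<cdots> \<lambda>(n)\<close>, and the vectors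
  \<open>x\<^sup>\<otimes>\<^sup>2\<^sup>n\<close> are eigenvectors of the symmetrisation operator. So \<open>G(x)\<close> acts on their span by
  \<open>x\<^sup>\<otimes>\<^sup>2\<^sup>n \<mapsto> x\<^sup>\<otimes>\<^sup>2\<^sup>n\<^sup>+\<^sup>2 + \<lambda>(n) x\<^sup>\<otimes>\<^sup>2\<^sup>n\<^sup>-\<^sup>2\<close>, which is the action of multiplication by \<open>t\<close> on the polynomials
  \<open>Q\<^sub>n\<close>; thus both measures have the same moments.

  For the quotient to make sense the weight must be positive definite: up to the sign character it is the
  normalised trace of the action of \<open>B(n)\<close> on colourings of \<open>[n]\<close> with \<open>M\<close> even and \<open>N\<close> odd colours, and for
  \<open>q\<^sub>+ = 0\<close> a variant of it in which different points never share a colour.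

  A measure with the given moments exists by Gauss quadrature at the zeros of \<open>Q\<^sub>N\<close>, followed by a weak limit
  as \<open>N \<rightarrow> \<infinity>\<close> if no \<open>\<lambda>(n)\<close> vanishes. It is unique since \<open>\<lambda>(n) = O(n)\<close> bounds its moments by Gaussian ones.
\<close>

section \<open>The hyperoctahedral group and its cycles\<close>

text \<open>On the quotient, annihilation is specified only as the class that represents a given
  functional, so the null vectors must be known exactly. Writing the kernel
  \<open>weight qp qm n (h o inv g)\<close> as a Gram matrix settles this: the form becomes an
  average of squared norms of vectors from which the symmetrised vector can be recovered, so the
  null vectors are precisely the kernel of the symmetrisation operator. Creation respects these
  kernels by the same coset recursion that computes the weights. The adjoint is computed on finite
  combinations of the tensor powers of x, where a candidate is written down and tested against
  arbitrary vectors. Both measures are compared with one sequence, \<open>jacobi_moment\<close>, the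
  vacuum entry of the n-th power of a tridiagonal operator. It is defined for arbitrary real
  coefficients. If a coefficient vanishes, the corresponding Q_n divides every later one, so both
  descriptions of the measure still say that Q_k integrates to 0 for all k > 0. For the given
  parameters the coefficients stay positive up to a possible first zero, as quadrature
  requires.\<close>

text \<open>For \<open>j = n+1\<close> this is the identity, for \<open>j = - (n+1)\<close> the sign change of \<open>n+1\<close>.\<close>

definition swap_last :: "nat \<Rightarrow> int \<Rightarrow> int \<Rightarrow> int" where
  "swap_last n j i = (if i = j then int (Suc n) else if i = int (Suc n) then j
     else if i = - j then - int (Suc n) else if i = - int (Suc n) then - j else i)"

lemma pm_Suc: "pm (Suc n) = insert (- int (Suc n)) (insert (int (Suc n)) (pm n))"
  by (auto simp: pm_def)

lemma pm_iff: "i \<in> pm n \<longleftrightarrow> i \<noteq> 0 \<and> \<bar>i\<bar> \<le> int n"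
  by (auto simp: pm_def)

lemma uminus_in_pm_iff [simp]: "- i \<in> pm n \<longleftrightarrow> i \<in> pm n"
  by (auto simp: pm_iff)

lemma card_pm: "card (pm n) = 2 * n"
proof -
  have "card (pm n) = card {- int n..int n} - card {0::int}"
    unfolding pm_def by (subst card_Diff_subset) auto
  then show ?thesis by simp
qed

lemma hyperoct_permutes: "\<sigma> \<in> hyperoct n \<Longrightarrow> \<sigma> permutes pm n"
  by (simp add: hyperoct_def)

lemma hyperoct_minus: "\<sigma> \<in> hyperoct n \<Longrightarrow> \<sigma> (- i) = - \<sigma> i"
  by (cases "i \<in> pm n") (auto simp: hyperoct_def permutes_not_in)

lemma hyperoctI: "\<sigma> permutes pm n \<Longrightarrow> (\<And>i. \<sigma> (- i) = - \<sigma> i) \<Longrightarrow> \<sigma> \<in> hyperoct n"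
  by (simp add: hyperoct_def)

lemma hyperoct_in_iff: "\<sigma> \<in> hyperoct n \<Longrightarrow> \<sigma> i \<in> pm n \<longleftrightarrow> i \<in> pm n"
  by (meson hyperoct_permutes permutes_in_image)

lemma hyperoct_not_in: "\<sigma> \<in> hyperoct n \<Longrightarrow> i \<notin> pm n \<Longrightarrow> \<sigma> i = i"
  by (meson hyperoct_permutes permutes_not_in)

lemma hyperoct_permutation: "\<sigma> \<in> hyperoct n \<Longrightarrow> permutation \<sigma>"
  using hyperoct_permutes finite_pm permutation_permutes by blast

lemma hyperoct_inj: "\<sigma> \<in> hyperoct n \<Longrightarrow> \<sigma> i = \<sigma> j \<longleftrightarrow> i = j"
  by (metis hyperoct_permutes permutes_inverses(2))

lemma finite_hyperoct [simp]: "finite (hyperoct n)"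
  by (rule finite_subset[OF _ finite_permutations[OF finite_pm[of n]]]) (auto simp: hyperoct_def)

lemma id_in_hyperoct [simp]: "id \<in> hyperoct n"
  by (simp add: hyperoct_def permutes_id)

lemma comp_in_hyperoct: "\<sigma> \<in> hyperoct n \<Longrightarrow> \<tau> \<in> hyperoct n \<Longrightarrow> \<sigma> \<circ> \<tau> \<in> hyperoct n"
  by (rule hyperoctI) (simp_all add: permutes_compose[OF hyperoct_permutes hyperoct_permutes] hyperoct_minus)

lemma inv_in_hyperoct: "\<sigma> \<in> hyperoct n \<Longrightarrow> inv \<sigma> \<in> hyperoct n"
  by (rule hyperoctI)
    (simp_all add: permutes_inv hyperoct_permutes permutes_inv_eq[OF hyperoct_permutes] hyperoct_minus
      permutes_inverses[OF hyperoct_permutes])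

lemma hyperoct_0: "hyperoct 0 = {id}"
  by (auto simp: hyperoct_def pm_def permutes_empty)

lemma hyperoct_mono: "\<sigma> \<in> hyperoct n \<Longrightarrow> \<sigma> \<in> hyperoct (Suc n)"
  by (rule hyperoctI[OF permutes_subset[OF hyperoct_permutes]]) (auto simp: pm_Suc hyperoct_minus)

lemma swap_last_in_hyperoct:
  assumes "j \<in> pm (Suc n)" shows "swap_last n j \<in> hyperoct (Suc n)"
proof (rule hyperoctI)
  have "swap_last n j (swap_last n j i) = i" for i
    using assms by (auto simp: swap_last_def pm_iff)
  then have "\<exists>!k. swap_last n j k = i" for i by metis
  moreover have "swap_last n j i = i" if "i \<notin> pm (Suc n)" for i
    using assms that by (auto simp: swap_last_def pm_iff)
  ultimately show "swap_last n j permutes pm (Suc n)"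
    by (simp add: permutes_def)
  show "swap_last n j (- i) = - swap_last n j i" for i
    using assms by (auto simp: swap_last_def pm_iff)
qed

lemma swap_last_invol: "j \<in> pm (Suc n) \<Longrightarrow> swap_last n j (swap_last n j i) = i"
  by (auto simp: swap_last_def pm_iff)

text \<open>The index j is forced: as \<tau> fixes n+1, it is the point that the composite sends to
  n+1. Composing once more with the involution \<open>swap_last n j\<close> leaves an element fixing
  both n+1 and -(n+1), that is, one of B(n).\<close>

lemma bij_betw_hyperoct_Suc:
  "bij_betw (\<lambda>(\<tau>, j). \<tau> \<circ> swap_last n j) (hyperoct n \<times> pm (Suc n)) (hyperoct (Suc n))"
  unfolding bij_betw_def
proof (intro conjI)
  let ?N = "int (Suc n)"
  have fx: "\<tau> ?N = ?N" "\<tau> (- ?N) = - ?N" if "\<tau> \<in> hyperoct n" for \<tau>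
    by (intro hyperoct_not_in[OF that]; simp add: pm_iff)+
  show "inj_on (\<lambda>(\<tau>, j). \<tau> \<circ> swap_last n j) (hyperoct n \<times> pm (Suc n))"
  proof (rule inj_onI, clarify)
    fix \<tau> j \<tau>' j' assume *: "\<tau> \<in> hyperoct n" "\<tau>' \<in> hyperoct n" "j \<in> pm (Suc n)" "j' \<in> pm (Suc n)"
      and eq: "\<tau> \<circ> swap_last n j = \<tau>' \<circ> swap_last n j'"
    have "(\<tau> \<circ> swap_last n j) j = ?N" "(\<tau>' \<circ> swap_last n j') j' = ?N"
      using fx * by (auto simp: swap_last_def)
    moreover have "\<tau>' \<circ> swap_last n j' \<in> hyperoct (Suc n)"
      using * by (intro comp_in_hyperoct hyperoct_mono swap_last_in_hyperoct)
    ultimately have jj: "j = j'" using eq hyperoct_inj by metis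
    have "\<tau> i = \<tau>' i" for i
      using fun_cong[OF eq, of "swap_last n j i"] swap_last_invol[OF *(3)] jj by simp
    then show "\<tau> = \<tau>' \<and> j = j'" using jj by auto
  qed
  show "(\<lambda>(\<tau>, j). \<tau> \<circ> swap_last n j) ` (hyperoct n \<times> pm (Suc n)) = hyperoct (Suc n)"
  proof (intro equalityI subsetI)
    fix \<sigma> assume "\<sigma> \<in> (\<lambda>(\<tau>, j). \<tau> \<circ> swap_last n j) ` (hyperoct n \<times> pm (Suc n))"
    then show "\<sigma> \<in> hyperoct (Suc n)"
      by (auto intro: comp_in_hyperoct hyperoct_mono swap_last_in_hyperoct)
  next
    fix \<sigma> assume s: "\<sigma> \<in> hyperoct (Suc n)"
    define j where "j = inv \<sigma> ?N"
    have sj: "\<sigma> j = ?N" unfolding j_def by (rule permutes_inverses(1)[OF hyperoct_permutes[OF s]])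
    have jp: "j \<in> pm (Suc n)" using hyperoct_in_iff[OF s, of j] by (simp add: sj pm_iff)
    define \<tau> where "\<tau> = \<sigma> \<circ> swap_last n j"
    have t: "\<tau> \<in> hyperoct (Suc n)"
      unfolding \<tau>_def by (intro comp_in_hyperoct s swap_last_in_hyperoct jp)
    have tN: "\<tau> ?N = ?N" using sj by (auto simp: \<tau>_def swap_last_def)
    then have tN': "\<tau> (- ?N) = - ?N" using hyperoct_minus[OF t, of ?N] by simp
    have "\<tau> permutes pm n"
      by (rule permutes_superset[OF hyperoct_permutes[OF t]]) (use tN tN' in \<open>auto simp: pm_Suc\<close>)
    then have "\<tau> \<in> hyperoct n" by (intro hyperoctI hyperoct_minus[OF t])
    moreover have "\<sigma> = \<tau> \<circ> swap_last n j"
      using swap_last_invol[OF jp] by (auto simp: \<tau>_def fun_eq_iff)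
    ultimately show "\<sigma> \<in> (\<lambda>(\<tau>, j). \<tau> \<circ> swap_last n j) ` (hyperoct n \<times> pm (Suc n))"
      using jp by force
  qed
qed

lemma hyperoct_SucE:
  assumes "\<sigma> \<in> hyperoct (Suc n)"
  obtains \<tau> j where "\<tau> \<in> hyperoct n" "j \<in> pm (Suc n)" "\<sigma> = \<tau> \<circ> swap_last n j"
proof -
  have "\<sigma> \<in> (\<lambda>(\<tau>, j). \<tau> \<circ> swap_last n j) ` (hyperoct n \<times> pm (Suc n))"
    using assms bij_betw_imp_surj_on[OF bij_betw_hyperoct_Suc[of n]] by simp
  then show ?thesis using that by auto
qed

section \<open>Cycles and the two partitions\<close>

lemma orbit_uminus:
  assumes "\<And>i. \<sigma> (- i) = - \<sigma> (i :: int)"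
  shows "uminus ` orbit \<sigma> i = orbit \<sigma> (- i)"
proof -
  have "(\<sigma> ^^ k) (- i) = - (\<sigma> ^^ k) i" for k by (induction k) (auto simp: assms)
  then show ?thesis unfolding orbit_altdef by (force simp: image_iff)
qed

context
  fixes n :: nat and \<sigma> :: "int \<Rightarrow> int"
  assumes sigma: "\<sigma> \<in> hyperoct n"
begin

lemma cycle_sets_uminus: "c \<in> cycle_sets n \<sigma> \<Longrightarrow> uminus ` c \<in> cycle_sets n \<sigma>"
  by (auto simp: cycle_sets_def orbit_uminus hyperoct_minus[OF sigma])

lemma self_in_cycle: "i \<in> orbit \<sigma> i"
  by (rule permutation_self_in_orbit[OF hyperoct_permutation[OF sigma]])

lemma orbit_eq_of_mem: "i \<in> orbit \<sigma> j \<Longrightarrow> orbit \<sigma> i = orbit \<sigma> j"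
  by (rule orbit_cyclic_eq3[OF cyclic_on_orbit'[OF hyperoct_permutation[OF sigma]]])

lemma cycle_sets_disjoint:
  "c \<in> cycle_sets n \<sigma> \<Longrightarrow> d \<in> cycle_sets n \<sigma> \<Longrightarrow> c \<inter> d \<noteq> {} \<Longrightarrow> c = d"
  unfolding cycle_sets_def using orbit_eq_of_mem by blast

lemma cycle_sets_subset: "c \<in> cycle_sets n \<sigma> \<Longrightarrow> c \<subseteq> pm n"
  unfolding cycle_sets_def using permutes_orbit_subset[OF hyperoct_permutes[OF sigma]] by auto

lemma cycle_sets_nonempty: "c \<in> cycle_sets n \<sigma> \<Longrightarrow> c \<noteq> {}"
  by (auto simp: cycle_sets_def orbit_nonempty)

lemma finite_cycle_sets: "finite (cycle_sets n \<sigma>)"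
  by (simp add: cycle_sets_def)

text \<open>Cycles are equal or disjoint, so disjointness from the negated cycle can be tested by
  inequality. In this form the condition transfers along injections that commute with
  negation.\<close>

lemma pos_cycles_eq:
  "pos_cycles n \<sigma> = (\<lambda>c. {c, uminus ` c}) ` {c \<in> cycle_sets n \<sigma>. uminus ` c \<noteq> c}"
proof -
  have "c \<inter> uminus ` c = {} \<longleftrightarrow> uminus ` c \<noteq> c" if "c \<in> cycle_sets n \<sigma>" for c
    using cycle_sets_disjoint[OF that cycle_sets_uminus[OF that]] cycle_sets_nonempty[OF that] by auto
  then show ?thesis unfolding pos_cycles_def setcompr_eq_image by (intro image_cong) auto
qed

lemma finite_pos_cycles: "finite (pos_cycles n \<sigma>)"
  unfolding pos_cycles_eq using finite_cycle_sets by simp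

lemma finite_neg_cycles: "finite (neg_cycles n \<sigma>)"
  unfolding neg_cycles_def using finite_cycle_sets by simp

text \<open>Negation exchanges the positive and negative entries. Replacing the halved cardinality
  by a count of positive entries makes the lengths of disjoint cycles additive.\<close>

lemma card_symmetric_div2:
  assumes "S \<subseteq> pm n" "uminus ` S = S"
  shows "card S div 2 = card (S \<inter> {0<..})"
proof -
  have fin: "finite S" using assms(1) finite_pm finite_subset by blast
  have "uminus ` (S \<inter> {0<..}) = S \<inter> {..<0}"
  proof (intro equalityI subsetI)
    fix i assume "i \<in> S \<inter> {..<0}"
    then have "- i \<in> S \<inter> {0<..}" using assms(2) by auto
    then show "i \<in> uminus ` (S \<inter> {0<..})" by (metis image_eqI minus_minus)
  qed (use assms in auto)
  then have "card (S \<inter> {..<0}) = card (S \<inter> {0<..})"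
    by (metis card_image inj_on_def neg_equal_iff_equal)
  moreover have "S = (S \<inter> {0<..}) \<union> (S \<inter> {..<0})" using assms(1) by (auto simp: pm_def)
  moreover have "card ((S \<inter> {0<..}) \<union> (S \<inter> {..<0})) = card (S \<inter> {0<..}) + card (S \<inter> {..<0})"
    using fin by (intro card_Un_disjoint) auto
  ultimately show ?thesis by simp
qed

lemma Union_pos_cycle:
  assumes "p \<in> pos_cycles n \<sigma>"
  obtains c where "c \<in> cycle_sets n \<sigma>" "uminus ` c \<noteq> c" "p = {c, uminus ` c}" "\<Union>p = c \<union> uminus ` c"
  using assms unfolding pos_cycles_eq by auto

lemma Union_pos_cycle_symmetric:
  assumes "p \<in> pos_cycles n \<sigma>"
  shows "\<Union>p \<subseteq> pm n" "uminus ` \<Union>p = \<Union>p" "\<Union>p \<noteq> {}"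
proof -
  obtain c where c: "c \<in> cycle_sets n \<sigma>" "\<Union>p = c \<union> uminus ` c"
    using Union_pos_cycle[OF assms] by metis
  show "\<Union>p \<subseteq> pm n" using cycle_sets_subset[OF c(1)] c(2) by auto
  show "uminus ` \<Union>p = \<Union>p" unfolding c(2) by (auto simp: image_Un image_image)
  show "\<Union>p \<noteq> {}" using c cycle_sets_nonempty by auto
qed

lemma neg_cycle_symmetric:
  assumes "c \<in> neg_cycles n \<sigma>"
  shows "c \<subseteq> pm n" "uminus ` c = c" "c \<noteq> {}"
  using assms cycle_sets_subset cycle_sets_nonempty by (auto simp: neg_cycles_def)

lemma card_symmetric_div2_pos:
  assumes "S \<subseteq> pm n" "uminus ` S = S" "S \<noteq> {}"
  shows "card S div 2 \<ge> 1"
proof -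
  obtain i where i: "i \<in> S" using assms(3) by auto
  then have "\<bar>i\<bar> \<in> S \<inter> {0<..}" using assms(1,2) by (auto simp: pm_def abs_if)
  moreover have "finite S" using assms(1) finite_pm finite_subset by blast
  ultimately show ?thesis
    unfolding card_symmetric_div2[OF assms(1,2)] by (metis One_nat_def Suc_leI card_gt_0_iff empty_iff finite_Int)
qed

text \<open>The positive entries of the positive and negative cycles partition {1..n}.\<close>

lemma sum_rho: "sum_mset (rho_pos n \<sigma>) + sum_mset (rho_neg n \<sigma>) = n"
proof -
  let ?P = "{0<..} :: int set"
  have fin: "finite (S \<inter> ?P)" if "S \<subseteq> pm n" for S
    using that finite_pm finite_subset by blast
  have "sum_mset (rho_pos n \<sigma>) = (\<Sum>p\<in>pos_cycles n \<sigma>. card (\<Union>p \<inter> ?P))"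
    unfolding rho_pos_def sum_unfold_sum_mset
    using card_symmetric_div2[OF Union_pos_cycle_symmetric(1,2)] finite_pos_cycles
    by (intro arg_cong[where f = sum_mset] image_mset_cong) auto
  also have "\<dots> = card (\<Union>p\<in>pos_cycles n \<sigma>. \<Union>p \<inter> ?P)"
  proof (rule card_UN_disjoint[symmetric])
    show "\<forall>p\<in>pos_cycles n \<sigma>. \<forall>q\<in>pos_cycles n \<sigma>. p \<noteq> q \<longrightarrow> \<Union>p \<inter> ?P \<inter> (\<Union>q \<inter> ?P) = {}"
    proof (intro ballI impI)
      fix p q assume p: "p \<in> pos_cycles n \<sigma>" and q: "q \<in> pos_cycles n \<sigma>" and ne: "p \<noteq> q"
      obtain c where c: "c \<in> cycle_sets n \<sigma>" "p = {c, uminus ` c}" using Union_pos_cycle[OF p] by metis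
      obtain d where d: "d \<in> cycle_sets n \<sigma>" "q = {d, uminus ` d}" using Union_pos_cycle[OF q] by metis
      \<comment> \<open>Two pairs with a common entry share a cycle, and a pair is determined by
        either of its cycles.\<close>
      have "a = b" if "a \<in> p" "b \<in> q" "a \<inter> b \<noteq> {}" for a b
      proof -
        have "a \<in> cycle_sets n \<sigma>" "b \<in> cycle_sets n \<sigma>"
          using that c d cycle_sets_uminus by auto
        then show ?thesis using that(3) by (rule cycle_sets_disjoint)
      qed
      moreover have "p = q" if "a \<in> p" "a \<in> q" for a
      proof -
        have "p = {a, uminus ` a}" using that(1) unfolding c(2) by (elim insertE emptyE) (simp_all add: image_image insert_commute)
        moreover have "q = {a, uminus ` a}" using that(2) unfolding d(2) by (elim insertE emptyE) (simp_all add: image_image insert_commute)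
        ultimately show ?thesis by simp
      qed
      ultimately have "\<Union>p \<inter> \<Union>q = {}" using ne by blast
      then show "\<Union>p \<inter> ?P \<inter> (\<Union>q \<inter> ?P) = {}" by blast
    qed
    show "\<forall>p\<in>pos_cycles n \<sigma>. finite (\<Union>p \<inter> ?P)" using fin Union_pos_cycle_symmetric(1) by blast
  qed (rule finite_pos_cycles)
  finally have 1: "sum_mset (rho_pos n \<sigma>) = card (\<Union>p\<in>pos_cycles n \<sigma>. \<Union>p \<inter> ?P)" .
  have "sum_mset (rho_neg n \<sigma>) = (\<Sum>c\<in>neg_cycles n \<sigma>. card (c \<inter> ?P))"
    unfolding rho_neg_def sum_unfold_sum_mset
    using card_symmetric_div2[OF neg_cycle_symmetric(1,2)] finite_neg_cycles
    by (intro arg_cong[where f = sum_mset] image_mset_cong) auto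
  also have "\<dots> = card (\<Union>c\<in>neg_cycles n \<sigma>. c \<inter> ?P)"
  proof (rule card_UN_disjoint[symmetric])
    show "\<forall>c\<in>neg_cycles n \<sigma>. finite (c \<inter> ?P)" using fin neg_cycle_symmetric(1) by blast
    show "\<forall>c\<in>neg_cycles n \<sigma>. \<forall>d\<in>neg_cycles n \<sigma>. c \<noteq> d \<longrightarrow> c \<inter> ?P \<inter> (d \<inter> ?P) = {}"
    proof (intro ballI impI)
      fix c d assume "c \<in> neg_cycles n \<sigma>" "d \<in> neg_cycles n \<sigma>" "c \<noteq> d"
      then have "c \<inter> d = {}" using cycle_sets_disjoint[of c d] by (auto simp: neg_cycles_def)
      then show "c \<inter> ?P \<inter> (d \<inter> ?P) = {}" by blast
    qed
  qed (rule finite_neg_cycles)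
  finally have 2: "sum_mset (rho_neg n \<sigma>) = card (\<Union>c\<in>neg_cycles n \<sigma>. c \<inter> ?P)" .
  have disj: "(\<Union>p\<in>pos_cycles n \<sigma>. \<Union>p \<inter> ?P) \<inter> (\<Union>c\<in>neg_cycles n \<sigma>. c \<inter> ?P) = {}"
  proof -
    have False if pd: "p \<in> pos_cycles n \<sigma>" "d \<in> neg_cycles n \<sigma>" "i \<in> \<Union>p" "i \<in> d" for p d i
    proof -
      obtain c where c: "c \<in> cycle_sets n \<sigma>" "uminus ` c \<noteq> c" "\<Union>p = c \<union> uminus ` c"
        using Union_pos_cycle[OF pd(1)] by metis
      have "c = d \<or> uminus ` c = d"
      proof -
        have "d \<in> cycle_sets n \<sigma>" using pd(2) by (simp add: neg_cycles_def)
        then show ?thesis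
          using pd(3,4) c(3) cycle_sets_disjoint[OF c(1), of d]
            cycle_sets_disjoint[OF cycle_sets_uminus[OF c(1)], of d] by blast
      qed
      then have "uminus ` c = c" using neg_cycle_symmetric(2)[OF pd(2)] by (auto simp: image_image)
      then show False using c by simp
    qed
    then show ?thesis by blast
  qed
  have cov: "(\<Union>p\<in>pos_cycles n \<sigma>. \<Union>p \<inter> ?P) \<union> (\<Union>c\<in>neg_cycles n \<sigma>. c \<inter> ?P) = {1..int n}"
  proof (intro equalityI subsetI)
    fix i assume "i \<in> {1..int n}"
    then have ip: "i \<in> pm n" "i > 0" by (auto simp: pm_def)
    then have o: "orbit \<sigma> i \<in> cycle_sets n \<sigma>" "i \<in> orbit \<sigma> i"
      using self_in_cycle by (auto simp: cycle_sets_def)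
    show "i \<in> (\<Union>p\<in>pos_cycles n \<sigma>. \<Union>p \<inter> ?P) \<union> (\<Union>c\<in>neg_cycles n \<sigma>. c \<inter> ?P)"
    proof (cases "uminus ` orbit \<sigma> i = orbit \<sigma> i")
      case True
      then show ?thesis using o ip by (auto simp: neg_cycles_def)
    next
      case False
      then have "{orbit \<sigma> i, uminus ` orbit \<sigma> i} \<in> pos_cycles n \<sigma>" using o by (auto simp: pos_cycles_eq)
      then show ?thesis using o ip by blast
    qed
  next
    fix i assume "i \<in> (\<Union>p\<in>pos_cycles n \<sigma>. \<Union>p \<inter> ?P) \<union> (\<Union>c\<in>neg_cycles n \<sigma>. c \<inter> ?P)"
    moreover have "(\<Union>p\<in>pos_cycles n \<sigma>. \<Union>p \<inter> ?P) \<subseteq> pm n \<inter> ?P"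
      by (intro UN_least Int_mono Union_pos_cycle_symmetric(1) order_refl)
    moreover have "(\<Union>c\<in>neg_cycles n \<sigma>. c \<inter> ?P) \<subseteq> pm n \<inter> ?P"
      by (intro UN_least Int_mono neg_cycle_symmetric(1) order_refl)
    ultimately have "i \<in> pm n \<inter> ?P" by (meson UnE subsetD)
    then show "i \<in> {1..int n}" by (simp add: pm_def)
  qed
  have "n = card {1..int n}" by simp
  also have "\<dots> = card (\<Union>p\<in>pos_cycles n \<sigma>. \<Union>p \<inter> ?P) + card (\<Union>c\<in>neg_cycles n \<sigma>. c \<inter> ?P)"
  proof -
    have "finite ((\<Union>p\<in>pos_cycles n \<sigma>. \<Union>p \<inter> ?P) \<union> (\<Union>c\<in>neg_cycles n \<sigma>. c \<inter> ?P))" unfolding cov by simp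
    then show ?thesis unfolding cov[symmetric] by (intro card_Un_disjoint disj) auto
  qed
  finally show ?thesis using 1 2 by simp
qed

lemma size_image_mset_le:
  assumes "finite A" "\<And>a. a \<in> A \<Longrightarrow> f a \<ge> (1::nat)"
  shows "card A \<le> sum_mset (image_mset f (mset_set A))"
proof -
  have "card A = (\<Sum>a\<in>A. 1)" by simp
  also have "\<dots> \<le> sum f A" using assms by (intro sum_mono) auto
  finally show ?thesis by (simp add: sum_unfold_sum_mset)
qed

lemma size_rho: "size (rho_pos n \<sigma>) = card (pos_cycles n \<sigma>)" "size (rho_neg n \<sigma>) = card (neg_cycles n \<sigma>)"
  by (simp_all add: rho_pos_def rho_neg_def)

lemma size_rho_le: "size (rho_pos n \<sigma>) \<le> sum_mset (rho_pos n \<sigma>)" "size (rho_neg n \<sigma>) \<le> sum_mset (rho_neg n \<sigma>)"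
  unfolding size_rho unfolding rho_pos_def rho_neg_def
  by (intro size_image_mset_le finite_pos_cycles finite_neg_cycles card_symmetric_div2_pos
      Union_pos_cycle_symmetric neg_cycle_symmetric; assumption)+

lemma card_cycles_le: "card (pos_cycles n \<sigma>) + card (neg_cycles n \<sigma>) \<le> n"
  using size_rho_le sum_rho by (simp add: size_rho)

text \<open>The exponents of \<open>qp\<close> add up to n minus the number of cycles, so only the
  numbers of positive and negative cycles matter. The natural subtractions in
  \<open>part_norm\<close> are exact because every part is at least 1.\<close>

lemma weight_eq:
  "weight qp qm n \<sigma> = qp ^ (n - (card (pos_cycles n \<sigma>) + card (neg_cycles n \<sigma>))) * qm ^ card (neg_cycles n \<sigma>)"
proof -
  have "part_norm (rho_pos n \<sigma>) + part_norm (rho_neg n \<sigma>) = n - (card (pos_cycles n \<sigma>) + card (neg_cycles n \<sigma>))"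
    using size_rho_le sum_rho unfolding part_norm_def size_rho by simp
  then show ?thesis by (simp add: weight_def size_rho)
qed

end

lemma uminus_pm [simp]: "uminus ` pm n = pm n"
  by (auto simp: image_iff pm_iff intro!: bexI[of _ "- i" for i])

lemma uminus_image_Int_pm: "uminus ` (c \<inter> pm n) = uminus ` c \<inter> pm n"
  by (subst image_Int) auto

text \<open>Negation acts on the set of cycles; negative cycles are its fixed points and positive
  cycles its two-element orbits. An equivariant bijection preserves both kinds.\<close>

lemma card_cycles_bij:
  assumes s: "\<sigma> \<in> hyperoct m" and t: "\<tau> \<in> hyperoct n"
    and bij: "bij_betw f (cycle_sets m \<sigma>) (cycle_sets n \<tau>)"
    and um: "\<And>c. f (uminus ` c) = uminus ` f c"
  shows "card (pos_cycles m \<sigma>) = card (pos_cycles n \<tau>)"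
    "card (neg_cycles m \<sigma>) = card (neg_cycles n \<tau>)"
proof -
  have inj: "inj_on f (cycle_sets m \<sigma>)" and im: "f ` cycle_sets m \<sigma> = cycle_sets n \<tau>"
    using bij by (auto simp: bij_betw_def)
  have eq: "uminus ` f c = f c \<longleftrightarrow> uminus ` c = c" if "c \<in> cycle_sets m \<sigma>" for c
    using inj_onD[OF inj, of "uminus ` c" c] that cycle_sets_uminus[OF s that] um[of c] by auto
  have "neg_cycles n \<tau> = f ` neg_cycles m \<sigma>"
    unfolding neg_cycles_def im[symmetric] using eq by (auto simp del: image_eqI)
  moreover have "inj_on f (neg_cycles m \<sigma>)"
    by (rule inj_on_subset[OF inj]) (auto simp: neg_cycles_def)
  ultimately show "card (neg_cycles m \<sigma>) = card (neg_cycles n \<tau>)" by (simp add: card_image)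
  have "{c \<in> cycle_sets n \<tau>. uminus ` c \<noteq> c} = f ` {c \<in> cycle_sets m \<sigma>. uminus ` c \<noteq> c}"
    unfolding im[symmetric]
  proof (intro equalityI subsetI)
    fix d assume "d \<in> {c \<in> f ` cycle_sets m \<sigma>. uminus ` c \<noteq> c}"
    then obtain c where c: "c \<in> cycle_sets m \<sigma>" "d = f c" "uminus ` d \<noteq> d" by blast
    then have "uminus ` c \<noteq> c" using eq[OF c(1)] by simp
    then show "d \<in> f ` {c \<in> cycle_sets m \<sigma>. uminus ` c \<noteq> c}" using c by blast
  next
    fix d assume "d \<in> f ` {c \<in> cycle_sets m \<sigma>. uminus ` c \<noteq> c}"
    then show "d \<in> {c \<in> f ` cycle_sets m \<sigma>. uminus ` c \<noteq> c}" using eq by fastforce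
  qed
  then have "pos_cycles n \<tau> = image f ` pos_cycles m \<sigma>"
    by (simp add: pos_cycles_eq[OF s] pos_cycles_eq[OF t] image_image um)
  moreover have "inj_on (image f) (pos_cycles m \<sigma>)"
    by (rule inj_on_subset[OF inj_on_image_Pow[OF inj]])
      (auto simp: pos_cycles_eq[OF s] cycle_sets_uminus[OF s])
  ultimately show "card (pos_cycles m \<sigma>) = card (pos_cycles n \<tau>)" by (simp add: card_image)
qed

section \<open>Effect of the coset representatives on cycles and weight\<close>

lemma swap_last_self: "swap_last n (int (Suc n)) = id"
  by (auto simp: swap_last_def fun_eq_iff)

lemma Collect_insert_if:
  "{c \<in> insert a A. P c} = (if P a then insert a {c \<in> A. P c} else {c \<in> A. P c})"
  by auto

context
  fixes n :: nat and \<tau> :: "int \<Rightarrow> int"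
  assumes tau: "\<tau> \<in> hyperoct n"
begin

lemma fixes_last: "\<tau> (int (Suc n)) = int (Suc n)" "\<tau> (- int (Suc n)) = - int (Suc n)"
  by (intro hyperoct_not_in[OF tau]; simp add: pm_iff)+

text \<open>\<open>\<tau>\<close> is the first return map of \<open>\<tau> \<circ> swap_last n j\<close> to \<open>pm n\<close>.\<close>

lemma orbit_comp_swap_last:
  assumes j: "j \<in> pm n" and i: "i \<in> pm n"
  shows "orbit (\<tau> \<circ> swap_last n j) i \<inter> pm n = orbit \<tau> i"
proof -
  define \<sigma> where "\<sigma> = \<tau> \<circ> swap_last n j"
  let ?N = "int (Suc n)"
  have jN: "j \<noteq> ?N" "j \<noteq> - ?N" "j \<noteq> - j" using j by (auto simp: pm_iff)
  have s1: "\<sigma> j = ?N" "\<sigma> (- j) = - ?N" "\<sigma> ?N = \<tau> j" "\<sigma> (- ?N) = \<tau> (- j)"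
    using jN fixes_last j by (auto simp: \<sigma>_def swap_last_def pm_iff)
  have s2: "\<sigma> y = \<tau> y" if "y \<in> pm n" "y \<noteq> j" "y \<noteq> - j" for y
    using that by (auto simp: \<sigma>_def swap_last_def pm_iff)
  have tp: "\<tau> y \<in> pm n \<longleftrightarrow> y \<in> pm n" for y by (rule hyperoct_in_iff[OF tau])
  have Npm: "?N \<notin> pm n" "- ?N \<notin> pm n" by (auto simp: pm_iff)
  \<comment> \<open>The induction has to follow the detour through the new points: \<sigma> enters
    n+1 only from j and -(n+1) only from -j, so a visit there is recorded as j or -j lying on the
    orbit of \<tau>.\<close>
  have "y \<in> orbit \<sigma> i \<Longrightarrow> (y \<in> pm n \<longrightarrow> y \<in> orbit \<tau> i) \<and> (y = ?N \<longrightarrow> j \<in> orbit \<tau> i) \<and>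
      (y = - ?N \<longrightarrow> - j \<in> orbit \<tau> i) \<and> (y \<in> pm n \<or> y = ?N \<or> y = - ?N)" for y
  proof (induction rule: orbit.induct)
    case base
    have "i \<in> orbit \<tau> i" by (rule self_in_cycle[OF tau])
    then show ?case using s1 s2[OF i] i tp[of i] Npm
      by (cases "i = j"; cases "i = - j") (auto intro: orbit.intros)
  next
    case (step y)
    consider "y \<in> pm n" "y \<noteq> j" "y \<noteq> - j" | "y = j" | "y = - j" | "y = ?N" | "y = - ?N"
      using step by blast
    then show ?case
    proof cases
      case 1
      then have "\<tau> y \<in> pm n" "\<tau> y \<in> orbit \<tau> i" using step.IH tp by (auto intro: orbit.step)
      then show ?thesis using s2[OF 1] Npm by auto
    next
      case 2
      then have "j \<in> orbit \<tau> i" using step.IH j by simp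
      then show ?thesis using s1 2 Npm by auto
    next
      case 3
      then have "- j \<in> orbit \<tau> i" using step.IH j by simp
      then show ?thesis using s1 3 Npm by auto
    next
      case 4
      then have "\<tau> j \<in> orbit \<tau> i" using step.IH by (auto intro: orbit.step)
      moreover have "\<tau> j \<in> pm n" using tp j by simp
      ultimately show ?thesis using s1 4 Npm by auto
    next
      case 5
      then have "\<tau> (- j) \<in> orbit \<tau> i" using step.IH by (auto intro: orbit.step)
      moreover have "\<tau> (- j) \<in> pm n" using tp j by simp
      ultimately show ?thesis using s1 5 Npm by auto
    qed
  qed
  \<comment> \<open>Conversely, one step of \<tau> is one step of \<sigma>, or two when it starts at
    j or -j.\<close>
  moreover have "y \<in> orbit \<tau> i \<Longrightarrow> y \<in> orbit \<sigma> i \<and> y \<in> pm n" for y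
  proof (induction rule: orbit.induct)
    case base
    have "\<tau> i \<in> orbit \<sigma> i"
    proof (cases "i = j \<or> i = - j")
      case True
      then have "\<sigma> (\<sigma> i) = \<tau> i" using s1 by auto
      then show ?thesis by (metis orbit.base orbit.step)
    next
      case False
      then show ?thesis using s2[OF i] by (metis orbit.base)
    qed
    then show ?case using tp i by auto
  next
    case (step y)
    have "\<tau> y \<in> orbit \<sigma> i"
    proof (cases "y = j \<or> y = - j")
      case True
      then have "\<sigma> (\<sigma> y) = \<tau> y" using s1 by auto
      then show ?thesis using step.IH by (metis orbit.step)
    next
      case False
      then show ?thesis using s2 step.IH by (metis orbit.step)
    qed
    then show ?case using tp step.IH by auto
  qed
  ultimately show ?thesis unfolding \<sigma>_def[symmetric] by blast
qed

text \<open>Inserting n+1 after j and -(n+1) after -j lengthens existing cycles without creating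
  any. Cutting each cycle back to \<open>pm n\<close> is the required bijection, and it commutes
  with negation.\<close>

lemma card_cycles_comp_swap_last:
  assumes j: "j \<in> pm n"
  shows "card (pos_cycles (Suc n) (\<tau> \<circ> swap_last n j)) = card (pos_cycles n \<tau>)"
    "card (neg_cycles (Suc n) (\<tau> \<circ> swap_last n j)) = card (neg_cycles n \<tau>)"
proof -
  define \<sigma> where "\<sigma> = \<tau> \<circ> swap_last n j"
  let ?N = "int (Suc n)"
  have jS: "j \<in> pm (Suc n)" using j by (auto simp: pm_Suc)
  have s: "\<sigma> \<in> hyperoct (Suc n)" unfolding \<sigma>_def
    by (intro comp_in_hyperoct hyperoct_mono[OF tau] swap_last_in_hyperoct jS)
  have sj: "\<sigma> j = ?N" "\<sigma> (- j) = - ?N"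
    using j fixes_last by (auto simp: \<sigma>_def swap_last_def pm_iff)
  have "orbit \<sigma> ?N = orbit \<sigma> j" "orbit \<sigma> (- ?N) = orbit \<sigma> (- j)"
    using permutation_orbit_step[OF hyperoct_permutation[OF s]] sj by metis+
  then have cs: "cycle_sets (Suc n) \<sigma> = orbit \<sigma> ` pm n"
    using j by (auto simp: cycle_sets_def pm_Suc simp del: of_nat_Suc)
  have cut: "orbit \<sigma> i \<inter> pm n = orbit \<tau> i" if "i \<in> pm n" for i
    unfolding \<sigma>_def by (rule orbit_comp_swap_last[OF j that])
  have "inj_on (\<lambda>c. c \<inter> pm n) (orbit \<sigma> ` pm n)"
  proof (rule inj_onI, clarify)
    fix i k assume ik: "i \<in> pm n" "k \<in> pm n" and "orbit \<sigma> i \<inter> pm n = orbit \<sigma> k \<inter> pm n"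
    then have "i \<in> orbit \<sigma> k" using self_in_cycle[OF s, of i] by blast
    then show "orbit \<sigma> i = orbit \<sigma> k" by (rule orbit_eq_of_mem[OF s])
  qed
  moreover have "(\<lambda>c. c \<inter> pm n) ` (orbit \<sigma> ` pm n) = cycle_sets n \<tau>"
    unfolding cycle_sets_def image_image by (rule image_cong) (simp_all add: cut)
  ultimately have bij: "bij_betw (\<lambda>c. c \<inter> pm n) (cycle_sets (Suc n) \<sigma>) (cycle_sets n \<tau>)"
    by (simp add: bij_betw_def cs)
  show "card (pos_cycles (Suc n) (\<tau> \<circ> swap_last n j)) = card (pos_cycles n \<tau>)"
    "card (neg_cycles (Suc n) (\<tau> \<circ> swap_last n j)) = card (neg_cycles n \<tau>)"
    using card_cycles_bij[OF s tau bij] uminus_image_Int_pm unfolding \<sigma>_def by auto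
qed

lemma cycle_sets_extend:
  assumes "\<And>i. i \<in> pm n \<Longrightarrow> \<sigma> i = \<tau> i"
  shows "cycle_sets (Suc n) \<sigma> = {orbit \<sigma> (int (Suc n)), orbit \<sigma> (- int (Suc n))} \<union> cycle_sets n \<tau>"
proof -
  have "orbit \<tau> i = orbit \<sigma> i" if "i \<in> pm n" for i
    by (rule orbit_cong0[OF that]) (use assms hyperoct_in_iff[OF tau] in auto)
  then show ?thesis by (auto simp: cycle_sets_def pm_Suc)
qed

lemma card_cycles_Suc:
  "card (pos_cycles (Suc n) \<tau>) = Suc (card (pos_cycles n \<tau>))"
  "card (neg_cycles (Suc n) \<tau>) = card (neg_cycles n \<tau>)"
proof -
  let ?N = "int (Suc n)"
  have o: "orbit \<tau> ?N = {?N}" "orbit \<tau> (- ?N) = {- ?N}"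
    using fixes_last by (auto simp: orbit_eq_singleton_iff)
  have cs: "cycle_sets (Suc n) \<tau> = {{?N}, {- ?N}} \<union> cycle_sets n \<tau>"
    using cycle_sets_extend[of \<tau>] by (simp only: o)
  have ne: "uminus ` {?N} \<noteq> {?N}" "uminus ` {- ?N} \<noteq> {- ?N}" by simp_all
  show "card (neg_cycles (Suc n) \<tau>) = card (neg_cycles n \<tau>)"
    unfolding neg_cycles_def cs Un_insert_left Un_empty_left Collect_insert_if using ne by (simp only: if_False)
  have "pos_cycles (Suc n) \<tau> = insert {{?N}, {- ?N}} (pos_cycles n \<tau>)"
    unfolding pos_cycles_eq[OF tau] pos_cycles_eq[OF hyperoct_mono[OF tau]] cs Un_insert_left Un_empty_left
      Collect_insert_if if_P[OF ne(1)] if_P[OF ne(2)] by (simp add: insert_commute del: of_nat_Suc)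
  moreover have "{{?N}, {- ?N}} \<notin> pos_cycles n \<tau>"
  proof
    assume "{{?N}, {- ?N}} \<in> pos_cycles n \<tau>"
    from Union_pos_cycle_symmetric(1)[OF tau this] show False by (auto simp: pm_iff)
  qed
  ultimately show "card (pos_cycles (Suc n) \<tau>) = Suc (card (pos_cycles n \<tau>))"
    using finite_pos_cycles[OF tau] by simp
qed

text \<open>The points n+1 and -(n+1) now form one cycle, which is its own negative; all other
  cycles are those of \<tau>.\<close>

lemma card_cycles_comp_flip:
  "card (pos_cycles (Suc n) (\<tau> \<circ> swap_last n (- int (Suc n)))) = card (pos_cycles n \<tau>)"
  "card (neg_cycles (Suc n) (\<tau> \<circ> swap_last n (- int (Suc n)))) = Suc (card (neg_cycles n \<tau>))"
proof -
  let ?N = "int (Suc n)"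
  define \<sigma> where "\<sigma> = \<tau> \<circ> swap_last n (- ?N)"
  have s: "\<sigma> \<in> hyperoct (Suc n)" unfolding \<sigma>_def
    by (intro comp_in_hyperoct hyperoct_mono[OF tau] swap_last_in_hyperoct) (simp add: pm_iff)
  have sN: "\<sigma> ?N = - ?N" "\<sigma> (- ?N) = ?N" using fixes_last by (auto simp: \<sigma>_def swap_last_def)
  have "y \<in> orbit \<sigma> ?N \<longleftrightarrow> y = ?N \<or> y = - ?N" "y \<in> orbit \<sigma> (- ?N) \<longleftrightarrow> y = ?N \<or> y = - ?N" for y
  proof -
    have "y \<in> orbit \<sigma> i \<Longrightarrow> i = ?N \<or> i = - ?N \<Longrightarrow> y = ?N \<or> y = - ?N" for i
      by (induction rule: orbit.induct) (use sN in auto)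
    moreover have "?N \<in> orbit \<sigma> ?N" "- ?N \<in> orbit \<sigma> ?N" "?N \<in> orbit \<sigma> (- ?N)" "- ?N \<in> orbit \<sigma> (- ?N)"
      using orbit.base[of \<sigma> ?N] orbit.base[of \<sigma> "- ?N"] orbit.step[of "- ?N" \<sigma> ?N]
        orbit.step[of "?N" \<sigma> "- ?N"] unfolding sN by blast+
    ultimately show "y \<in> orbit \<sigma> ?N \<longleftrightarrow> y = ?N \<or> y = - ?N" "y \<in> orbit \<sigma> (- ?N) \<longleftrightarrow> y = ?N \<or> y = - ?N"
      by blast+
  qed
  then have o: "orbit \<sigma> ?N = {?N, - ?N}" "orbit \<sigma> (- ?N) = {?N, - ?N}" by blast+
  have "\<sigma> i = \<tau> i" if "i \<in> pm n" for i
    using that by (auto simp: \<sigma>_def swap_last_def pm_iff)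
  then have cs: "cycle_sets (Suc n) \<sigma> = insert {?N, - ?N} (cycle_sets n \<tau>)"
    using cycle_sets_extend[of \<sigma>] by (simp only: o) auto
  have u: "uminus ` {?N, - ?N} = {?N, - ?N}" by auto
  have notin: "c \<in> cycle_sets n \<tau> \<Longrightarrow> ?N \<notin> c" for c
    using cycle_sets_subset[OF tau, of c] by (auto simp: pm_iff)
  have "neg_cycles (Suc n) \<sigma> = insert {?N, - ?N} (neg_cycles n \<tau>)"
    unfolding neg_cycles_def cs Collect_insert_if if_P[OF u] ..
  moreover have "{?N, - ?N} \<notin> neg_cycles n \<tau>" using notin by (auto simp: neg_cycles_def simp del: of_nat_Suc)
  ultimately have "card (neg_cycles (Suc n) \<sigma>) = Suc (card (neg_cycles n \<tau>))"
    using finite_neg_cycles[OF tau] by simp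
  moreover have "pos_cycles (Suc n) \<sigma> = pos_cycles n \<tau>"
    unfolding pos_cycles_eq[OF tau] pos_cycles_eq[OF s] cs Collect_insert_if using u by (simp only: not_not if_False simp_thms)
  ultimately show "card (pos_cycles (Suc n) (\<tau> \<circ> swap_last n (- int (Suc n)))) = card (pos_cycles n \<tau>)"
  "card (neg_cycles (Suc n) (\<tau> \<circ> swap_last n (- int (Suc n)))) = Suc (card (neg_cycles n \<tau>))"
    by (simp_all add: \<sigma>_def)
qed

text \<open>As the exponent of \<open>qp\<close> is n minus the number of cycles, passing to n+1
  raises it exactly when no cycle is added. A new cycle leaves it unchanged and contributes
  \<open>qm\<close> if it is negative.\<close>

lemma weight_comp_swap_last:
  assumes "j \<in> pm (Suc n)"
  shows "weight qp qm (Suc n) (\<tau> \<circ> swap_last n j) = weight qp qm n \<tau> *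
    (if j = int (Suc n) then 1 else if j = - int (Suc n) then qm else qp)"
proof -
  have s: "\<tau> \<circ> swap_last n j \<in> hyperoct (Suc n)"
    by (intro comp_in_hyperoct hyperoct_mono[OF tau] swap_last_in_hyperoct assms)
  note le = card_cycles_le[OF tau]
  note w = weight_eq[OF s] weight_eq[OF tau]
  consider "j = int (Suc n)" | "j = - int (Suc n)" | "j \<in> pm n" using assms by (auto simp: pm_Suc)
  then show ?thesis
  proof cases
    case 1
    then have "\<tau> \<circ> swap_last n j = \<tau>" by (simp only: swap_last_self) simp
    then show ?thesis using w 1 card_cycles_Suc by simp
  next
    case 2
    then show ?thesis using w card_cycles_comp_flip by simp
  next
    case 3
    then have "j \<noteq> int (Suc n)" "j \<noteq> - int (Suc n)" by (auto simp: pm_iff)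
    then show ?thesis using w card_cycles_comp_swap_last[OF 3] le by (simp add: Suc_diff_le)
  qed
qed

end

lemma weight_0: "weight qp qm 0 id = 1"
proof -
  have "pm 0 = {}" by (auto simp: pm_def)
  then show ?thesis by (simp add: weight_eq[OF id_in_hyperoct] pos_cycles_def neg_cycles_def cycle_sets_def)
qed

lemma sum_hyperoct_Suc:
  "(\<Sum>\<sigma>\<in>hyperoct (Suc n). f \<sigma>) = (\<Sum>\<tau>\<in>hyperoct n. \<Sum>j\<in>pm (Suc n). f (\<tau> \<circ> swap_last n j))"
  by (simp add: sum.reindex_bij_betw[OF bij_betw_hyperoct_Suc, symmetric] sum.cartesian_product case_prod_beta')

lemma sum_weight: "(\<Sum>\<sigma>\<in>hyperoct n. weight qp qm n \<sigma>) = (\<Prod>k=1..n. rec_coeff qp qm k)"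
proof (induction n)
  case (Suc n)
  have "(\<Sum>j\<in>pm (Suc n). if j = int (Suc n) then 1 else if j = - int (Suc n) then qm else qp)
      = qm + 1 + (\<Sum>j\<in>pm n. qp)"
  proof -
    let ?w = "\<lambda>j. if j = int (Suc n) then 1 else if j = - int (Suc n) then qm else qp"
    have "sum ?w (pm (Suc n)) = ?w (- int (Suc n)) + (?w (int (Suc n)) + sum ?w (pm n))"
      unfolding pm_Suc by (subst sum.insert; (subst sum.insert)?) (auto simp: pm_iff)
    also have "sum ?w (pm n) = (\<Sum>j\<in>pm n. qp)" by (rule sum.cong) (auto simp: pm_iff)
    finally show ?thesis by simp
  qed
  also have "\<dots> = rec_coeff qp qm (Suc n)" by (simp add: card_pm rec_coeff_def)
  finally show ?case
    by (simp add: sum_hyperoct_Suc weight_comp_swap_last sum_distrib_left[symmetric] sum_distrib_right[symmetric] Suc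
        del: of_nat_Suc)
qed (simp add: hyperoct_0 weight_0 flip: id_def)

section \<open>Positive definiteness of the weight function\<close>

definition lift_col :: "(nat \<Rightarrow> 'a) \<Rightarrow> int \<Rightarrow> 'a" where
  "lift_col c i = c (nat \<bar>i\<bar>)"

text \<open>Changing the sign of a point acts on its tensor factor by the scalar \<open>s\<close> of
  its colour, which is 1 for even and -1 for odd colours in the applications.\<close>

definition col_sign :: "(nat \<Rightarrow> real) \<Rightarrow> (nat \<Rightarrow> nat) \<Rightarrow> int \<Rightarrow> real" where
  "col_sign s c i = (if i < 0 then s (lift_col c i) else 1)"

lemma lift_col_minus [simp]: "lift_col c (- i) = lift_col c i"
  by (simp add: lift_col_def)

lemma lift_col_upd:
  "lift_col (c(Suc n := a)) (int (Suc n)) = a" "lift_col (c(Suc n := a)) (- int (Suc n)) = a"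
  "i \<in> pm n \<Longrightarrow> lift_col (c(Suc n := a)) i = lift_col c i"
  by (auto simp: lift_col_def pm_iff)

lemma col_sign_upd:
  "col_sign s (c(Suc n := a)) (int (Suc n)) = 1" "col_sign s (c(Suc n := a)) (- int (Suc n)) = s a"
  "i \<in> pm n \<Longrightarrow> col_sign s (c(Suc n := a)) i = col_sign s c i"
  by (simp_all add: col_sign_def lift_col_upd del: of_nat_Suc)

lemma int_in_pm [simp]: "int i \<in> pm n \<longleftrightarrow> i \<in> {1..n}"
  by (auto simp: pm_iff)

lemma sum_PiE_Suc:
  "(\<Sum>c\<in>PiE {1..Suc n} C. f c) = (\<Sum>c\<in>PiE {1..n} C. \<Sum>a\<in>C (Suc n). f (c(Suc n := a)))"
proof -
  have "{1..Suc n} = insert (Suc n) {1..n}" by auto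
  then have "(\<Sum>c\<in>PiE {1..Suc n} C. f c) = (\<Sum>(a, c)\<in>C (Suc n) \<times> PiE {1..n} C. f (c(Suc n := a)))"
    by (simp only: PiE_insert_eq) (subst sum.reindex, rule inj_combinator, simp, simp add: case_prod_beta' comp_def)
  then show ?thesis by (simp add: sum.cartesian_product[symmetric] sum.swap[of _ "C (Suc n)"])
qed

text \<open>Point i is coloured independently of the others, with law \<open>p i\<close> on
  \<open>C i\<close>. The mean of the sign is \<open>qm\<close>, and \<open>coincidence\<close> says
  that, whatever the colour of an earlier point, a later point receives the same colour with
  probability \<open>qp\<close>. Uniform common colours and pairwise disjoint colour sets (with
  \<open>qp\<close> = 0) are both instances.\<close>

locale colouring =
  fixes C :: "nat \<Rightarrow> nat set" and p :: "nat \<Rightarrow> nat \<Rightarrow> real" and s :: "nat \<Rightarrow> real" and qp qm :: real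
  assumes finite_col: "finite (C i)"
    and prob_nonneg: "a \<in> C i \<Longrightarrow> p i a \<ge> 0"
    and prob_sum: "i > 0 \<Longrightarrow> (\<Sum>a\<in>C i. p i a) = 1"
    and sign_square: "s a * s a = 1"
    and mean_sign: "i > 0 \<Longrightarrow> (\<Sum>a\<in>C i. p i a * s a) = qm"
    and coincidence: "0 < i \<Longrightarrow> i < k \<Longrightarrow> a \<in> C i \<Longrightarrow> (if a \<in> C k then p k a else 0) = qp"
begin

definition col_prob :: "nat \<Rightarrow> (nat \<Rightarrow> nat) \<Rightarrow> real" where
  "col_prob n c = (\<Prod>i\<in>{1..n}. p i (c i))"

definition total_sign :: "nat \<Rightarrow> (nat \<Rightarrow> nat) \<Rightarrow> (int \<Rightarrow> int) \<Rightarrow> real" where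
  "total_sign n c \<sigma> = (\<Prod>i\<in>{1..n}. col_sign s c (\<sigma> (int i)))"

definition invariant_col :: "nat \<Rightarrow> (nat \<Rightarrow> nat) \<Rightarrow> (int \<Rightarrow> int) \<Rightarrow> bool" where
  "invariant_col n c \<sigma> \<longleftrightarrow> (\<forall>i\<in>{1..n}. lift_col c (\<sigma> (int i)) = c i)"

text \<open>Only colourings unchanged by \<sigma> give diagonal entries, and
  \<open>total_sign\<close> is that entry. Weighting by \<open>col_prob\<close> generalises the
  normalised trace to colours that are not equally likely.\<close>

definition col_trace :: "nat \<Rightarrow> (int \<Rightarrow> int) \<Rightarrow> real" where
  "col_trace n \<sigma> = (\<Sum>c\<in>PiE {1..n} C. col_prob n c * (if invariant_col n c \<sigma> then total_sign n c \<sigma> else 0))"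

lemma atLeastAtMost_Suc: "{1..Suc n} = insert (Suc n) {1..n}" "Suc n \<notin> {1..n}"
  by auto

lemma col_prob_upd: "col_prob (Suc n) (c(Suc n := a)) = col_prob n c * p (Suc n) a"
proof -
  have "(\<Prod>i\<in>{1..n}. p i ((c(Suc n := a)) i)) = (\<Prod>i\<in>{1..n}. p i (c i))" by (rule prod.cong) auto
  then show ?thesis
    unfolding col_prob_def atLeastAtMost_Suc(1) by (subst prod.insert) (auto simp: mult_ac)
qed

lemma finite_cols: "finite (PiE {1..n} C)"
  by (intro finite_PiE) (auto simp: finite_col)

context
  fixes n :: nat and \<tau> :: "int \<Rightarrow> int"
  assumes tau: "\<tau> \<in> hyperoct n"
begin

lemma hyperoct_apply_in: "i \<in> {1..n} \<Longrightarrow> \<tau> (int i) \<in> pm n"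
  using hyperoct_in_iff[OF tau, of "int i"] by simp

lemma col_upd_step:
  assumes \<sigma>: "\<And>i. i \<in> {1..n} \<Longrightarrow> \<sigma> (int i) = \<tau> (int i)"
    and last: "\<sigma> (int (Suc n)) = int (Suc n) \<or> \<sigma> (int (Suc n)) = - int (Suc n)"
  shows "invariant_col (Suc n) (c(Suc n := a)) \<sigma> \<longleftrightarrow> invariant_col n c \<tau>"
    "total_sign (Suc n) (c(Suc n := a)) \<sigma> =
      total_sign n c \<tau> * (if \<sigma> (int (Suc n)) = int (Suc n) then 1 else s a)"
proof -
  have l: "lift_col (c(Suc n := a)) (\<sigma> (int (Suc n))) = a" using last lift_col_upd by metis
  have "i \<in> {1..n} \<Longrightarrow> lift_col (c(Suc n := a)) (\<sigma> (int i)) = (c(Suc n := a)) i \<longleftrightarrow> lift_col c (\<tau> (int i)) = c i" for i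
  proof -
    assume i: "i \<in> {1..n}"
    then have "(c(Suc n := a)) i = c i" by auto
    then show ?thesis by (simp only: \<sigma>[OF i] lift_col_upd(3)[OF hyperoct_apply_in[OF i]])
  qed
  then show "invariant_col (Suc n) (c(Suc n := a)) \<sigma> \<longleftrightarrow> invariant_col n c \<tau>"
    unfolding invariant_col_def atLeastAtMost_Suc(1) using l by (simp del: of_nat_Suc)
  have "(\<Prod>i\<in>{1..n}. col_sign s (c(Suc n := a)) (\<sigma> (int i))) = (\<Prod>i\<in>{1..n}. col_sign s c (\<tau> (int i)))"
    by (rule prod.cong) (simp_all add: \<sigma> col_sign_upd(3)[OF hyperoct_apply_in])
  then show "total_sign (Suc n) (c(Suc n := a)) \<sigma> =
      total_sign n c \<tau> * (if \<sigma> (int (Suc n)) = int (Suc n) then 1 else s a)"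
    unfolding total_sign_def atLeastAtMost_Suc(1) using last col_sign_upd(1,2)
    by (subst prod.insert) (auto simp del: of_nat_Suc)
qed

text \<open>The point n+1 is inserted in the cycle through j, so invariance forces on it the colour
  of j. In the sign only the factors at the absolute value of j and at n+1 change: for negative j
  both pick up an extra factor \<open>s a\<close>, and these cancel by
  \<open>sign_square\<close>.\<close>

lemma col_upd_swap:
  assumes j: "j \<in> pm n"
  shows "invariant_col (Suc n) (c(Suc n := a)) (\<tau> \<circ> swap_last n j) \<longleftrightarrow> a = lift_col c j \<and> invariant_col n c \<tau>"
    "a = lift_col c j \<Longrightarrow> invariant_col n c \<tau> \<Longrightarrow>
      total_sign (Suc n) (c(Suc n := a)) (\<tau> \<circ> swap_last n j) = total_sign n c \<tau>"
proof -
  let ?N = "int (Suc n)" and ?d = "c(Suc n := a)" and ?\<sigma> = "\<tau> \<circ> swap_last n j"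
  define i0 where "i0 = nat \<bar>j\<bar>"
  have i0: "i0 \<in> {1..n}" using j by (auto simp: i0_def pm_iff)
  have j_or: "j = int i0 \<or> j = - int i0" by (auto simp: i0_def)
  have jN: "j \<noteq> ?N" "j \<noteq> - ?N" using j by (auto simp: pm_iff)
  have sN: "?\<sigma> ?N = \<tau> j" using jN by (auto simp: swap_last_def)
  have s0: "?\<sigma> (int i0) = (if j > 0 then ?N else - ?N)"
    using j_or i0 fixes_last[OF tau] by (auto simp: swap_last_def)
  have si: "?\<sigma> (int i) = \<tau> (int i)" if "i \<in> {1..n}" "i \<noteq> i0" for i
    using that j_or by (auto simp: swap_last_def)
  have l0: "lift_col ?d (?\<sigma> (int i0)) = a"
    unfolding s0 by (cases "j > 0") (simp_all only: if_True if_False lift_col_upd)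
  have tj: "\<tau> j = \<tau> (int i0) \<or> \<tau> j = - \<tau> (int i0)" using j_or hyperoct_minus[OF tau] by metis
  have tjp: "\<tau> j \<in> pm n" using hyperoct_in_iff[OF tau] j by simp
  have lN: "lift_col ?d (?\<sigma> ?N) = lift_col c (\<tau> (int i0))"
    unfolding sN lift_col_upd(3)[OF tjp] using tj by (elim disjE) (simp_all only: lift_col_minus)
  have split: "{1..n} = insert i0 ({1..n} - {i0})" using i0 by auto
  have dc: "?d i = c i" if "i \<in> {1..n}" for i using that by auto
  have rest: "lift_col ?d (?\<sigma> (int i)) = lift_col c (\<tau> (int i))"
    "col_sign s ?d (?\<sigma> (int i)) = col_sign s c (\<tau> (int i))" if "i \<in> {1..n} - {i0}" for i
  proof -
    have i: "i \<in> {1..n}" "i \<noteq> i0" using that by auto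
    show "lift_col ?d (?\<sigma> (int i)) = lift_col c (\<tau> (int i))"
      "col_sign s ?d (?\<sigma> (int i)) = col_sign s c (\<tau> (int i))"
      by (simp_all only: si[OF i] lift_col_upd(3)[OF hyperoct_apply_in[OF i(1)]] col_sign_upd(3)[OF hyperoct_apply_in[OF i(1)]])
  qed
  have lj: "lift_col c j = c i0" by (simp add: lift_col_def i0_def)
  have "invariant_col (Suc n) ?d ?\<sigma> \<longleftrightarrow> lift_col ?d (?\<sigma> ?N) = a \<and> lift_col ?d (?\<sigma> (int i0)) = c i0 \<and>
     (\<forall>i\<in>{1..n} - {i0}. lift_col ?d (?\<sigma> (int i)) = c i)"
  proof -
    have "(\<forall>i\<in>{1..n}. lift_col ?d (?\<sigma> (int i)) = ?d i) \<longleftrightarrow> (\<forall>i\<in>{1..n}. lift_col ?d (?\<sigma> (int i)) = c i)"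
      by (rule ball_cong[OF refl]) (simp only: dc)
    then have "invariant_col (Suc n) ?d ?\<sigma> \<longleftrightarrow> lift_col ?d (?\<sigma> ?N) = a \<and> (\<forall>i\<in>{1..n}. lift_col ?d (?\<sigma> (int i)) = c i)"
      unfolding invariant_col_def atLeastAtMost_Suc(1) Set.ball_simps by simp
    also have "(\<forall>i\<in>{1..n}. lift_col ?d (?\<sigma> (int i)) = c i) \<longleftrightarrow> lift_col ?d (?\<sigma> (int i0)) = c i0 \<and>
     (\<forall>i\<in>{1..n} - {i0}. lift_col ?d (?\<sigma> (int i)) = c i)"
      by (subst split) (simp only: Set.ball_simps)
    finally show ?thesis .
  qed
  also have "\<dots> \<longleftrightarrow> lift_col c (\<tau> (int i0)) = a \<and> a = c i0 \<and> (\<forall>i\<in>{1..n} - {i0}. lift_col c (\<tau> (int i)) = c i)"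
  proof -
    have "(\<forall>i\<in>{1..n} - {i0}. lift_col ?d (?\<sigma> (int i)) = c i) \<longleftrightarrow> (\<forall>i\<in>{1..n} - {i0}. lift_col c (\<tau> (int i)) = c i)"
      by (rule ball_cong[OF refl]) (simp only: rest(1))
    then show ?thesis unfolding l0 lN by blast
  qed
  also have "\<dots> \<longleftrightarrow> a = c i0 \<and> lift_col c (\<tau> (int i0)) = c i0 \<and> (\<forall>i\<in>{1..n} - {i0}. lift_col c (\<tau> (int i)) = c i)"
    by metis
  also have "\<dots> \<longleftrightarrow> a = c i0 \<and> invariant_col n c \<tau>"
    unfolding invariant_col_def by (subst split) (simp only: Set.ball_simps)
  finally show "invariant_col (Suc n) ?d ?\<sigma> \<longleftrightarrow> a = lift_col c j \<and> invariant_col n c \<tau>"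
    unfolding lj .
  assume a: "a = lift_col c j" and inv: "invariant_col n c \<tau>"
  have li0: "lift_col c (\<tau> (int i0)) = a" using inv i0 a lj by (auto simp: invariant_col_def)
  have "\<tau> (int i0) \<noteq> 0" using hyperoct_apply_in[OF i0] by (auto simp: pm_iff)
  then have pair: "col_sign s ?d (?\<sigma> ?N) * col_sign s ?d (?\<sigma> (int i0)) = col_sign s c (\<tau> (int i0))"
    unfolding sN s0 col_sign_upd(3)[OF tjp]
    using j_or i0 li0 sign_square[of a] hyperoct_minus[OF tau, of "int i0"] col_sign_upd(1,2)[of s c n a]
    by (auto simp: col_sign_def simp del: of_nat_Suc)
  have "total_sign (Suc n) ?d ?\<sigma> = col_sign s ?d (?\<sigma> ?N) * (\<Prod>i\<in>{1..n}. col_sign s ?d (?\<sigma> (int i)))"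
    unfolding total_sign_def atLeastAtMost_Suc(1) by (subst prod.insert) auto
  also have "(\<Prod>i\<in>{1..n}. col_sign s ?d (?\<sigma> (int i))) =
      col_sign s ?d (?\<sigma> (int i0)) * (\<Prod>i\<in>{1..n} - {i0}. col_sign s ?d (?\<sigma> (int i)))"
    using i0 by (intro prod.remove) auto
  also have "(\<Prod>i\<in>{1..n} - {i0}. col_sign s ?d (?\<sigma> (int i))) = (\<Prod>i\<in>{1..n} - {i0}. col_sign s c (\<tau> (int i)))"
    by (intro prod.cong refl rest(2))
  also have "col_sign s ?d (?\<sigma> ?N) * (col_sign s ?d (?\<sigma> (int i0)) * \<dots>) =
      col_sign s c (\<tau> (int i0)) * (\<Prod>i\<in>{1..n} - {i0}. col_sign s c (\<tau> (int i)))"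
    unfolding pair[symmetric] by (simp only: mult.assoc)
  also have "\<dots> = total_sign n c \<tau>"
    unfolding total_sign_def using i0 by (intro prod.remove[symmetric]) auto
  finally show "total_sign (Suc n) ?d ?\<sigma> = total_sign n c \<tau>" .
qed

text \<open>Average over the colour of n+1 with the other colours fixed. It is free in the first two
  cases, contributing total probability 1 or the mean sign \<open>qm\<close>; in the third it must
  equal the colour of j, an event of probability \<open>qp\<close>.\<close>

lemma col_trace_comp_swap_last:
  assumes j: "j \<in> pm (Suc n)"
  shows "col_trace (Suc n) (\<tau> \<circ> swap_last n j) = col_trace n \<tau> *
    (if j = int (Suc n) then 1 else if j = - int (Suc n) then qm else qp)"
proof -
  let ?N = "int (Suc n)" and ?\<sigma> = "\<tau> \<circ> swap_last n j"
  let ?F = "\<lambda>c. if invariant_col n c \<tau> then total_sign n c \<tau> else 0"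
  let ?G = "\<lambda>c. if invariant_col (Suc n) c ?\<sigma> then total_sign (Suc n) c ?\<sigma> else 0"
  let ?w = "if j = ?N then 1 else if j = - ?N then qm else qp"
  have "(\<Sum>a\<in>C (Suc n). p (Suc n) a * ?G (c(Suc n := a))) = ?F c * ?w" if c: "c \<in> PiE {1..n} C" for c
  proof -
    consider "j = ?N" | "j = - ?N" | "j \<in> pm n" using j by (auto simp: pm_Suc)
    then show ?thesis
    proof cases
      case 1
      have "?\<sigma> (int i) = \<tau> (int i)" if "i \<in> {1..n}" for i unfolding 1 swap_last_self by simp
      moreover have "?\<sigma> ?N = ?N" unfolding 1 swap_last_self using fixes_last[OF tau] by simp
      ultimately have "?G (c(Suc n := a)) = ?F c" for a
        using col_upd_step[of ?\<sigma> c a] by (simp del: of_nat_Suc o_apply)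
      then have "(\<Sum>a\<in>C (Suc n). p (Suc n) a * ?G (c(Suc n := a))) = (\<Sum>a\<in>C (Suc n). p (Suc n) a) * ?F c"
        by (simp only: sum_distrib_right)
      then show ?thesis using prob_sum[of "Suc n"] 1 by simp
    next
      case 2
      have "?\<sigma> (int i) = \<tau> (int i)" if "i \<in> {1..n}" for i using 2 that by (auto simp: swap_last_def)
      moreover have sN: "?\<sigma> ?N = - ?N" using 2 fixes_last[OF tau] by (auto simp: swap_last_def)
      moreover have "- ?N \<noteq> ?N" by simp
      ultimately have "?G (c(Suc n := a)) = s a * ?F c" for a
        using col_upd_step[of ?\<sigma> c a] by (simp del: of_nat_Suc o_apply)
      then have "(\<Sum>a\<in>C (Suc n). p (Suc n) a * ?G (c(Suc n := a))) = (\<Sum>a\<in>C (Suc n). p (Suc n) a * s a) * ?F c"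
        by (simp only: sum_distrib_right mult.assoc)
      then show ?thesis using mean_sign[of "Suc n"] 2 by simp
    next
      case 3
      define b where "b = lift_col c j"
      have jj: "0 < nat \<bar>j\<bar>" "nat \<bar>j\<bar> < Suc n" using 3 by (auto simp: pm_iff)
      have b: "b \<in> C (nat \<bar>j\<bar>)" using c jj by (auto simp: b_def lift_col_def)
      have "?G (c(Suc n := a)) = (if a = b then ?F c else 0)" for a
        using col_upd_swap(1)[OF 3, of c a] col_upd_swap(2)[OF 3, of a c] unfolding b_def[symmetric] by (simp del: o_apply)
      then have "(\<Sum>a\<in>C (Suc n). p (Suc n) a * ?G (c(Suc n := a))) = (\<Sum>a\<in>C (Suc n). if a = b then p (Suc n) b * ?F c else 0)"
        by (intro sum.cong) auto
      also have "\<dots> = (if b \<in> C (Suc n) then p (Suc n) b else 0) * ?F c"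
        using finite_col by simp
      also have "\<dots> = qp * ?F c" using coincidence[OF jj b] by simp
      finally show ?thesis using 3 by (auto simp: pm_iff)
    qed
  qed
  then have "col_prob n c * (\<Sum>a\<in>C (Suc n). p (Suc n) a * ?G (c(Suc n := a))) = col_prob n c * ?F c * ?w"
    if "c \<in> PiE {1..n} C" for c using that by simp
  then show ?thesis
    unfolding col_trace_def sum_PiE_Suc col_prob_upd mult.assoc sum_distrib_left[symmetric] sum_distrib_right
    by (intro sum.cong) auto
qed

end

text \<open>Both sides obey the same recursion over the coset representatives and agree on
  B(0).\<close>

lemma col_trace_eq_weight: "\<sigma> \<in> hyperoct n \<Longrightarrow> col_trace n \<sigma> = weight qp qm n \<sigma>"
proof (induction n arbitrary: \<sigma>)
  case 0
  then show ?case using weight_0[of qp qm]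
    by (simp add: hyperoct_0 col_trace_def col_prob_def invariant_col_def total_sign_def flip: id_def)
next
  case (Suc n)
  from Suc.prems obtain \<tau> j where t: "\<tau> \<in> hyperoct n" "j \<in> pm (Suc n)" "\<sigma> = \<tau> \<circ> swap_last n j"
    by (rule hyperoct_SucE)
  then show ?case by (simp only: col_trace_comp_swap_last weight_comp_swap_last Suc.IH)
qed

section \<open>Gram factorisation of the weight\<close>

context
  fixes n :: nat and g h :: "int \<Rightarrow> int"
  assumes g: "g \<in> hyperoct n" and h: "h \<in> hyperoct n"
begin

lemma abs_hyperoct_in: "i \<in> {1..n} \<Longrightarrow> nat \<bar>g (int i)\<bar> \<in> {1..n}"
  using hyperoct_in_iff[OF g, of "int i"] by (auto simp: pm_iff)

lemma abs_hyperoct_cases: "\<bar>g i\<bar> = g i \<or> \<bar>g i\<bar> = g (- i)"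
  using hyperoct_minus[OF g, of i] by auto

lemma inv_hyperoct_apply [simp]: "inv g (g i) = i"
  by (rule permutes_inverses(2)[OF hyperoct_permutes[OF g]])

lemma bij_abs_g: "bij_betw (\<lambda>i. nat \<bar>g (int i)\<bar>) {1..n} {1..n}"
proof -
  have "inj_on (\<lambda>i. nat \<bar>g (int i)\<bar>) {1..n}"
  proof (rule inj_onI)
    fix i k assume ik: "i \<in> {1..n}" "k \<in> {1..n}" and "nat \<bar>g (int i)\<bar> = nat \<bar>g (int k)\<bar>"
    then have "g (int i) = g (int k) \<or> g (int i) = g (- int k)"
      using hyperoct_minus[OF g, of "int k"] by (auto simp: abs_if split: if_splits)
    then have "int i = int k \<or> int i = - int k" using hyperoct_inj[OF g] by blast
    then show "i = k" using ik by auto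
  qed
  moreover have "(\<lambda>i. nat \<bar>g (int i)\<bar>) ` {1..n} \<subseteq> {1..n}" using abs_hyperoct_in by blast
  ultimately show ?thesis by (simp add: bij_betw_def endo_inj_surj)
qed

text \<open>Substitute i = g k in the invariance condition. That condition is tested at positive
  points only, and the colour ignores signs, so the absolute value of g k may stand for g k.\<close>

lemma invariant_col_quotient:
  "invariant_col n c (h \<circ> inv g) \<longleftrightarrow> lift_col c \<circ> g = lift_col c \<circ> h"
proof
  assume *: "lift_col c \<circ> g = lift_col c \<circ> h"
  have "lift_col c (h (inv g (int i))) = c i" for i
    using fun_cong[OF *, of "inv g (int i)"] permutes_inverses(1)[OF hyperoct_permutes[OF g]]
    by (simp add: lift_col_def)
  then show "invariant_col n c (h \<circ> inv g)" by (simp add: invariant_col_def)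
next
  assume *: "invariant_col n c (h \<circ> inv g)"
  show "lift_col c \<circ> g = lift_col c \<circ> h"
  proof
    fix i
    show "(lift_col c \<circ> g) i = (lift_col c \<circ> h) i"
    proof (cases "i \<in> pm n")
      case True
      then have gi: "g i \<in> pm n" using hyperoct_in_iff[OF g] by simp
      then have "nat \<bar>g i\<bar> \<in> {1..n}" by (auto simp: pm_iff)
      then have "lift_col c (h (inv g \<bar>g i\<bar>)) = c (nat \<bar>g i\<bar>)"
        using bspec[OF *[unfolded invariant_col_def], of "nat \<bar>g i\<bar>"] by simp
      moreover have "lift_col c (h (inv g \<bar>g i\<bar>)) = lift_col c (h i)"
        using abs_hyperoct_cases[of i] hyperoct_minus[OF h, of i] by auto
      ultimately show ?thesis by (simp add: lift_col_def)
    next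
      case False
      then show ?thesis by (simp add: hyperoct_not_in[OF g] hyperoct_not_in[OF h])
    qed
  qed
qed

text \<open>Reindex the product by the absolute value of g i. Where g i is negative the argument
  becomes - h i; since g i and h i have the same colour, whose scalar is its own inverse, the factor
  is still the product of the two signs.\<close>

lemma total_sign_quotient:
  assumes eq: "lift_col c \<circ> g = lift_col c \<circ> h"
  shows "total_sign n c (h \<circ> inv g) = total_sign n c g * total_sign n c h"
proof -
  have "total_sign n c (h \<circ> inv g) = (\<Prod>i\<in>{1..n}. col_sign s c (h (inv g \<bar>g (int i)\<bar>)))"
    unfolding total_sign_def by (subst prod.reindex_bij_betw[OF bij_abs_g, symmetric]) simp
  also have "\<dots> = (\<Prod>i\<in>{1..n}. col_sign s c (g (int i)) * col_sign s c (h (int i)))"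
  proof (rule prod.cong)
    fix i assume i: "i \<in> {1..n}"
    have l: "lift_col c (g (int i)) = lift_col c (h (int i))" using fun_cong[OF eq, of "int i"] by simp
    have nz: "g (int i) \<noteq> 0" "h (int i) \<noteq> 0"
      using i hyperoct_in_iff[OF g, of "int i"] hyperoct_in_iff[OF h, of "int i"] by (auto simp: pm_iff)
    show "col_sign s c (h (inv g \<bar>g (int i)\<bar>)) = col_sign s c (g (int i)) * col_sign s c (h (int i))"
    proof (cases "g (int i) > 0")
      case True
      then show ?thesis by (simp add: col_sign_def)
    next
      case False
      then have "\<bar>g (int i)\<bar> = g (- int i)" using hyperoct_minus[OF g] by simp
      then have "h (inv g \<bar>g (int i)\<bar>) = - h (int i)" using hyperoct_minus[OF h] by simp
      then show ?thesis using False nz l sign_square by (auto simp: col_sign_def)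
    qed
  qed simp
  finally show ?thesis by (simp add: total_sign_def prod.distrib)
qed

lemma weight_quotient:
  "weight qp qm n (h \<circ> inv g) = (\<Sum>c\<in>PiE {1..n} C. col_prob n c *
     (if lift_col c \<circ> g = lift_col c \<circ> h then total_sign n c g * total_sign n c h else 0))"
proof -
  have "h \<circ> inv g \<in> hyperoct n" using g h comp_in_hyperoct inv_in_hyperoct by blast
  then show ?thesis
    using total_sign_quotient
    by (auto simp: col_trace_eq_weight[symmetric] col_trace_def invariant_col_quotient intro!: sum.cong)
qed

end

text \<open>The test whether g and h produce the same colouring must become a sum of products of a
  function of g and a function of h. This is achieved by summing over the possible common value
  d.\<close>

definition gram_index :: "nat \<Rightarrow> ((nat \<Rightarrow> nat) \<times> (int \<Rightarrow> nat)) set" where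
  "gram_index n = (SIGMA c:PiE {1..n} C. (\<lambda>g. lift_col c \<circ> g) ` hyperoct n)"

definition gram_vec :: "nat \<Rightarrow> (nat \<Rightarrow> nat) \<times> (int \<Rightarrow> nat) \<Rightarrow> (int \<Rightarrow> int) \<Rightarrow> real" where
  "gram_vec n = (\<lambda>(c, d) g. if lift_col c \<circ> g = d then sqrt (col_prob n c) * total_sign n c g else 0)"

lemma col_prob_nonneg: "c \<in> PiE {1..n} C \<Longrightarrow> col_prob n c \<ge> 0"
  unfolding col_prob_def by (intro prod_nonneg) (auto intro: prob_nonneg)

lemma finite_gram_index: "finite (gram_index n)"
  unfolding gram_index_def by (intro finite_SigmaI finite_cols finite_imageI finite_hyperoct)

lemma weight_gram:
  assumes "g \<in> hyperoct n" "h \<in> hyperoct n"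
  shows "weight qp qm n (h \<circ> inv g) = (\<Sum>i\<in>gram_index n. gram_vec n i g * gram_vec n i h)"
proof -
  have "(\<Sum>d\<in>(\<lambda>g. lift_col c \<circ> g) ` hyperoct n. gram_vec n (c, d) g * gram_vec n (c, d) h) =
      col_prob n c * (if lift_col c \<circ> g = lift_col c \<circ> h then total_sign n c g * total_sign n c h else 0)"
    if c: "c \<in> PiE {1..n} C" for c
  proof -
    have "(\<Sum>d\<in>(\<lambda>g. lift_col c \<circ> g) ` hyperoct n. gram_vec n (c, d) g * gram_vec n (c, d) h) =
      (\<Sum>d\<in>(\<lambda>g. lift_col c \<circ> g) ` hyperoct n. if lift_col c \<circ> g = d then
         (if lift_col c \<circ> g = lift_col c \<circ> h then (sqrt (col_prob n c) * sqrt (col_prob n c)) * (total_sign n c g * total_sign n c h) else 0) else 0)"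
      by (rule sum.cong) (auto simp: gram_vec_def)
    then show ?thesis using assms col_prob_nonneg[OF c] by simp
  qed
  moreover have "(\<Sum>i\<in>gram_index n. gram_vec n i g * gram_vec n i h) =
      (\<Sum>c\<in>PiE {1..n} C. \<Sum>d\<in>(\<lambda>g. lift_col c \<circ> g) ` hyperoct n. gram_vec n (c, d) g * gram_vec n (c, d) h)"
    unfolding gram_index_def by (subst sum.Sigma) (simp_all add: finite_cols[simplified] case_prod_beta')
  ultimately show ?thesis
    unfolding weight_quotient[OF assms] by simp
qed

end

section \<open>The sign character of the underlying permutation\<close>

definition abs_perm :: "(int \<Rightarrow> int) \<Rightarrow> int \<Rightarrow> int" where
  "abs_perm \<sigma> i = (if i > 0 then \<bar>\<sigma> i\<bar> else i)"

lemma hyperoct_abs_inj: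
  assumes s: "\<sigma> \<in> hyperoct n" and "\<bar>\<sigma> i\<bar> = \<bar>\<sigma> k\<bar>" shows "\<bar>i\<bar> = \<bar>k\<bar>"
proof -
  have "\<sigma> i = \<sigma> k \<or> \<sigma> i = \<sigma> (- k)" using assms hyperoct_minus[OF s, of k] by (auto simp: abs_if split: if_splits)
  then have "i = k \<or> i = - k" using hyperoct_inj[OF s] by blast
  then show ?thesis by auto
qed

lemma hyperoct_zero_iff: "\<sigma> \<in> hyperoct n \<Longrightarrow> \<sigma> i = 0 \<longleftrightarrow> i = 0"
  using hyperoct_not_in[of \<sigma> n 0] hyperoct_inj[of \<sigma> n i 0] by (simp add: pm_iff)

lemma permutation_abs_perm:
  assumes s: "\<sigma> \<in> hyperoct n" shows "permutation (abs_perm \<sigma>)"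
proof -
  have "bij_betw (abs_perm \<sigma>) {1..int n} {1..int n}"
  proof -
    have "inj_on (abs_perm \<sigma>) {1..int n}"
    proof (rule inj_onI)
      fix i k assume ik: "i \<in> {1..int n}" "k \<in> {1..int n}" "abs_perm \<sigma> i = abs_perm \<sigma> k"
      then have "\<bar>\<sigma> i\<bar> = \<bar>\<sigma> k\<bar>" by (simp add: abs_perm_def)
      then have "\<bar>i\<bar> = \<bar>k\<bar>" by (rule hyperoct_abs_inj[OF s])
      then show "i = k" using ik(1,2) by simp
    qed
    moreover have "abs_perm \<sigma> i \<in> {1..int n}" if "i \<in> {1..int n}" for i
      using that hyperoct_in_iff[OF s, of i] by (auto simp: abs_perm_def pm_iff)
    ultimately show ?thesis by (simp add: bij_betw_def endo_inj_surj image_subset_iff)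
  qed
  moreover have "abs_perm \<sigma> i = i" if "i \<notin> {1..int n}" for i
    using that hyperoct_not_in[OF s, of i] by (auto simp: abs_perm_def pm_iff)
  ultimately have "abs_perm \<sigma> permutes {1..int n}" by (intro bij_imp_permutes)
  then show ?thesis by (rule permutes_imp_permutation[rotated]) simp
qed

lemma abs_perm_comp:
  assumes "\<sigma> \<in> hyperoct n" "\<tau> \<in> hyperoct n"
  shows "abs_perm (\<sigma> \<circ> \<tau>) = abs_perm \<sigma> \<circ> abs_perm \<tau>"
proof
  fix i
  have "\<bar>\<sigma> \<bar>k\<bar>\<bar> = \<bar>\<sigma> k\<bar>" for k using hyperoct_minus[OF assms(1), of k] by (auto simp: abs_if)
  then show "abs_perm (\<sigma> \<circ> \<tau>) i = (abs_perm \<sigma> \<circ> abs_perm \<tau>) i"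
    using hyperoct_zero_iff[OF assms(2), of i] by (auto simp: abs_perm_def)
qed

definition abs_sign :: "(int \<Rightarrow> int) \<Rightarrow> real" where
  "abs_sign \<sigma> = of_int (sign (abs_perm \<sigma>))"

lemma abs_sign_comp:
  "\<sigma> \<in> hyperoct n \<Longrightarrow> \<tau> \<in> hyperoct n \<Longrightarrow> abs_sign (\<sigma> \<circ> \<tau>) = abs_sign \<sigma> * abs_sign \<tau>"
  unfolding abs_sign_def by (simp only: abs_perm_comp sign_compose permutation_abs_perm of_int_mult)

lemma abs_sign_id: "abs_sign id = 1"
proof -
  have "abs_perm id = id" by (auto simp: abs_perm_def)
  then show ?thesis by (simp add: abs_sign_def)
qed

lemma abs_sign_inv:
  assumes "\<sigma> \<in> hyperoct n" shows "abs_sign (inv \<sigma>) = abs_sign \<sigma>"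
proof -
  have "\<sigma> \<circ> inv \<sigma> = id" using permutes_inv_o(1)[OF hyperoct_permutes[OF assms]] .
  then have "abs_sign \<sigma> * abs_sign (inv \<sigma>) = 1"
    using abs_sign_comp[OF assms inv_in_hyperoct[OF assms]] abs_sign_id by simp
  then show ?thesis by (auto simp: abs_sign_def sign_def split: if_splits)
qed

lemma abs_sign_swap_last:
  assumes "j \<in> pm (Suc n)"
  shows "abs_sign (swap_last n j) = (if j = int (Suc n) \<or> j = - int (Suc n) then 1 else - 1)"
proof -
  have "abs_perm (swap_last n j) = Transposition.transpose \<bar>j\<bar> (int (Suc n))"
    using assms by (auto simp: abs_perm_def swap_last_def Transposition.transpose_def pm_iff fun_eq_iff)
  then show ?thesis using assms by (auto simp: abs_sign_def sign_swap_id pm_iff)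
qed

text \<open>In the coset recursion the factor \<open>qp\<close> occurs exactly for those
  representatives whose underlying permutation is a transposition, the only ones with
  \<open>abs_sign\<close> -1.\<close>

lemma weight_uminus: "\<sigma> \<in> hyperoct n \<Longrightarrow> weight (- qp) qm n \<sigma> = abs_sign \<sigma> * weight qp qm n \<sigma>"
proof (induction n arbitrary: \<sigma>)
  case 0
  then show ?case using weight_0 abs_sign_id by (simp add: hyperoct_0 flip: id_def)
next
  case (Suc n)
  from Suc.prems obtain \<tau> j where t: "\<tau> \<in> hyperoct n" "j \<in> pm (Suc n)" "\<sigma> = \<tau> \<circ> swap_last n j"
    by (rule hyperoct_SucE)
  have as: "abs_sign (\<tau> \<circ> swap_last n j) = abs_sign \<tau> * abs_sign (swap_last n j)"
    by (rule abs_sign_comp[OF hyperoct_mono[OF t(1)] swap_last_in_hyperoct[OF t(2)]])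
  show ?case
    unfolding t(3) as weight_comp_swap_last[OF t(1,2)] Suc.IH[OF t(1)] abs_sign_swap_last[OF t(2)]
    by (simp add: mult_ac)
qed

text \<open>The index type is an arbitrary choice, large enough for colourings.\<close>

definition weight_posdef :: "real \<Rightarrow> real \<Rightarrow> bool" where
  "weight_posdef qp qm \<longleftrightarrow> (\<forall>n. \<exists>I a. finite (I :: ((nat \<Rightarrow> nat) \<times> (int \<Rightarrow> nat)) set) \<and>
     (\<forall>g\<in>hyperoct n. \<forall>h\<in>hyperoct n. weight qp qm n (h \<circ> inv g) = (\<Sum>i\<in>I. a i g * a i h)))"

lemma (in colouring) weight_posdef: "weight_posdef qp qm"
  unfolding weight_posdef_def
proof
  fix n
  show "\<exists>I a. finite (I :: ((nat \<Rightarrow> nat) \<times> (int \<Rightarrow> nat)) set) \<and>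
     (\<forall>g\<in>hyperoct n. \<forall>h\<in>hyperoct n. weight qp qm n (h \<circ> inv g) = (\<Sum>i\<in>I. a i g * a i h))"
    by (rule exI[of _ "gram_index n"], rule exI[of _ "gram_vec n"]) (simp add: finite_gram_index weight_gram)
qed

text \<open>A character with values 1 and -1 takes the value chi(h) chi(g) at h o inv g, so it can
  be absorbed into the Gram vectors.\<close>

lemma weight_posdef_uminus:
  assumes "weight_posdef qp qm" shows "weight_posdef (- qp) qm"
  unfolding weight_posdef_def
proof
  fix n
  obtain I a where Ia: "finite (I :: ((nat \<Rightarrow> nat) \<times> (int \<Rightarrow> nat)) set) \<and>
     (\<forall>g\<in>hyperoct n. \<forall>h\<in>hyperoct n. weight qp qm n (h \<circ> inv g) = (\<Sum>i\<in>I. a i g * a i h))"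
    using spec[OF assms[unfolded weight_posdef_def], of n] by (elim exE) (rule that)
  have I: "finite I" using Ia ..
  have a: "weight qp qm n (h \<circ> inv g) = (\<Sum>i\<in>I. a i g * a i h)" if "g \<in> hyperoct n" "h \<in> hyperoct n" for g h
    using Ia that by blast
  have "weight (- qp) qm n (h \<circ> inv g) = (\<Sum>i\<in>I. (abs_sign g * a i g) * (abs_sign h * a i h))"
    if gh: "g \<in> hyperoct n" "h \<in> hyperoct n" for g h
  proof -
    have "h \<circ> inv g \<in> hyperoct n" using gh comp_in_hyperoct inv_in_hyperoct by blast
    then have "weight (- qp) qm n (h \<circ> inv g) = abs_sign (h \<circ> inv g) * weight qp qm n (h \<circ> inv g)"
      by (rule weight_uminus)
    also have "abs_sign (h \<circ> inv g) = abs_sign h * abs_sign g"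
      using abs_sign_comp[OF gh(2) inv_in_hyperoct[OF gh(1)]] abs_sign_inv[OF gh(1)] by simp
    finally show ?thesis unfolding a[OF gh] sum_distrib_left by (simp only: mult_ac)
  qed
  then show "\<exists>I a. finite (I :: ((nat \<Rightarrow> nat) \<times> (int \<Rightarrow> nat)) set) \<and>
     (\<forall>g\<in>hyperoct n. \<forall>h\<in>hyperoct n. weight (- qp) qm n (h \<circ> inv g) = (\<Sum>i\<in>I. a i g * a i h))"
    using I by (intro exI[of _ I] exI[of _ "\<lambda>i g. abs_sign g * a i g"]) simp
qed

section \<open>The two parameter families\<close>

lemma weight_posdef_trace:
  assumes "M + N \<noteq> 0"
  shows "weight_posdef (1 / (real M + real N)) ((real M - real N) / (real M + real N))"
proof -
  have pos: "real M + real N > 0" using assms by linarith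
  interpret colouring "\<lambda>_. {..<M + N}" "\<lambda>_ _. 1 / (real M + real N)" "\<lambda>a. if a < M then 1 else - 1"
    "1 / (real M + real N)" "(real M - real N) / (real M + real N)"
  proof
    have "{..<M + N} = {..<M} \<union> {M..<M + N}" by auto
    then have "(\<Sum>a<M + N. if a < M then 1 else - 1 :: real) = (\<Sum>a\<in>{..<M} \<union> {M..<M + N}. if a < M then 1 else - 1)"
      by (rule arg_cong)
    also have "\<dots> = (\<Sum>a\<in>{..<M}. if a < M then 1 else - 1) + (\<Sum>a\<in>{M..<M + N}. if a < M then 1 else - 1)"
      by (rule sum.union_disjoint) auto
    also have "\<dots> = (\<Sum>a\<in>{..<M}. 1) + (\<Sum>a\<in>{M..<M + N}. - 1)"
      by (intro arg_cong2[where f = "(+)"] sum.cong) auto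
    also have "\<dots> = real M - real N" by simp
    finally show "(\<Sum>a<M + N. 1 / (real M + real N) * (if a < M then 1 else - 1)) = (real M - real N) / (real M + real N)"
      by (simp add: sum_distrib_left[symmetric] sum_divide_distrib[symmetric])
  qed (use pos in auto)
  show ?thesis by (rule weight_posdef)
qed

lemma weight_posdef_signs:
  assumes "- 1 \<le> q" "q \<le> 1" shows "weight_posdef 0 q"
proof -
  \<comment> \<open>Point i owns the two colours 2i and 2i+1, so distinct points never agree and
    \<open>qp\<close> is 0. The probabilities (1+q)/2 and (1-q)/2 of the even and the odd colour
    give mean sign q.\<close>
  interpret colouring "\<lambda>i. {2 * i, 2 * i + 1}" "\<lambda>_ a. if even a then (1 + q) / 2 else (1 - q) / 2"
    "\<lambda>a. if even a then 1 else - 1" 0 q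
  proof
    fix i k a :: nat assume "i < k" "a \<in> {2 * i, 2 * i + 1}"
    then show "(if a \<in> {2 * k, 2 * k + 1} then if even a then (1 + q) / 2 else (1 - q) / 2 else 0) = 0"
      by auto presburger+
  qed (use assms in \<open>auto simp: field_simps\<close>)
  show ?thesis by (rule weight_posdef)
qed

section \<open>Orthogonal polynomials given by a three-term recursion\<close>

text \<open>Polymorphic in the field because the measures use real polynomials, while reality and
  simplicity of the roots are shown over the complex numbers.\<close>

fun jacobi_poly :: "(nat \<Rightarrow> real) \<Rightarrow> nat \<Rightarrow> 'a::real_field poly" where
  "jacobi_poly lam 0 = 1"
| "jacobi_poly lam (Suc 0) = [:0, 1:]"
| "jacobi_poly lam (Suc (Suc n)) =
     [:0, 1:] * jacobi_poly lam (Suc n) - smult (of_real (lam (Suc n))) (jacobi_poly lam n)"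

lemma rec_poly_eq: "rec_poly qp qm n = jacobi_poly (rec_coeff qp qm) n"
  by (induction n rule: rec_poly.induct[of _ qp qm]) simp_all

text \<open>Multiplication by t on coordinate sequences with respect to the Q_j: the entry at j
  receives a(j-1) from Q_(j-1) and lam(j+1) a(j+1) from Q_(j+1). The same map will describe G(x) in
  coordinates with respect to the tensor powers of x.\<close>

definition jacobi_step :: "(nat \<Rightarrow> real) \<Rightarrow> (nat \<Rightarrow> real) \<Rightarrow> nat \<Rightarrow> real" where
  "jacobi_step lam a j = (case j of 0 \<Rightarrow> 0 | Suc i \<Rightarrow> a i) + lam (Suc j) * a (Suc j)"

definition jacobi_coeff :: "(nat \<Rightarrow> real) \<Rightarrow> nat \<Rightarrow> nat \<Rightarrow> real" where
  "jacobi_coeff lam n = (jacobi_step lam ^^ n) (\<lambda>j. if j = 0 then 1 else 0)"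

text \<open>The Q_0 coordinate of t^n. It is the n-th moment of any probability measure for which
  all Q_k with k > 0 integrate to 0.\<close>

definition jacobi_moment :: "(nat \<Rightarrow> real) \<Rightarrow> nat \<Rightarrow> real" where
  "jacobi_moment lam n = jacobi_coeff lam n 0"

lemma jacobi_coeff_0: "jacobi_coeff lam 0 j = (if j = 0 then 1 else 0)"
  by (simp add: jacobi_coeff_def)

lemma jacobi_coeff_Suc: "jacobi_coeff lam (Suc n) = jacobi_step lam (jacobi_coeff lam n)"
  by (simp add: jacobi_coeff_def)

lemma jacobi_coeff_eq_0: "n < j \<Longrightarrow> jacobi_coeff lam n j = 0"
  by (induction n arbitrary: j) (auto simp: jacobi_coeff_0 jacobi_coeff_Suc jacobi_step_def split: nat.split)

lemma jacobi_coeff_diag: "jacobi_coeff lam n n = 1"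
  by (induction n) (auto simp: jacobi_coeff_0 jacobi_coeff_Suc jacobi_step_def jacobi_coeff_eq_0)

lemma poly_jacobi_rec:
  "x * poly (jacobi_poly lam n) x = poly (jacobi_poly lam (Suc n)) x +
     (case n of 0 \<Rightarrow> 0 | Suc m \<Rightarrow> of_real (lam n) * poly (jacobi_poly lam m) x)"
  by (cases n) simp_all

lemma power_eq_jacobi_sum:
  "x ^ n = (\<Sum>j\<le>n. jacobi_coeff lam n j * poly (jacobi_poly lam j) (x::real))"
proof (induction n)
  case 0
  then show ?case by (simp add: jacobi_coeff_0)
next
  case (Suc n)
  let ?c = "jacobi_coeff lam n" and ?q = "\<lambda>j. poly (jacobi_poly lam j) x"
  have "x ^ Suc n = (\<Sum>j\<le>n. ?c j * (x * ?q j))"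
    by (simp add: Suc sum_distrib_left mult_ac)
  also have "\<dots> = (\<Sum>j\<le>n. ?c j * ?q (Suc j)) + (\<Sum>j\<le>n. ?c j * (case j of 0 \<Rightarrow> 0 | Suc m \<Rightarrow> lam j * ?q m))"
    unfolding sum.distrib[symmetric] by (intro sum.cong refl, subst poly_jacobi_rec) (auto simp: distrib_left split: nat.split)
  also have "(\<Sum>j\<le>n. ?c j * (case j of 0 \<Rightarrow> 0 | Suc m \<Rightarrow> lam j * ?q m)) = (\<Sum>j<n. lam (Suc j) * ?c (Suc j) * ?q j)"
    unfolding lessThan_Suc_atMost[symmetric] sum.lessThan_Suc_shift by (simp add: mult_ac)
  also have "\<dots> = (\<Sum>j\<le>Suc n. lam (Suc j) * ?c (Suc j) * ?q j)"
    by (rule sum.mono_neutral_left) (auto simp: jacobi_coeff_eq_0)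
  also have "(\<Sum>j\<le>n. ?c j * ?q (Suc j)) = (\<Sum>j\<le>Suc n. (case j of 0 \<Rightarrow> 0 | Suc i \<Rightarrow> ?c i) * ?q j)"
    by (simp add: sum.atMost_Suc_shift del: sum.atMost_Suc)
  finally show ?case
    by (simp only: jacobi_coeff_Suc jacobi_step_def distrib_right sum.distrib)
qed

section \<open>Moments and orthogonality\<close>

definition has_jacobi_moments :: "(nat \<Rightarrow> real) \<Rightarrow> real measure \<Rightarrow> bool" where
  "has_jacobi_moments lam M \<longleftrightarrow> real_distribution M \<and>
     (\<forall>n. integrable M (\<lambda>t. t ^ n) \<and> integral\<^sup>L M (\<lambda>t. t ^ n) = jacobi_moment lam n)"

lemma integrable_poly:
  fixes M :: "real measure"
  assumes "\<And>n. integrable M (\<lambda>t. t ^ n)" shows "integrable M (poly p)"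
  unfolding poly_altdef using assms by (intro Bochner_Integration.integrable_sum integrable_mult_right)

lemma integral_power_jacobi:
  fixes M :: "real measure"
  assumes "\<And>n. integrable M (\<lambda>t. t ^ n)"
  shows "integral\<^sup>L M (\<lambda>t. t ^ n) = (\<Sum>j\<le>n. jacobi_coeff lam n j * integral\<^sup>L M (poly (jacobi_poly lam j)))"
  unfolding power_eq_jacobi_sum[of _ n lam] using integrable_poly[OF assms]
  by (subst Bochner_Integration.integral_sum) auto

lemma integral_jacobi_0:
  assumes "real_distribution M" shows "integral\<^sup>L M (poly (jacobi_poly lam 0)) = 1"
proof -
  interpret real_distribution M by fact
  have "poly (jacobi_poly lam 0) = (\<lambda>t::real. 1)" by (simp add: fun_eq_iff)
  then show ?thesis using prob_space by simp
qed

text \<open>Stated up to a fixed degree, since a quadrature measure controls only finitely many of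
  the polynomials.\<close>

lemma integral_power_eq_jacobi_moment:
  assumes M: "real_distribution M" and int: "\<And>n. integrable M (\<lambda>t. t ^ n)"
    and 0: "\<And>k. 0 < k \<Longrightarrow> k \<le> n \<Longrightarrow> integral\<^sup>L M (poly (jacobi_poly lam k)) = 0"
  shows "integral\<^sup>L M (\<lambda>t. t ^ n) = jacobi_moment lam n"
proof -
  have "integral\<^sup>L M (\<lambda>t. t ^ n) = (\<Sum>j\<le>n. if j = 0 then jacobi_coeff lam n 0 else 0)"
    unfolding integral_power_jacobi[OF int, of n lam]
    by (rule sum.cong) (use 0 integral_jacobi_0[OF M, of lam] in auto)
  then show ?thesis by (simp add: jacobi_moment_def)
qed

lemma has_jacobi_momentsI:
  assumes "real_distribution M" "\<And>n. integrable M (\<lambda>t. t ^ n)"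
    and "\<And>k. k > 0 \<Longrightarrow> integral\<^sup>L M (poly (jacobi_poly lam k)) = 0"
  shows "has_jacobi_moments lam M"
  using assms integral_power_eq_jacobi_moment[of M] by (simp add: has_jacobi_moments_def)

text \<open>The system is triangular: Q_k occurs in t^k with coefficient 1, so its integral is
  determined by the k-th moment and the integrals of the earlier Q_j.\<close>

lemma partial_moments_imp_integral:
  assumes M: "real_distribution M" and int: "\<And>n. integrable M (\<lambda>t. t ^ n)"
    and mom: "\<And>k. k \<le> n \<Longrightarrow> integral\<^sup>L M (\<lambda>t. t ^ k) = jacobi_moment lam k"
  shows "0 < k \<Longrightarrow> k \<le> n \<Longrightarrow> integral\<^sup>L M (poly (jacobi_poly lam k)) = 0"
proof (induction k rule: less_induct)
  case (less k)
  have "integral\<^sup>L M (\<lambda>t. t ^ k) =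
      (\<Sum>j<k. jacobi_coeff lam k j * integral\<^sup>L M (poly (jacobi_poly lam j))) + integral\<^sup>L M (poly (jacobi_poly lam k))"
    unfolding integral_power_jacobi[OF int, of k lam] lessThan_Suc_atMost[symmetric] by (simp add: jacobi_coeff_diag)
  also have "(\<Sum>j<k. jacobi_coeff lam k j * integral\<^sup>L M (poly (jacobi_poly lam j))) = (\<Sum>j<k. if j = 0 then jacobi_coeff lam k 0 else 0)"
    by (rule sum.cong) (use less integral_jacobi_0[OF M, of lam] in auto)
  also have "\<dots> = jacobi_moment lam k" using less.prems by (simp add: jacobi_moment_def)
  finally show ?case using mom[OF less.prems(2)] by simp
qed

lemma has_jacobi_moments_integral:
  assumes "has_jacobi_moments lam M"
  shows "integral\<^sup>L M (poly (jacobi_poly lam k)) = (if k = 0 then 1 else 0)"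
  using partial_moments_imp_integral[of M k lam k] integral_jacobi_0[of M lam] assms
  by (cases k) (auto simp: has_jacobi_moments_def)

definition jacobi_norm :: "(nat \<Rightarrow> real) \<Rightarrow> nat \<Rightarrow> real" where
  "jacobi_norm lam n = (\<Prod>i\<in>{1..n}. lam i)"

lemma jacobi_norm_0 [simp]: "jacobi_norm lam 0 = 1"
  and jacobi_norm_Suc: "jacobi_norm lam (Suc n) = lam (Suc n) * jacobi_norm lam n"
  by (simp_all add: jacobi_norm_def)

text \<open>Integrating t Q_m Q_n in two ways, with t applied to either factor, gives a recursion in
  m for the integrals of Q_m Q_n, starting from the known integrals of Q_n. The squared norm may be
  0; this is what puts the measure on the zeros of Q_m at a vanishing coefficient.\<close>

lemma jacobi_orthogonal:
  assumes M: "has_jacobi_moments lam M"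
  shows "integral\<^sup>L M (\<lambda>t. poly (jacobi_poly lam m) t * poly (jacobi_poly lam n) t) =
    (if m = n then jacobi_norm lam m else 0)"
proof -
  have int: "integrable M (poly p)" for p
    using M integrable_poly by (auto simp: has_jacobi_moments_def)
  let ?q = "jacobi_poly lam :: nat \<Rightarrow> real poly"
  define B where "B m n = integral\<^sup>L M (poly (?q m * ?q n))" for m n
  have B0: "B 0 n = (if n = 0 then 1 else 0)" for n
    using has_jacobi_moments_integral[OF M, of n] by (simp add: B_def)
  have X: "[:0, 1:] * ?q n = ?q (Suc n) + (case n of 0 \<Rightarrow> 0 | Suc m \<Rightarrow> smult (lam n) (?q m))" for n
    by (cases n) simp_all
  have XB: "integral\<^sup>L M (poly ([:0, 1:] * ?q n * p)) =
      integral\<^sup>L M (poly (?q (Suc n) * p)) + (case n of 0 \<Rightarrow> 0 | Suc k \<Rightarrow> lam n * integral\<^sup>L M (poly (?q k * p)))" for n p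
  proof -
    have "poly ([:0, 1:] * ?q n * p) = (\<lambda>t. poly (?q (Suc n) * p) t + (case n of 0 \<Rightarrow> 0 | Suc k \<Rightarrow> lam n * poly (?q k * p) t))"
      unfolding X by (auto simp: fun_eq_iff algebra_simps split: nat.split)
    then show ?thesis using int by (cases n) (auto simp del: poly_mult jacobi_poly.simps)
  qed
  have comm: "B (Suc m) n + (case m of 0 \<Rightarrow> 0 | Suc k \<Rightarrow> lam m * B k n) =
      B m (Suc n) + (case n of 0 \<Rightarrow> 0 | Suc k \<Rightarrow> lam n * B m k)" for m n
  proof -
    have "[:0, 1:] * ?q m * ?q n = [:0, 1:] * ?q n * ?q m" by (simp only: mult_ac)
    then have "integral\<^sup>L M (poly ([:0, 1:] * ?q m * ?q n)) = integral\<^sup>L M (poly ([:0, 1:] * ?q n * ?q m))"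
      by (rule arg_cong)
    then have eq: "B (Suc m) n + (case m of 0 \<Rightarrow> 0 | Suc k \<Rightarrow> lam m * B k n) =
      B (Suc n) m + (case n of 0 \<Rightarrow> 0 | Suc k \<Rightarrow> lam n * B k m)"
      unfolding XB B_def .
    have sym: "B i k = B k i" for i k by (simp only: B_def mult.commute)
    show ?thesis
    proof (cases n)
      case 0
      then show ?thesis using eq sym[of m "Suc n"] by simp
    next
      case (Suc k)
      then show ?thesis using eq sym[of m "Suc n"] sym[of m k] by simp
    qed
  qed
  have "B m n = (if m = n then jacobi_norm lam m else 0)"
  proof (induction m arbitrary: n rule: induct_nat_012)
    case 0
    then show ?case using B0 by auto
  next
    case 1
    then show ?case using comm[of 0 n] B0 by (cases n) (auto simp: jacobi_norm_Suc)
  next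
    case (ge2 m)
    have "B (Suc (Suc m)) n = B (Suc m) (Suc n) + (case n of 0 \<Rightarrow> 0 | Suc k \<Rightarrow> lam n * B (Suc m) k) - lam (Suc m) * B m n"
      using comm[of "Suc m" n] by simp
    then show ?case by (cases n) (auto simp: ge2 jacobi_norm_Suc)
  qed
  moreover have "poly (?q m * ?q n) = (\<lambda>t. poly (?q m) t * poly (?q n) t)" by (simp add: fun_eq_iff)
  ultimately show ?thesis by (simp only: B_def)
qed

lemma jacobi_poly_degree_coeff:
  "degree (jacobi_poly lam n :: 'a::real_field poly) = n \<and> coeff (jacobi_poly lam n :: 'a poly) n = 1"
proof (induction n rule: induct_nat_012)
  case (ge2 n)
  have "degree ([:0, 1:] * jacobi_poly lam (Suc n) :: 'a poly) = Suc (Suc n)"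
    using ge2 by (subst degree_mult_eq) auto
  moreover have "degree (smult (of_real (lam (Suc n))) (jacobi_poly lam n) :: 'a poly) \<le> n"
    using degree_smult_le[of "of_real (lam (Suc n))" "jacobi_poly lam n :: 'a poly"] ge2 by simp
  ultimately have "degree (jacobi_poly lam (Suc (Suc n)) :: 'a poly) = Suc (Suc n)"
    unfolding jacobi_poly.simps diff_conv_add_uminus by (subst degree_add_eq_left) auto
  moreover have "coeff (jacobi_poly lam n :: 'a poly) (Suc (Suc n)) = 0"
    using ge2 by (intro coeff_eq_0) auto
  ultimately show ?case using ge2 by simp
qed simp_all

lemma degree_jacobi_poly [simp]: "degree (jacobi_poly lam n) = n"
  using jacobi_poly_degree_coeff by blast

lemma coeff_jacobi_poly: "coeff (jacobi_poly lam n) n = 1" "n < k \<Longrightarrow> coeff (jacobi_poly lam n) k = 0"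
  using jacobi_poly_degree_coeff by (blast, intro coeff_eq_0) simp

lemma jacobi_poly_nonzero: "jacobi_poly lam n \<noteq> (0 :: 'a::real_field poly)"
  using coeff_jacobi_poly(1)[where 'a = 'a, of lam n] by auto

lemma jacobi_poly_independent:
  assumes "(\<Sum>k\<le>n. smult (c k) (jacobi_poly lam k)) = 0" "k \<le> n"
  shows "c k = 0"
  using assms
proof (induction n arbitrary: k)
  case 0
  then show ?case by simp
next
  case (Suc n)
  have "(\<Sum>k\<le>n. c k * coeff (jacobi_poly lam k) (Suc n)) = 0"
    by (intro sum.neutral) (auto simp: coeff_jacobi_poly)
  moreover have "coeff (\<Sum>k\<le>Suc n. smult (c k) (jacobi_poly lam k)) (Suc n) = 0"
    unfolding Suc.prems(1) by simp
  ultimately have "c (Suc n) = 0"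
    by (simp add: coeff_sum coeff_jacobi_poly(1) del: jacobi_poly.simps)
  then show ?case using Suc by (cases "k = Suc n") (auto simp del: jacobi_poly.simps)
qed

section \<open>The Christoffel-Darboux kernel and Gauss quadrature\<close>

lemma poly_jacobi_of_real:
  "poly (jacobi_poly lam n) (of_real x) = of_real (poly (jacobi_poly lam n) x)"
  by (induction n rule: induct_nat_012) simp_all

lemma poly_jacobi_cnj: "poly (jacobi_poly lam n) (cnj z) = cnj (poly (jacobi_poly lam n) z)"
  by (induction n rule: induct_nat_012) simp_all

text \<open>The reproducing kernel of the polynomials of degree at most n, with
  \<open>jacobi_norm\<close> as the squared norms of the Q_k.\<close>

definition cd_kernel :: "(nat \<Rightarrow> real) \<Rightarrow> nat \<Rightarrow> 'a::real_field \<Rightarrow> 'a \<Rightarrow> 'a" where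
  "cd_kernel lam n z w = (\<Sum>k\<le>n. of_real (1 / jacobi_norm lam k) * (poly (jacobi_poly lam k) z * poly (jacobi_poly lam k) w))"

context
  fixes lam :: "nat \<Rightarrow> real" and n :: nat
  assumes lam_pos: "\<And>k. 0 < k \<Longrightarrow> k \<le> n \<Longrightarrow> lam k > 0"
begin

lemma jacobi_norm_pos: "k \<le> n \<Longrightarrow> jacobi_norm lam k > 0"
  unfolding jacobi_norm_def by (intro prod_pos) (auto intro: lam_pos)

text \<open>The right-hand sides telescope: by the recursion for Q_(m+2), two consecutive ones
  differ by the new term of the kernel, because lam(m+1) is the ratio of consecutive norms.\<close>

lemma christoffel_darboux:
  fixes z w :: "'a::real_field"
  shows "m \<le> n \<Longrightarrow> (z - w) * cd_kernel lam m z w = of_real (1 / jacobi_norm lam m) *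
    (poly (jacobi_poly lam (Suc m)) z * poly (jacobi_poly lam m) w - poly (jacobi_poly lam m) z * poly (jacobi_poly lam (Suc m)) w)"
proof (induction m)
  case 0
  then show ?case by (simp add: cd_kernel_def)
next
  case (Suc m)
  let ?q = "\<lambda>k z. poly (jacobi_poly lam k) z :: 'a"
  let ?h = "jacobi_norm lam" and ?r = "\<lambda>x. of_real x :: 'a"
  have nz: "?h m \<noteq> 0" "lam (Suc m) \<noteq> 0"
    using jacobi_norm_pos[of m] lam_pos[of "Suc m"] Suc.prems by auto
  have "(z - w) * cd_kernel lam (Suc m) z w =
      ?r (1 / ?h m) * (?q (Suc m) z * ?q m w - ?q m z * ?q (Suc m) w) + (z - w) * (?r (1 / ?h (Suc m)) * (?q (Suc m) z * ?q (Suc m) w))"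
    using Suc unfolding cd_kernel_def by (simp add: distrib_left del: jacobi_poly.simps)
  also have "?r (1 / ?h m) = ?r (1 / ?h (Suc m)) * ?r (lam (Suc m))"
    using nz by (simp add: jacobi_norm_Suc field_simps)
  finally show ?case by (rule trans) (simp add: algebra_simps diff_divide_distrib add_divide_distrib)
qed

text \<open>The case w -> z of the preceding identity, obtained from the differentiated recursion by
  the same induction rather than as a limit.\<close>

lemma christoffel_darboux_confluent:
  fixes z :: "'a::real_field"
  shows "m \<le> n \<Longrightarrow> cd_kernel lam m z z = of_real (1 / jacobi_norm lam m) *
    (poly (pderiv (jacobi_poly lam (Suc m))) z * poly (jacobi_poly lam m) z
      - poly (pderiv (jacobi_poly lam m)) z * poly (jacobi_poly lam (Suc m)) z)"
proof (induction m)
  case 0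
  then show ?case by (simp add: cd_kernel_def pderiv_pCons)
next
  case (Suc m)
  let ?q = "\<lambda>k. poly (jacobi_poly lam k) z :: 'a" and ?d = "\<lambda>k. poly (pderiv (jacobi_poly lam k)) z :: 'a"
  let ?h = "jacobi_norm lam" and ?r = "\<lambda>x. of_real x :: 'a"
  have nz: "?h m \<noteq> 0" "lam (Suc m) \<noteq> 0"
    using jacobi_norm_pos[of m] lam_pos[of "Suc m"] Suc.prems by auto
  have d: "?d (Suc (Suc m)) = ?q (Suc m) + z * ?d (Suc m) - ?r (lam (Suc m)) * ?d m"
    by (simp add: pderiv_diff pderiv_smult pderiv_mult pderiv_pCons del: mult_pCons_left)
  have q: "?q (Suc (Suc m)) = z * ?q (Suc m) - ?r (lam (Suc m)) * ?q m" by simp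
  have "cd_kernel lam (Suc m) z z =
      ?r (1 / ?h m) * (?d (Suc m) * ?q m - ?d m * ?q (Suc m)) + ?r (1 / ?h (Suc m)) * (?q (Suc m) * ?q (Suc m))"
    using Suc unfolding cd_kernel_def by (simp del: jacobi_poly.simps)
  also have "?r (1 / ?h m) = ?r (1 / ?h (Suc m)) * ?r (lam (Suc m))"
    using nz by (simp add: jacobi_norm_Suc field_simps)
  finally show ?case unfolding d q by (simp add: algebra_simps del: jacobi_poly.simps)
qed

text \<open>At conjugate arguments the kernel is a sum of nonnegative reals whose term at k = 0 is
  1.\<close>

lemma cd_kernel_cnj: "cd_kernel lam n z (cnj z) \<noteq> 0"
proof -
  define S where "S = (\<Sum>k\<le>n. (cmod (poly (jacobi_poly lam k) z))\<^sup>2 / jacobi_norm lam k)"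
  have "cd_kernel lam n z (cnj z) = of_real S"
    unfolding cd_kernel_def poly_jacobi_cnj S_def of_real_sum
    by (intro sum.cong refl)
      (simp only: complex_norm_square[symmetric] of_real_mult[symmetric] times_divide_eq_left mult_1)
  moreover have "S \<ge> (\<Sum>k\<in>{0}. (cmod (poly (jacobi_poly lam k) z))\<^sup>2 / jacobi_norm lam k)"
    unfolding S_def by (rule sum_mono2) (auto intro!: divide_nonneg_pos jacobi_norm_pos)
  then have "S \<noteq> 0" by auto
  ultimately show ?thesis by (simp only: of_real_eq_0_iff not_False_eq_True)
qed

lemma cd_kernel_pos: "cd_kernel lam n x x > (0::real)"
proof -
  have "cd_kernel lam n x x \<ge> (\<Sum>k\<in>{0}. of_real (1 / jacobi_norm lam k) * (poly (jacobi_poly lam k) x * poly (jacobi_poly lam k) x))"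
    unfolding cd_kernel_def by (rule sum_mono2) (auto intro!: divide_nonneg_pos jacobi_norm_pos)
  then show ?thesis by simp
qed

text \<open>The conjugate of a root z is a root, so Christoffel-Darboux at this pair has right-hand
  side 0. The kernel there is nonzero, which leaves z - cnj z = 0.\<close>

lemma jacobi_root_real:
  assumes "poly (jacobi_poly lam (Suc n)) z = (0::complex)" shows "z \<in> \<real>"
proof -
  have "poly (jacobi_poly lam (Suc n)) (cnj z) = 0" using assms by (simp only: poly_jacobi_cnj) simp
  then have "(z - cnj z) * cd_kernel lam n z (cnj z) = 0"
    using assms by (subst christoffel_darboux) (simp_all del: jacobi_poly.simps)
  then have "cnj z = z" using cd_kernel_cnj by simp
  then show ?thesis by (simp add: Reals_cnj_iff)
qed

text \<open>At a double root the confluent formula would make the kernel vanish on the diagonal; the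
  root being real, this contradicts \<open>cd_kernel_cnj\<close>.\<close>

lemma rsquarefree_jacobi: "rsquarefree (jacobi_poly lam (Suc n) :: complex poly)"
  unfolding rsquarefree_roots
proof (intro allI notI; elim conjE)
  fix z :: complex assume z: "poly (jacobi_poly lam (Suc n)) z = 0" "poly (pderiv (jacobi_poly lam (Suc n))) z = 0"
  have "cd_kernel lam n z z = 0"
    using z by (subst christoffel_darboux_confluent) (simp_all del: jacobi_poly.simps)
  moreover have "cnj z = z" using jacobi_root_real[OF z(1)] by (simp add: Reals_cnj_iff)
  ultimately show False using cd_kernel_cnj[of z] by simp
qed

definition jacobi_nodes :: "real set" where
  "jacobi_nodes = {x. poly (jacobi_poly lam (Suc n)) x = 0}"

lemma finite_jacobi_nodes: "finite jacobi_nodes"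
  unfolding jacobi_nodes_def by (rule poly_roots_finite[OF jacobi_poly_nonzero])

lemma card_jacobi_nodes: "card jacobi_nodes = Suc n"
proof -
  let ?P = "jacobi_poly lam (Suc n) :: complex poly"
  have fin: "finite {z. poly ?P z = 0}" by (rule poly_roots_finite[OF jacobi_poly_nonzero])
  \<comment> \<open>Without multiple roots the number of distinct roots is the degree.\<close>
  have "smult (lead_coeff ?P) (\<Prod>z | poly ?P z = 0. [:- z, 1:]) = ?P"
    by (rule complex_poly_decompose_rsquarefree[OF rsquarefree_jacobi])
  then have "degree (smult (lead_coeff ?P) (\<Prod>z | poly ?P z = 0. [:- z, 1:])) = Suc n"
    by (simp only: degree_jacobi_poly)
  moreover have "lead_coeff ?P = 1" by (simp add: coeff_jacobi_poly(1) del: jacobi_poly.simps)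
  ultimately have "degree (\<Prod>z | poly ?P z = 0. [:- z, 1:]) = Suc n" by simp
  then have "card {z. poly ?P z = 0} = Suc n"
    by (subst (asm) degree_prod_eq_sum_degree) auto
  moreover have "{z. poly ?P z = 0} = of_real ` jacobi_nodes"
  proof (intro equalityI subsetI)
    fix z assume "z \<in> {z. poly ?P z = 0}"
    then have z: "poly ?P z = 0" by simp
    then obtain x where x: "z = of_real x" using jacobi_root_real by (auto elim: Reals_cases)
    then have "poly (jacobi_poly lam (Suc n)) x = 0" using z by (simp only: x poly_jacobi_of_real of_real_eq_0_iff)
    then show "z \<in> of_real ` jacobi_nodes" using x by (auto simp: jacobi_nodes_def)
  qed (auto simp: jacobi_nodes_def poly_jacobi_of_real simp del: jacobi_poly.simps)
  ultimately show ?thesis by (simp add: card_image inj_on_def)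
qed

text \<open>The Christoffel numbers. On the nodes the kernel is diagonal, so integrating it in one
  variable to the value 1 forces these weights.\<close>

definition gauss_weight :: "real \<Rightarrow> real" where
  "gauss_weight x = 1 / cd_kernel lam n x x"

lemma cd_kernel_nodes:
  "x \<in> jacobi_nodes \<Longrightarrow> y \<in> jacobi_nodes \<Longrightarrow> x \<noteq> y \<Longrightarrow> cd_kernel lam n x y = 0"
  using christoffel_darboux[of n x y] by (simp add: jacobi_nodes_def del: jacobi_poly.simps)

text \<open>
  By the Christoffel--Darboux formula the polynomial \<open>\<Sum>k. (s k / h k) q k - 1\<close>, where \<open>s k\<close> is the
  quadrature sum of \<open>q k\<close>, has degree at most \<open>n\<close> and vanishes at all \<open>n + 1\<close> nodes.
\<close>

lemma gauss_quadrature: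
  assumes "k \<le> n"
  shows "(\<Sum>x\<in>jacobi_nodes. gauss_weight x * poly (jacobi_poly lam k) x) = (if k = 0 then 1 else 0)"
proof -
  define s where "s k = (\<Sum>x\<in>jacobi_nodes. gauss_weight x * poly (jacobi_poly lam k) x)" for k
  define c where "c k = s k / jacobi_norm lam k - (if k = 0 then 1 else 0)" for k
  define R where "R = (\<Sum>k\<le>n. smult (c k) (jacobi_poly lam k))"
  have Ry: "poly R y = 0" if y: "y \<in> jacobi_nodes" for y
  proof -
    have "poly R y = (\<Sum>k\<le>n. s k / jacobi_norm lam k * poly (jacobi_poly lam k) y) - (\<Sum>k\<le>n. if k = 0 then 1 else 0)"
      unfolding R_def poly_sum sum_subtractf[symmetric] by (intro sum.cong) (auto simp: c_def algebra_simps)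
    also have "(\<Sum>k\<le>n. s k / jacobi_norm lam k * poly (jacobi_poly lam k) y) =
        (\<Sum>x\<in>jacobi_nodes. gauss_weight x * cd_kernel lam n x y)"
      unfolding s_def cd_kernel_def sum_distrib_left sum_divide_distrib sum_distrib_right
      by (subst sum.swap) (simp add: mult_ac)
    also have "\<dots> = (\<Sum>x\<in>jacobi_nodes. if x = y then 1 else 0)"
      using cd_kernel_nodes y cd_kernel_pos[of y] by (intro sum.cong) (auto simp: gauss_weight_def)
    finally show ?thesis using y finite_jacobi_nodes by simp
  qed
  have "R = 0"
  proof (rule ccontr)
    assume "R \<noteq> 0"
    then have "card {x. poly R x = 0} \<le> degree R" by (rule card_poly_roots_bound)
    also have "degree R \<le> n"
      unfolding R_def by (intro degree_sum_le) (auto intro: order_trans[OF degree_smult_le])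
    finally have "card {x. poly R x = 0} \<le> n" .
    moreover have "card jacobi_nodes \<le> card {x. poly R x = 0}"
      using Ry poly_roots_finite[OF \<open>R \<noteq> 0\<close>] by (intro card_mono) auto
    ultimately show False using card_jacobi_nodes by simp
  qed
  then have "c k = 0" unfolding R_def using assms by (rule jacobi_poly_independent)
  then show ?thesis using jacobi_norm_pos[OF assms] by (auto simp: c_def s_def[symmetric] split: if_splits)
qed

lemma gauss_measure:
  obtains M where "real_distribution M" "\<And>k. integrable M (\<lambda>t. t ^ k)"
    "\<And>k. 0 < k \<Longrightarrow> k \<le> n \<Longrightarrow> integral\<^sup>L M (poly (jacobi_poly lam k)) = 0"
    "AE t in M. poly (jacobi_poly lam (Suc n)) t = 0"
proof -
  define f where "f x = (if x \<in> jacobi_nodes then gauss_weight x else 0)" for x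
  have w0: "gauss_weight x \<ge> 0" for x using cd_kernel_pos[of x] by (simp add: gauss_weight_def)
  then have f0: "f x \<ge> 0" for x by (auto simp: f_def)
  have "(\<Sum>x\<in>jacobi_nodes. f x) = 1" using gauss_quadrature[of 0] by (simp add: f_def)
  then have "(\<integral>\<^sup>+ x. ennreal (f x) \<partial>count_space UNIV) = 1"
    by (subst nn_integral_count_space'[OF finite_jacobi_nodes]) (auto simp: f_def sum_ennreal w0)
  then have pmf: "pmf (embed_pmf f) x = f x" for x by (intro pmf_embed_pmf) (auto simp: f0)
  have sub: "set_pmf (embed_pmf f) \<subseteq> jacobi_nodes" by (auto simp: set_pmf_iff pmf f_def split: if_splits)
  \<comment> \<open>The \<open>pmf\<close> lives on the full power set; its image under the identity
    is a Borel measure.\<close>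
  define M where "M = distr (measure_pmf (embed_pmf f)) borel (\<lambda>x. x)"
  have fin: "finite (set_pmf (embed_pmf f))" using sub finite_jacobi_nodes finite_subset by blast
  show ?thesis
  proof (rule that[of M])
    show "real_distribution M" unfolding M_def by (rule prob_space.real_distribution_distr[OF prob_space_measure_pmf]) simp
    have "integrable M (\<lambda>t. t ^ k)" for k :: nat
      unfolding M_def by (subst integrable_distr_eq) (auto intro: integrable_measure_pmf_finite[OF fin])
    then show "integrable M (\<lambda>t. t ^ k)" for k .
    have int: "integral\<^sup>L M (poly p) = (\<Sum>x\<in>jacobi_nodes. gauss_weight x * poly p x)" for p
    proof -
      have [measurable]: "poly p \<in> borel_measurable borel"
        by (intro borel_measurable_continuous_onI continuous_intros)
      have "integral\<^sup>L M (poly p) = (\<Sum>x\<in>jacobi_nodes. pmf (embed_pmf f) x * poly p x)"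
        unfolding M_def using sub
        by (subst integral_distr, simp, simp, subst integral_measure_pmf_real[OF finite_jacobi_nodes]) (auto simp: mult.commute)
      then show ?thesis by (simp add: pmf f_def)
    qed
    show "integral\<^sup>L M (poly (jacobi_poly lam k)) = 0" if "0 < k" "k \<le> n" for k
      using gauss_quadrature[of k] that by (simp add: int)
    show "AE t in M. poly (jacobi_poly lam (Suc n)) t = 0"
      unfolding M_def
    proof (subst AE_distr_iff)
      have [measurable]: "poly (jacobi_poly lam (Suc n) :: real poly) \<in> borel_measurable borel"
        by (intro borel_measurable_continuous_onI continuous_intros)
      show "{t \<in> space borel. poly (jacobi_poly lam (Suc n)) t = (0::real)} \<in> sets borel" by measurable
      show "AE t in measure_pmf (embed_pmf f). poly (jacobi_poly lam (Suc n)) t = 0"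
        using sub by (auto simp: AE_measure_pmf_iff jacobi_nodes_def simp del: jacobi_poly.simps)
    qed simp
  qed
qed

end

section \<open>The moment problem\<close>

text \<open>For lam k = A k the right-hand side is the exact coefficient, that of the Hermite
  polynomial of degree j and variance A in t^(j+2m). Hence the induction closes without loss: the
  two terms of \<open>jacobi_step\<close> contribute the shares j and 2m of the factor n+1 = j +
  2m.\<close>

lemma abs_jacobi_coeff_le:
  assumes lam: "\<And>k. k > 0 \<Longrightarrow> \<bar>lam k\<bar> \<le> A * real k"
  shows "\<bar>jacobi_coeff lam (j + 2 * m) j\<bar> \<le> fact (j + 2 * m) * A ^ m / (2 ^ m * fact m * fact j)"
proof -
  have A0: "A \<ge> 0" using lam[of 1] abs_ge_zero[of "lam 1"] by linarith
  have "n = j + 2 * m \<Longrightarrow> \<bar>jacobi_coeff lam n j\<bar> \<le> fact n * A ^ m / (2 ^ m * fact m * fact j)" for n j m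
  proof (induction n arbitrary: j m)
    case 0
    then show ?case by (simp add: jacobi_coeff_0)
  next
    case (Suc n)
    let ?c = "jacobi_coeff lam n" and ?R = "fact n * A ^ m / (2 ^ m * fact m * fact j) :: real"
    have R0: "?R \<ge> 0" using A0 by simp
    have 1: "\<bar>case j of 0 \<Rightarrow> 0 | Suc i \<Rightarrow> ?c i\<bar> \<le> real j * ?R"
    proof (cases j)
      case (Suc i)
      have "\<bar>?c i\<bar> \<le> fact n * A ^ m / (2 ^ m * fact m * fact i)"
        using Suc.prems Suc by (intro Suc.IH) simp
      also have "\<dots> = real j * ?R" unfolding Suc by (simp add: divide_simps del: of_nat_Suc)
      finally show ?thesis using Suc by simp
    qed simp
    have 2: "\<bar>lam (Suc j) * ?c (Suc j)\<bar> \<le> real (2 * m) * ?R"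
    proof (cases m)
      case 0
      then show ?thesis using Suc.prems by (simp add: jacobi_coeff_eq_0)
    next
      case (Suc k)
      have "\<bar>?c (Suc j)\<bar> \<le> fact n * A ^ k / (2 ^ k * fact k * fact (Suc j))"
        using Suc.prems Suc by (intro Suc.IH) simp
      then have "\<bar>lam (Suc j)\<bar> * \<bar>?c (Suc j)\<bar> \<le> (A * real (Suc j)) * (fact n * A ^ k / (2 ^ k * fact k * fact (Suc j)))"
        using A0 by (intro mult_mono lam) auto
      also have "\<dots> = real (2 * m) * ?R" unfolding Suc by (simp add: field_simps del: of_nat_Suc of_nat_mult) (simp add: field_simps)
      finally show ?thesis by (simp add: abs_mult)
    qed
    have "\<bar>jacobi_coeff lam (Suc n) j\<bar> \<le> real j * ?R + real (2 * m) * ?R"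
      unfolding jacobi_coeff_Suc jacobi_step_def using 1 2 by (intro order_trans[OF abs_triangle_ineq] add_mono)
    also have "\<dots> = real (Suc n) * ?R" by (simp only: Suc.prems of_nat_add distrib_right)
    also have "\<dots> = fact (Suc n) * A ^ m / (2 ^ m * fact m * fact j)" by simp
    finally show ?case .
  qed
  then show ?thesis by blast
qed

text \<open>The Gaussian bound on the moments makes the Taylor polynomials of the characteristic
  function converge to it on the whole line, and these depend on the moments alone. Even orders 2m
  are taken because the error bound then involves a genuine moment instead of an absolute
  one.\<close>

lemma jacobi_measure_unique:
  assumes lam: "\<And>k. k > 0 \<Longrightarrow> \<bar>lam k\<bar> \<le> A * real k"
    and M1: "has_jacobi_moments lam M1" and M2: "has_jacobi_moments lam M2"
  shows "M1 = M2"
proof (rule Levy_uniqueness)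
  show d: "real_distribution M1" "real_distribution M2"
    using M1 M2 by (auto simp: has_jacobi_moments_def)
  show "char M1 = char M2"
  proof
    fix t :: real
    define S where "S m = (\<Sum>k\<le>2 * m. ((\<i> * t) ^ k / fact k) * complex_of_real (jacobi_moment lam k))" for m
    have approx: "cmod (char M t - S m) \<le> 2 * ((A * t\<^sup>2 / 2) ^ m / fact m)"
      if M: "has_jacobi_moments lam M" for M m
    proof -
      interpret real_distribution M using M by (simp add: has_jacobi_moments_def)
      have even: "\<bar>x\<bar> ^ (2 * m) = x ^ (2 * m)" for x :: real by (simp add: power_even_abs)
      have "expectation (\<lambda>x. \<bar>x\<bar> ^ (2 * m)) = jacobi_moment lam (2 * m)"
        unfolding even using M by (simp add: has_jacobi_moments_def)
      also have "\<dots> \<le> fact (2 * m) * A ^ m / (2 ^ m * fact m)"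
        using abs_jacobi_coeff_le[OF lam, of 0 m] by (simp add: jacobi_moment_def)
      finally have E: "expectation (\<lambda>x. \<bar>x\<bar> ^ (2 * m)) \<le> fact (2 * m) * A ^ m / (2 ^ m * fact m)" .
      have "cmod (char M t - S m) \<le> (2 * \<bar>t\<bar> ^ (2 * m) / fact (2 * m)) * expectation (\<lambda>x. \<bar>x\<bar> ^ (2 * m))"
        using char_approx1[of "2 * m" t] M by (simp add: has_jacobi_moments_def S_def)
      also have "\<dots> \<le> (2 * \<bar>t\<bar> ^ (2 * m) / fact (2 * m)) * (fact (2 * m) * A ^ m / (2 ^ m * fact m))"
        by (rule mult_left_mono[OF E]) simp
      also have "\<dots> = 2 * ((A * t\<^sup>2 / 2) ^ m / fact m)"
        by (simp add: power_mult power_divide power_mult_distrib)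
      finally show ?thesis .
    qed
    define z where "z = A * t\<^sup>2 / 2"
    have "(\<lambda>m. 2 * (inverse (fact m) * z ^ m)) \<longlonglongrightarrow> 2 * 0"
      by (intro tendsto_mult tendsto_const summable_LIMSEQ_zero summable_exp)
    then have lim: "(\<lambda>m. 2 * (z ^ m / fact m)) \<longlonglongrightarrow> 0"
      by (simp only: divide_inverse_commute mult_zero_right)
    have "S \<longlonglongrightarrow> char M t" if M: "has_jacobi_moments lam M" for M
    proof (rule LIM_zero_cancel, rule tendsto_norm_zero_cancel, rule Lim_null_comparison[OF _ lim])
      show "\<forall>\<^sub>F m in sequentially. norm (cmod (S m - char M t)) \<le> 2 * (z ^ m / fact m)"
        using approx[OF M] unfolding z_def by (simp add: norm_minus_commute)
    qed
    then show "char M1 t = char M2 t" using M1 M2 LIMSEQ_unique by blast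
  qed
qed

text \<open>With lam(n+1) = 0 the recursion starts afresh from Q_(n+2) = t Q_(n+1). So Q_(n+1)
  divides every later polynomial, and these vanish almost everywhere as well.\<close>

lemma integral_jacobi_beyond:
  assumes 0: "lam (Suc n) = 0" and AE: "AE t in M. poly (jacobi_poly lam (Suc n)) t = (0::real)"
    and k: "n < k"
  shows "integral\<^sup>L M (poly (jacobi_poly lam k)) = 0"
proof -
  let ?q = "jacobi_poly lam :: nat \<Rightarrow> real poly"
  have "?q (Suc n) dvd ?q (Suc n + j)" for j
  proof (induction j rule: induct_nat_012)
    case 1
    have "?q (Suc n + Suc 0) = [:0, 1:] * ?q (Suc n)" using 0 by simp
    then show ?case by (metis dvd_triv_right)
  next
    case (ge2 j)
    have "?q (Suc n + Suc (Suc j)) = [:0, 1:] * ?q (Suc n + Suc j) - smult (of_real (lam (Suc n + Suc j))) (?q (Suc n + j))"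
      by simp
    then show ?case using ge2 by (metis dvd_diff dvd_mult dvd_smult)
  qed simp
  from this[of "k - Suc n"] have "?q (Suc n) dvd ?q k" using k by simp
  then obtain r where "?q k = ?q (Suc n) * r" by (rule dvdE)
  moreover have "AE t in M. poly (?q (Suc n) * r) t = 0"
    using AE by eventually_elim (simp del: jacobi_poly.simps)
  ultimately have "AE t in M. poly (?q k) t = 0" by (simp only:)
  then show ?thesis by (rule integral_eq_zero_AE)
qed

lemma jacobi_measure_exists_finite:
  assumes pos: "\<And>k. 0 < k \<Longrightarrow> k \<le> n \<Longrightarrow> lam k > 0" and 0: "lam (Suc n) = 0"
  shows "\<exists>M. has_jacobi_moments lam M"
proof (rule gauss_measure[OF pos])
  fix M :: "real measure"
  assume M: "real_distribution M" "\<And>k. integrable M (\<lambda>t. t ^ k)"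
    "\<And>k. 0 < k \<Longrightarrow> k \<le> n \<Longrightarrow> integral\<^sup>L M (poly (jacobi_poly lam k)) = 0"
    "AE t in M. poly (jacobi_poly lam (Suc n)) t = 0"
  have "integral\<^sup>L M (poly (jacobi_poly lam k)) = 0" if "k > 0" for k
    using M(3)[OF that] integral_jacobi_beyond[OF 0 M(4), of k] by (cases "k \<le> n") auto
  then show ?thesis using has_jacobi_momentsI[OF M(1,2)] by blast
qed

section \<open>Truncated powers, for passing to a weak limit\<close>

definition clip :: "real \<Rightarrow> real \<Rightarrow> real" where
  "clip K t = max (- K) (min K t)"

lemma abs_clip_le: "K \<ge> 0 \<Longrightarrow> \<bar>clip K t\<bar> \<le> K" "K \<ge> 0 \<Longrightarrow> \<bar>clip K t\<bar> \<le> \<bar>t\<bar>"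
  by (auto simp: clip_def max_def min_def)

lemma isCont_clip: "isCont (\<lambda>t. clip K t ^ n) t"
  unfolding clip_def by (intro continuous_intros)

text \<open>Weak convergence applies to bounded continuous functions, hence to truncated powers.
  Where the truncation acts, K^n is at most the n-th power of the absolute value of t; this trades a
  moment of order 2n for decay in K and bounds the error uniformly in the measure.\<close>

lemma clip_power_error:
  assumes K: "K > 0" shows "\<bar>t ^ n - clip K t ^ n\<bar> \<le> t ^ (2 * n) / K ^ n"
proof (cases "\<bar>t\<bar> \<le> K")
  case True
  then have "clip K t = t" by (auto simp: clip_def)
  then show ?thesis using K by simp
next
  case False
  have Kt: "K ^ n \<le> \<bar>t\<bar> ^ n" using False K by (intro power_mono) auto
  have "clip K t = K * sgn t" and t: "t = \<bar>t\<bar> * sgn t"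
    using False K by (auto simp: clip_def sgn_if)
  then have "t ^ n - clip K t ^ n = (\<bar>t\<bar> ^ n - K ^ n) * sgn t ^ n"
    by (metis left_diff_distrib power_mult_distrib)
  also have "\<bar>\<dots>\<bar> \<le> \<bar>t\<bar> ^ n - K ^ n"
    using Kt False K by (auto simp: abs_mult power_abs sgn_if)
  also have "\<dots> \<le> \<bar>t\<bar> ^ n" using K by simp
  also have "\<dots> \<le> t ^ (2 * n) / K ^ n"
  proof -
    have "\<bar>t\<bar> ^ n * K ^ n \<le> \<bar>t\<bar> ^ n * \<bar>t\<bar> ^ n" using Kt by (intro mult_left_mono) auto
    also have "\<dots> = t ^ (2 * n)" by (simp add: power_mult power2_eq_square flip: power_mult_distrib)
    finally show ?thesis using K by (simp add: field_simps)
  qed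
  finally show ?thesis .
qed

context
  fixes M :: "real measure"
  assumes M: "real_distribution M"
begin

lemma integrable_clip: "K \<ge> 0 \<Longrightarrow> integrable M (\<lambda>t. clip K t ^ n)"
proof -
  interpret real_distribution M by (rule M)
  assume K: "K \<ge> 0"
  have [measurable]: "(\<lambda>t. clip K t ^ n) \<in> borel_measurable borel"
    unfolding clip_def by measurable
  show "integrable M (\<lambda>t. clip K t ^ n)"
  proof (rule integrable_const_bound)
    show "AE t in M. norm (clip K t ^ n) \<le> K ^ n"
      using abs_clip_le(1)[OF K] by (auto simp: power_abs intro!: power_mono)
  qed simp
qed

lemma integral_clip_error:
  assumes int: "\<And>n. integrable M (\<lambda>t. t ^ n)" and K: "K > 0"
  shows "\<bar>integral\<^sup>L M (\<lambda>t. t ^ n) - integral\<^sup>L M (\<lambda>t. clip K t ^ n)\<bar> \<le> integral\<^sup>L M (\<lambda>t. t ^ (2 * n)) / K ^ n"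
proof -
  have ic: "integrable M (\<lambda>t. clip K t ^ n)" using K by (intro integrable_clip) simp
  have "integral\<^sup>L M (\<lambda>t. t ^ n) - integral\<^sup>L M (\<lambda>t. clip K t ^ n) = integral\<^sup>L M (\<lambda>t. t ^ n - clip K t ^ n)"
    using int ic by simp
  also have "\<bar>\<dots>\<bar> \<le> integral\<^sup>L M (\<lambda>t. \<bar>t ^ n - clip K t ^ n\<bar>)"
    by (rule integral_abs_bound)
  also have "\<dots> \<le> integral\<^sup>L M (\<lambda>t. t ^ (2 * n) / K ^ n)"
    using int ic clip_power_error[OF K] by (intro integral_mono integrable_abs Bochner_Integration.integrable_diff) auto
  finally show ?thesis by simp
qed

text \<open>Even powers of the truncated variable increase with the truncation level, so monotone
  convergence applies along K = 0, 1, 2, and so on.\<close>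

lemma integrable_of_clip_bound:
  assumes bd: "\<And>K. K \<ge> 0 \<Longrightarrow> integral\<^sup>L M (\<lambda>t. clip K t ^ (2 * n)) \<le> B"
  shows "integrable M (\<lambda>t. t ^ (2 * n))" "integral\<^sup>L M (\<lambda>t. t ^ (2 * n)) \<le> B"
proof -
  interpret real_distribution M by (rule M)
  have sq: "clip K t ^ (2 * n) = (\<bar>clip K t\<bar> ^ n)\<^sup>2" for K t
    by (simp add: power_mult power_abs[symmetric] mult.commute[of 2])
  have mono: "mono (\<lambda>i. clip (real i) t ^ (2 * n))" for t
    unfolding mono_def sq by (intro allI impI power_mono) (auto simp: clip_def max_def min_def)
  have inc: "incseq (\<lambda>i. integral\<^sup>L M (\<lambda>t. clip (real i) t ^ (2 * n)))"
    using mono by (auto intro!: incseq_SucI integral_mono integrable_clip simp: mono_def)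
  obtain L where L: "(\<lambda>i. integral\<^sup>L M (\<lambda>t. clip (real i) t ^ (2 * n))) \<longlonglongrightarrow> L"
    using incseq_convergent[OF inc] bd by (metis of_nat_0_le_iff)
  have lim: "(\<lambda>i. clip (real i) t ^ (2 * n)) \<longlonglongrightarrow> t ^ (2 * n)" for t
  proof (rule tendsto_eventually)
    have "clip (real i) t = t" if "i \<ge> nat \<lceil>\<bar>t\<bar>\<rceil>" for i
      using that by (auto simp: clip_def nat_le_iff ceiling_le_iff)
    then show "\<forall>\<^sub>F i in sequentially. clip (real i) t ^ (2 * n) = t ^ (2 * n)"
      unfolding eventually_sequentially by metis
  qed
  note mc = integral_monotone_convergence_nonneg[OF integrable_clip _ _ _ L]
  show "integrable M (\<lambda>t. t ^ (2 * n))" by (rule mc(1)) (use mono lim sq in auto)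
  have "integral\<^sup>L M (\<lambda>t. t ^ (2 * n)) = L" by (rule mc(2)) (use mono lim sq in auto)
  then show "integral\<^sup>L M (\<lambda>t. t ^ (2 * n)) \<le> B" using LIMSEQ_le_const2[OF L] bd by auto
qed

lemma integrable_power_of_even:
  assumes "\<And>n. integrable M (\<lambda>t. t ^ (2 * n))"
  shows "integrable M (\<lambda>t. t ^ n)"
proof (rule Bochner_Integration.integrable_bound[of _ "\<lambda>t. 1 + t ^ (2 * n)"])
  interpret real_distribution M by (rule M)
  show "integrable M (\<lambda>t. 1 + t ^ (2 * n))" using assms by simp
  show "AE t in M. norm (t ^ n) \<le> norm (1 + t ^ (2 * n))"
  proof (rule AE_I2)
    fix t :: real
    have "0 \<le> (\<bar>t ^ n\<bar> - 1)\<^sup>2" by simp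
    also have "(\<bar>t ^ n\<bar> - 1)\<^sup>2 = t ^ (2 * n) + 1 - 2 * \<bar>t ^ n\<bar>"
    proof -
      have "\<bar>t ^ n\<bar>\<^sup>2 = t ^ (2 * n)" by (simp add: power_mult[symmetric] mult.commute)
      then show ?thesis by (simp add: power2_diff)
    qed
    finally show "norm (t ^ n) \<le> norm (1 + t ^ (2 * n))" by simp
  qed
  show "(\<lambda>t. t ^ n) \<in> borel_measurable M" by (intro borel_measurable_power measurable_finite_borel) simp
qed

end

lemma jacobi_measure_exists_infinite:
  assumes pos: "\<And>k. 0 < k \<Longrightarrow> lam k > 0"
  shows "\<exists>M. has_jacobi_moments lam M"
proof -
  \<comment> \<open>The shift by 2 makes the second moment correct already for n = 0, so that
    tightness holds for the whole sequence.\<close>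
  have "\<exists>M. real_distribution M \<and> (\<forall>k. integrable M (\<lambda>t. t ^ k)) \<and>
      (\<forall>k. 0 < k \<longrightarrow> k \<le> n + 2 \<longrightarrow> integral\<^sup>L M (poly (jacobi_poly lam k)) = 0)" for n
  proof (rule gauss_measure[of "n + 2" lam])
    fix M :: "real measure"
    assume "real_distribution M" "\<And>k. integrable M (\<lambda>t. t ^ k)"
      "\<And>k. 0 < k \<Longrightarrow> k \<le> n + 2 \<Longrightarrow> integral\<^sup>L M (poly (jacobi_poly lam k)) = 0"
    then show ?thesis by auto
  qed (use pos in auto)
  then obtain \<mu> where \<mu>: "\<And>n. real_distribution (\<mu> n)" "\<And>n k. integrable (\<mu> n) (\<lambda>t. t ^ k)"
    and \<mu>0: "\<And>n k. 0 < k \<Longrightarrow> k \<le> n + 2 \<Longrightarrow> integral\<^sup>L (\<mu> n) (poly (jacobi_poly lam k)) = 0"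
    by metis
  have mom: "integral\<^sup>L (\<mu> n) (\<lambda>t. t ^ k) = jacobi_moment lam k" if "k \<le> n + 2" for n k
    using that by (intro integral_power_eq_jacobi_moment \<mu> \<mu>0) auto
  define V where "V = jacobi_moment lam 2"
  have V: "integral\<^sup>L (\<mu> n) (\<lambda>t. t\<^sup>2) = V" for n unfolding V_def by (rule mom) simp
  have V0: "V \<ge> 0" unfolding V[of 0, symmetric] by (rule integral_nonneg_AE) simp
  have tight: "tight \<mu>"
    unfolding tight_def
  proof (intro conjI allI impI)
    fix e :: real assume e: "e > 0"
    \<comment> \<open>Chebyshev's bound V / K^2 equals e V / (V + 1), which is less than e also when
      V = 0.\<close>
    define K where "K = sqrt ((V + 1) / e)"
    have K: "K > 0" "K\<^sup>2 = (V + 1) / e" using e V0 by (auto simp: K_def)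
    have "measure (\<mu> n) {- K<..K} > 1 - e" for n
    proof -
      interpret real_distribution "\<mu> n" by (rule \<mu>)
      let ?A = "UNIV - {- K<..K}"
      have "K\<^sup>2 * prob ?A = (\<integral>t. K\<^sup>2 * indicator ?A t \<partial>\<mu> n)" by simp
      also have "\<dots> \<le> (\<integral>t. t\<^sup>2 \<partial>\<mu> n)"
      proof (rule integral_mono)
        fix t :: real
        have "K\<^sup>2 \<le> t\<^sup>2" if "t \<in> ?A" using that K(1) by (auto simp: abs_le_square_iff[symmetric])
        then show "K\<^sup>2 * indicator ?A t \<le> t\<^sup>2" by (auto simp: indicator_def)
      qed (use \<mu>(2)[of n 2] in \<open>auto simp: integrable_real_indicator emeasure_eq_measure\<close>)
      also have "\<dots> = V" by (rule V)
      finally have "prob ?A \<le> V / K\<^sup>2" using K(1) by (subst pos_le_divide_eq) (simp_all add: mult.commute)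
      also have "\<dots> < e" unfolding K(2) using e V0 by (simp add: field_simps)
      finally show ?thesis using prob_compl[of "{- K<..K}"] by simp
    qed
    then show "\<exists>a b. a < b \<and> (\<forall>n. measure (\<mu> n) {a<..b} > 1 - e)" using K(1) by (intro exI[of _ "- K"] exI[of _ K]) auto
  qed (rule \<mu>)
  obtain r M where r: "strict_mono r" and M: "real_distribution M" and conv: "weak_conv_m (\<mu> \<circ> id \<circ> r) M"
    using tight_imp_convergent_subsubsequence[OF tight strict_mono_id] by blast
  define \<nu> where "\<nu> = \<mu> \<circ> r"
  have conv: "weak_conv_m \<nu> M" using conv by (simp add: \<nu>_def)
  have \<nu>: "real_distribution (\<nu> i)" "integrable (\<nu> i) (\<lambda>t. t ^ k)" for i k using \<mu> by (auto simp: \<nu>_def)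
  have \<nu>mom: "integral\<^sup>L (\<nu> i) (\<lambda>t. t ^ k) = jacobi_moment lam k" if "k \<le> i" for i k
    unfolding \<nu>_def comp_def using that seq_suble[OF r, of i] by (intro mom) linarith
  have lim: "(\<lambda>i. integral\<^sup>L (\<nu> i) (\<lambda>t. clip K t ^ n)) \<longlonglongrightarrow> integral\<^sup>L M (\<lambda>t. clip K t ^ n)" if "K \<ge> 0" for K n
  proof (rule weak_conv_imp_integral_bdd_continuous_conv[OF \<nu>(1) M conv isCont_clip])
    show "norm (clip K t ^ n) \<le> K ^ n" for t
      using abs_clip_le(1)[OF that, of t] by (auto simp: power_abs intro!: power_mono)
  qed
  have even_bd: "integral\<^sup>L M (\<lambda>t. clip K t ^ (2 * n)) \<le> jacobi_moment lam (2 * n)" if K: "K \<ge> 0" for K n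
  proof (rule LIMSEQ_le_const2[OF lim[OF K]], intro exI allI impI)
    fix i assume i: "2 * n \<le> i"
    have "integral\<^sup>L (\<nu> i) (\<lambda>t. clip K t ^ (2 * n)) \<le> integral\<^sup>L (\<nu> i) (\<lambda>t. t ^ (2 * n))"
    proof (rule integral_mono[OF integrable_clip[OF \<nu>(1) K] \<nu>(2)])
      fix t :: real
      have "\<bar>clip K t\<bar> ^ (2 * n) \<le> \<bar>t\<bar> ^ (2 * n)" using abs_clip_le(2)[OF K] by (intro power_mono) auto
      then show "clip K t ^ (2 * n) \<le> t ^ (2 * n)" by (simp only: power_even_abs dvd_triv_left)
    qed
    then show "integral\<^sup>L (\<nu> i) (\<lambda>t. clip K t ^ (2 * n)) \<le> jacobi_moment lam (2 * n)"
      using \<nu>mom[OF i] by simp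
  qed
  have Mint: "integrable M (\<lambda>t. t ^ n)" for n
    by (rule integrable_power_of_even[OF M]) (rule integrable_of_clip_bound(1)[OF M even_bd])
  have Mbd: "integral\<^sup>L M (\<lambda>t. t ^ (2 * n)) \<le> jacobi_moment lam (2 * n)" for n
    by (rule integrable_of_clip_bound(2)[OF M even_bd])
  have "integral\<^sup>L M (\<lambda>t. t ^ n) = jacobi_moment lam n" for n
  proof (cases "n = 0")
    case True
    interpret real_distribution M by (rule M)
    show ?thesis using True prob_space by (simp add: jacobi_moment_def jacobi_coeff_0)
  next
    case False
    let ?m = "jacobi_moment lam"
    \<comment> \<open>Truncation costs at most ?m (2 * n) / K^n for the approximating measures and
      again for the limit; the truncated integrals themselves converge.\<close>
    have err: "\<bar>?m n - integral\<^sup>L M (\<lambda>t. t ^ n)\<bar> \<le> 2 * ?m (2 * n) / K ^ n" if K: "K > 0" for K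
    proof -
      have "(\<lambda>i. \<bar>?m n - integral\<^sup>L (\<nu> i) (\<lambda>t. clip K t ^ n)\<bar>) \<longlonglongrightarrow> \<bar>?m n - integral\<^sup>L M (\<lambda>t. clip K t ^ n)\<bar>"
        using K by (intro tendsto_intros lim) simp
      then have 1: "\<bar>?m n - integral\<^sup>L M (\<lambda>t. clip K t ^ n)\<bar> \<le> ?m (2 * n) / K ^ n"
      proof (rule LIMSEQ_le_const2, intro exI allI impI)
        fix i assume i: "2 * n \<le> i"
        then show "\<bar>?m n - integral\<^sup>L (\<nu> i) (\<lambda>t. clip K t ^ n)\<bar> \<le> ?m (2 * n) / K ^ n"
          using integral_clip_error[OF \<nu>(1,2) K, of i n] \<nu>mom[of n i] \<nu>mom[OF i] by simp
      qed
      have "\<bar>integral\<^sup>L M (\<lambda>t. t ^ n) - integral\<^sup>L M (\<lambda>t. clip K t ^ n)\<bar> \<le> integral\<^sup>L M (\<lambda>t. t ^ (2 * n)) / K ^ n"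
        by (rule integral_clip_error[OF M Mint K])
      also have "\<dots> \<le> ?m (2 * n) / K ^ n" using K Mbd by (intro divide_right_mono) auto
      finally have 2: "\<bar>integral\<^sup>L M (\<lambda>t. t ^ n) - integral\<^sup>L M (\<lambda>t. clip K t ^ n)\<bar> \<le> ?m (2 * n) / K ^ n" .
      have "2 * ?m (2 * n) / K ^ n = ?m (2 * n) / K ^ n + ?m (2 * n) / K ^ n"
        by (simp only: mult_2 add_divide_distrib)
      then show ?thesis using 1 2 by linarith
    qed
    \<comment> \<open>Letting K grow removes the error. This needs n > 0, hence the case
      distinction.\<close>
    have "(\<lambda>i. 2 * ?m (2 * n) / real (Suc i) ^ n) \<longlonglongrightarrow> 0"
      using False by (intro tendsto_divide_0[OF tendsto_const] filterlim_at_top_imp_at_infinity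
          filterlim_pow_at_top filterlim_compose[OF filterlim_real_sequentially filterlim_Suc]) auto
    then have "\<bar>?m n - integral\<^sup>L M (\<lambda>t. t ^ n)\<bar> \<le> 0"
      by (rule LIMSEQ_le_const) (use err in auto)
    then show ?thesis by simp
  qed
  then show ?thesis using M Mint by (auto simp: has_jacobi_moments_def)
qed

section \<open>The symmetrisation operator\<close>

text \<open>Complex families that are summable are absolutely summable, which yields summability
  over the product set.\<close>

lemma has_sum_times_complex:
  fixes f g :: "_ \<Rightarrow> complex"
  assumes f: "(f has_sum a) A" and g: "(g has_sum b) B"
  shows "((\<lambda>(x, y). f x * g y) has_sum (a * b)) (A \<times> B)"
proof (rule has_sum_SigmaI)
  show "((\<lambda>y. case (x, y) of (x, y) \<Rightarrow> f x * g y) has_sum (f x * b)) B" for x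
    using has_sum_cmult_right[OF g] by simp
  show "((\<lambda>x. f x * b) has_sum (a * b)) A" by (rule has_sum_cmult_left[OF f])
  have nf: "(\<lambda>x. norm (f x)) summable_on A" and ng: "(\<lambda>x. norm (g x)) summable_on B"
    using f g has_sum_imp_summable summable_on_iff_abs_summable_on_complex by blast+
  have "(\<lambda>z. norm (case z of (x, y) \<Rightarrow> f x * g y)) summable_on A \<times> B"
    unfolding Infinite_Sum.abs_summable_on_Sigma_iff
    using nf ng by (auto simp: norm_mult infsum_cmult_right' abs_mult infsum_nonneg
        intro!: summable_on_cmult_right summable_on_cmult_left)
  then show "(\<lambda>(x, y). f x * g y) summable_on A \<times> B" by (rule Infinite_Sum.abs_summable_summable)
qed

lemma idx_comp_permutes:
  assumes "\<tau> permutes pm n"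
  shows "k \<circ> \<tau> \<in> idx E n \<longleftrightarrow> k \<in> idx E n"
proof -
  have *: "h \<circ> \<pi> \<in> idx E n" if "h \<in> idx E n" "\<pi> permutes pm n" for h :: "int \<Rightarrow> 'a" and \<pi>
    using that permutes_in_image[OF that(2)] by (auto simp: idx_def PiE_iff extensional_def)
  have "k \<circ> \<tau> \<circ> inv \<tau> = k" using permutes_inverses(1)[OF assms] by (simp add: fun_eq_iff)
  then show ?thesis using *[OF _ assms, of k] *[OF _ permutes_inv[OF assms], of "k \<circ> \<tau>"] by auto
qed

lemma bij_betw_idx_comp:
  assumes "\<tau> permutes pm n"
  shows "bij_betw (\<lambda>k. k \<circ> \<tau>) (idx E n) (idx E n)"
  by (rule bij_betwI[where g = "\<lambda>k. k \<circ> inv \<tau>"])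
    (auto simp: idx_comp_permutes[OF assms] idx_comp_permutes[OF permutes_inv[OF assms]] fun_eq_iff
      permutes_inverses[OF assms])

lemma tensor_spaceI:
  "(\<And>k. k \<notin> idx E n \<Longrightarrow> f k = 0) \<Longrightarrow> (\<lambda>k. cnj (f k) * f k) summable_on idx E n \<Longrightarrow> f \<in> tensor_space E n"
  unfolding tensor_space_def summable_on_iff_abs_summable_on_complex
  by (simp add: norm_mult power2_eq_square)

lemma tensor_space_outside: "f \<in> tensor_space E n \<Longrightarrow> k \<notin> idx E n \<Longrightarrow> f k = 0"
  by (simp add: tensor_space_def)

lemma tensor_space_summable:
  assumes "f \<in> tensor_space E n" "g \<in> tensor_space E n"
  shows "(\<lambda>k. cnj (f k) * g k) summable_on idx E n"
proof (rule Infinite_Sum.abs_summable_summable, rule Infinite_Sum.abs_summable_on_comparison_test')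
  show "(\<lambda>k. (cmod (f k))\<^sup>2 + (cmod (g k))\<^sup>2) summable_on idx E n"
    using assms by (intro summable_on_add) (auto simp: tensor_space_def)
  show "cmod (cnj (f k) * g k) \<le> (cmod (f k))\<^sup>2 + (cmod (g k))\<^sup>2" for k
  proof -
    have "0 \<le> (cmod (f k) - cmod (g k))\<^sup>2" by simp
    then have "2 * (cmod (f k) * cmod (g k)) \<le> (cmod (f k))\<^sup>2 + (cmod (g k))\<^sup>2"
      by (simp add: power2_diff)
    moreover have "0 \<le> cmod (f k) * cmod (g k)" by simp
    ultimately show ?thesis unfolding norm_mult complex_mod_cnj by linarith
  qed
qed

lemma tensor_space_zero: "(\<lambda>k. 0) \<in> tensor_space E n"
  by (rule tensor_spaceI) simp_all

lemma tensor_space_scale: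
  assumes "f \<in> tensor_space E n" shows "(\<lambda>k. c * f k) \<in> tensor_space E n"
proof (rule tensor_spaceI)
  have "(\<lambda>k. (cnj c * c) * (cnj (f k) * f k)) summable_on idx E n"
    by (intro summable_on_cmult_right tensor_space_summable assms)
  then show "(\<lambda>k. cnj (c * f k) * (c * f k)) summable_on idx E n" by (simp add: mult_ac)
qed (use assms in \<open>simp add: tensor_space_outside\<close>)

lemma tensor_space_add:
  assumes "f \<in> tensor_space E n" "g \<in> tensor_space E n"
  shows "(\<lambda>k. f k + g k) \<in> tensor_space E n"
proof (rule tensor_spaceI)
  have "(\<lambda>k. cnj (f k) * f k + cnj (f k) * g k + (cnj (g k) * f k + cnj (g k) * g k)) summable_on idx E n"
    by (intro summable_on_add tensor_space_summable assms)
  then show "(\<lambda>k. cnj (f k + g k) * (f k + g k)) summable_on idx E n" by (simp add: algebra_simps)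
qed (use assms in \<open>simp add: tensor_space_outside\<close>)

lemma tensor_space_diff:
  assumes "f \<in> tensor_space E n" "g \<in> tensor_space E n"
  shows "(\<lambda>k. f k - g k) \<in> tensor_space E n"
  using tensor_space_add[OF assms(1) tensor_space_scale[OF assms(2), of "- 1"]] by simp

lemma tensor_space_sum:
  assumes "\<And>i. i \<in> I \<Longrightarrow> f i \<in> tensor_space E n"
  shows "(\<lambda>k. \<Sum>i\<in>I. c i * f i k) \<in> tensor_space E n"
proof (cases "finite I")
  case True
  then show ?thesis using assms
    by (induction I rule: finite_induct)
      (auto intro!: tensor_space_zero tensor_space_add tensor_space_scale)
qed (simp add: tensor_space_zero)

lemma tensor_inner_cnj: "tensor_inner E n g f = cnj (tensor_inner E n f g)"
  unfolding tensor_inner_def infsum_cnj[symmetric] by (simp add: mult.commute)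

lemma tensor_inner_scale_right: "tensor_inner E n f (\<lambda>k. c * g k) = c * tensor_inner E n f g"
  unfolding tensor_inner_def infsum_cmult_right'[symmetric] by (simp add: mult_ac)

lemma tensor_inner_zero [simp]: "tensor_inner E n f (\<lambda>k. 0) = 0" "tensor_inner E n (\<lambda>k. 0) f = 0"
  by (simp_all add: tensor_inner_def)

lemma tensor_inner_add_right:
  assumes "f \<in> tensor_space E n" "g \<in> tensor_space E n" "h \<in> tensor_space E n"
  shows "tensor_inner E n f (\<lambda>k. g k + h k) = tensor_inner E n f g + tensor_inner E n f h"
  unfolding tensor_inner_def distrib_left by (intro infsum_add tensor_space_summable assms)

lemma tensor_inner_diff_right:
  assumes "f \<in> tensor_space E n" "g \<in> tensor_space E n" "h \<in> tensor_space E n"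
  shows "tensor_inner E n f (\<lambda>k. g k - h k) = tensor_inner E n f g - tensor_inner E n f h"
  using tensor_inner_add_right[OF assms(1,2) tensor_space_scale[OF assms(3), of "- 1"]]
    tensor_inner_scale_right[of E n f "- 1" h] by simp

lemma tensor_inner_sum_right:
  assumes "f \<in> tensor_space E n" "finite I" "\<And>i. i \<in> I \<Longrightarrow> g i \<in> tensor_space E n"
  shows "tensor_inner E n f (\<lambda>k. \<Sum>i\<in>I. c i * g i k) = (\<Sum>i\<in>I. c i * tensor_inner E n f (g i))"
  using assms(2,3)
proof (induction I rule: finite_induct)
  case (insert i I)
  then show ?case
    by (simp add: tensor_inner_add_right[OF assms(1) tensor_space_scale tensor_space_sum] tensor_inner_scale_right)
qed simp

lemma tensor_inner_sum_left:
  assumes "f \<in> tensor_space E n" "finite I" "\<And>i. i \<in> I \<Longrightarrow> g i \<in> tensor_space E n"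
  shows "tensor_inner E n (\<lambda>k. \<Sum>i\<in>I. c i * g i k) f = (\<Sum>i\<in>I. cnj (c i) * tensor_inner E n (g i) f)"
proof -
  have "tensor_inner E n (\<lambda>k. \<Sum>i\<in>I. c i * g i k) f = cnj (\<Sum>i\<in>I. c i * tensor_inner E n f (g i))"
    by (subst tensor_inner_cnj, subst tensor_inner_sum_right) (use assms in simp_all)
  also have "\<dots> = (\<Sum>i\<in>I. cnj (c i) * tensor_inner E n (g i) f)"
    unfolding cnj_sum complex_cnj_mult tensor_inner_cnj[symmetric] ..
  finally show ?thesis .
qed

lemma tensor_inner_self:
  assumes f: "f \<in> tensor_space E n"
  obtains r where "r \<ge> 0" "tensor_inner E n f f = complex_of_real r" "r = 0 \<Longrightarrow> f = (\<lambda>k. 0)"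
proof (rule that)
  let ?r = "\<Sum>\<^sub>\<infinity>k\<in>idx E n. (cmod (f k))\<^sup>2"
  show "?r \<ge> 0" by (rule infsum_nonneg) simp
  have "cnj (f k) * f k = complex_of_real ((cmod (f k))\<^sup>2)" for k
    by (simp only: complex_norm_square mult.commute)
  moreover have "((\<lambda>k. complex_of_real ((cmod (f k))\<^sup>2)) has_sum complex_of_real ?r) (idx E n)"
    using f by (intro has_sum_of_real has_sum_infsum) (simp add: tensor_space_def)
  ultimately show "tensor_inner E n f f = complex_of_real ?r"
    unfolding tensor_inner_def by (simp only: infsumI)
  show "f = (\<lambda>k. 0)" if r: "?r = 0"
  proof
    fix k
    show "f k = 0"
    proof (cases "k \<in> idx E n")
      case True
      have "(cmod (f k))\<^sup>2 = 0"
        by (rule nonneg_infsum_le_0D[of "\<lambda>k. (cmod (f k))\<^sup>2" "idx E n"])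
          (use r f True in \<open>auto simp: tensor_space_def\<close>)
      then show ?thesis by simp
    qed (use f in \<open>simp add: tensor_space_outside\<close>)
  qed
qed

text \<open>Precomposing the index by an inverse makes this a right action, so products are
  reversed. In \<open>\<tau> o swap_last n j\<close> it is therefore \<tau> that acts first.\<close>

lemma act_comp:
  assumes "\<sigma> \<in> hyperoct n" "\<tau> \<in> hyperoct n"
  shows "act \<sigma> (act \<tau> f) = act (\<tau> \<circ> \<sigma>) f"
proof -
  have "bij \<sigma>" "bij \<tau>" using assms hyperoct_permutes permutes_bij by blast+
  then have "inv (\<tau> \<circ> \<sigma>) = inv \<sigma> \<circ> inv \<tau>" by (intro o_inv_distrib)
  then show ?thesis by (simp add: act_def comp_assoc)
qed

lemma act_id [simp]: "act id f = f"
  by (simp add: act_def)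

lemma act_in_tensor_space:
  assumes "\<sigma> \<in> hyperoct n" "f \<in> tensor_space E n"
  shows "act \<sigma> f \<in> tensor_space E n"
proof (rule tensor_spaceI)
  have p: "inv \<sigma> permutes pm n" using assms(1) hyperoct_permutes permutes_inv by blast
  show "act \<sigma> f k = 0" if "k \<notin> idx E n" for k
  proof -
    have "k \<circ> inv \<sigma> \<notin> idx E n" using that idx_comp_permutes[OF p, of k E] by simp
    then show ?thesis unfolding act_def by (rule tensor_space_outside[OF assms(2)])
  qed
  show "(\<lambda>k. cnj (act \<sigma> f k) * act \<sigma> f k) summable_on idx E n"
    using tensor_space_summable[OF assms(2,2)]
    unfolding act_def by (subst summable_on_reindex_bij_betw[OF bij_betw_idx_comp[OF p], of "\<lambda>k. cnj (f k) * f k"])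
qed

lemma tensor_inner_act:
  assumes "\<sigma> \<in> hyperoct n"
  shows "tensor_inner E n (act \<sigma> f) (act \<sigma> g) = tensor_inner E n f g"
proof -
  have p: "inv \<sigma> permutes pm n" using assms(1) hyperoct_permutes permutes_inv by blast
  show ?thesis
    unfolding act_def tensor_inner_def
    by (rule infsum_reindex_bij_betw[OF bij_betw_idx_comp[OF p], of "\<lambda>k. cnj (f k) * g k"])
qed

lemma bij_betw_hyperoct_quotient:
  assumes g: "g \<in> hyperoct n"
  shows "bij_betw (\<lambda>h. h \<circ> inv g) (hyperoct n) (hyperoct n)"
proof (rule bij_betwI[where g = "\<lambda>h. h \<circ> g"])
  note gi = permutes_inv_o[OF hyperoct_permutes[OF g]]
  show "h \<circ> inv g \<circ> g = h" "h \<circ> g \<circ> inv g = h" for h :: "int \<Rightarrow> int" by (simp_all only: comp_assoc gi comp_id)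
qed (use g in \<open>auto intro: comp_in_hyperoct inv_in_hyperoct\<close>)

lemma bij_betw_hyperoct_inv: "bij_betw inv (hyperoct n) (hyperoct n)"
  by (rule bij_betwI[where g = inv]) (auto intro: inv_in_hyperoct simp: inv_inv_eq[OF permutes_bij[OF hyperoct_permutes]])

lemma sym_op_in_tensor_space: "f \<in> tensor_space E n \<Longrightarrow> sym_op qp qm n f \<in> tensor_space E n"
  unfolding sym_op_def by (intro tensor_space_sum act_in_tensor_space)

lemma sym_op_zero [simp]: "sym_op qp qm n (\<lambda>k. 0) = (\<lambda>k. 0)"
  by (simp add: sym_op_def act_def)

lemma sym_op_diff: "sym_op qp qm n (\<lambda>k. f k - g k) = (\<lambda>k. sym_op qp qm n f k - sym_op qp qm n g k)"
  by (simp add: sym_op_def act_def right_diff_distrib sum_subtractf)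

lemma sym_op_add: "sym_op qp qm n (\<lambda>k. f k + g k) = (\<lambda>k. sym_op qp qm n f k + sym_op qp qm n g k)"
  by (simp add: sym_op_def act_def distrib_left sum.distrib)

lemma tensor_inner_sym_op:
  assumes "f \<in> tensor_space E n" "g \<in> tensor_space E n"
  shows "tensor_inner E n f (sym_op qp qm n g) =
    (\<Sum>\<sigma>\<in>hyperoct n. complex_of_real (weight qp qm n \<sigma>) * tensor_inner E n f (act \<sigma> g))"
  unfolding sym_op_def by (rule tensor_inner_sum_right) (auto intro: assms act_in_tensor_space)

section \<open>Self-adjointness and positivity of the symmetrisation operator\<close>

context
  fixes qp qm :: real and n :: nat and E :: "'h set"
  assumes posdef: "weight_posdef qp qm"
begin

lemma weight_gramE:
  obtains I :: "((nat \<Rightarrow> nat) \<times> (int \<Rightarrow> nat)) set" and a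
  where "finite I" "\<And>g h. g \<in> hyperoct n \<Longrightarrow> h \<in> hyperoct n \<Longrightarrow> weight qp qm n (h \<circ> inv g) = (\<Sum>i\<in>I. a i g * a i h)"
proof -
  obtain I a where "finite (I :: ((nat \<Rightarrow> nat) \<times> (int \<Rightarrow> nat)) set) \<and>
     (\<forall>g\<in>hyperoct n. \<forall>h\<in>hyperoct n. weight qp qm n (h \<circ> inv g) = (\<Sum>i\<in>I. a i g * a i h))"
    using spec[OF posdef[unfolded weight_posdef_def], of n] by (elim exE) (rule that)
  then show ?thesis using that[of I a] by simp
qed

text \<open>A real Gram matrix is symmetric; compare its entries at (g, id) and (id, g).\<close>

lemma weight_inv:
  assumes g: "g \<in> hyperoct n" shows "weight qp qm n (inv g) = weight qp qm n g"
proof (rule weight_gramE)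
  fix I :: "((nat \<Rightarrow> nat) \<times> (int \<Rightarrow> nat)) set" and a
  assume a: "\<And>g h. g \<in> hyperoct n \<Longrightarrow> h \<in> hyperoct n \<Longrightarrow> weight qp qm n (h \<circ> inv g) = (\<Sum>i\<in>I. a i g * a i h)"
  have "weight qp qm n (id \<circ> inv g) = weight qp qm n (g \<circ> inv id)"
    unfolding a[OF g id_in_hyperoct] a[OF id_in_hyperoct g] by (simp only: mult.commute)
  then show ?thesis by (simp only: id_comp inv_id comp_id)
qed

text \<open>Each \<open>act \<sigma>\<close> is unitary with adjoint
  \<open>act (inv \<sigma>)\<close>, and the weight is invariant under inversion.\<close>

lemma sym_op_self_adjoint:
  assumes "f \<in> tensor_space E n" "g \<in> tensor_space E n"
  shows "tensor_inner E n (sym_op qp qm n f) g = tensor_inner E n f (sym_op qp qm n g)"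
proof -
  have adj: "tensor_inner E n f (act \<sigma> g) = tensor_inner E n (act (inv \<sigma>) f) g" if s: "\<sigma> \<in> hyperoct n" for \<sigma>
  proof -
    have "act (inv \<sigma>) (act \<sigma> g) = g"
      unfolding act_comp[OF inv_in_hyperoct[OF s] s] permutes_inv_o[OF hyperoct_permutes[OF s]] by simp
    then show ?thesis using tensor_inner_act[OF inv_in_hyperoct[OF s], of E f "act \<sigma> g"] by simp
  qed
  have "tensor_inner E n f (sym_op qp qm n g) =
      (\<Sum>\<sigma>\<in>hyperoct n. complex_of_real (weight qp qm n (inv \<sigma>)) * tensor_inner E n (act (inv \<sigma>) f) g)"
    unfolding tensor_inner_sym_op[OF assms] by (intro sum.cong refl) (simp add: adj weight_inv)
  also have "\<dots> = (\<Sum>\<sigma>\<in>hyperoct n. complex_of_real (weight qp qm n \<sigma>) * tensor_inner E n (act \<sigma> f) g)"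
    by (rule sum.reindex_bij_betw[OF bij_betw_hyperoct_inv])
  also have "\<dots> = tensor_inner E n (sym_op qp qm n f) g"
    unfolding sym_op_def using assms
    by (subst tensor_inner_sum_left) (auto intro: act_in_tensor_space)
  finally show ?thesis ..
qed

lemma act_quotient:
  assumes g: "g \<in> hyperoct n" and h: "h \<in> hyperoct n"
  shows "act g (act (h \<circ> inv g) f) = act h f" "act (inv g) (act h f) = act (h \<circ> inv g) f"
proof -
  have hg: "h \<circ> inv g \<in> hyperoct n" by (intro comp_in_hyperoct inv_in_hyperoct g h)
  show "act g (act (h \<circ> inv g) f) = act h f"
    unfolding act_comp[OF g hg] by (simp only: comp_assoc permutes_inv_o[OF hyperoct_permutes[OF g]] comp_id)
  show "act (inv g) (act h f) = act (h \<circ> inv g) f" by (rule act_comp[OF inv_in_hyperoct[OF g] h])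
qed

text \<open>Let u_i be the sum over g of a_i(g) \<open>act g f\<close>. Replacing \<sigma> by h o
  inv g and averaging over g turns the form into the sum of the squared norms of the u_i divided by
  the order of B(n). The same substitution writes the symmetrised vector as a combination of
  translates of the u_i, so it vanishes as soon as the form does.\<close>

lemma sym_op_form:
  assumes f: "f \<in> tensor_space E n"
  obtains r where "r \<ge> 0" "tensor_inner E n f (sym_op qp qm n f) = complex_of_real r"
    "r = 0 \<Longrightarrow> sym_op qp qm n f = (\<lambda>k. 0)"
proof (rule weight_gramE)
  fix I :: "((nat \<Rightarrow> nat) \<times> (int \<Rightarrow> nat)) set" and a
  assume I: "finite I"
    and a: "\<And>g h. g \<in> hyperoct n \<Longrightarrow> h \<in> hyperoct n \<Longrightarrow> weight qp qm n (h \<circ> inv g) = (\<Sum>i\<in>I. a i g * a i h)"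
  let ?G = "hyperoct n" and ?N = "real (card (hyperoct n))"
  have N: "?N > 0" by (metis id_in_hyperoct finite_hyperoct card_gt_0_iff empty_iff of_nat_0_less_iff)
  define u where "u i = (\<lambda>k. \<Sum>g\<in>?G. complex_of_real (a i g) * act g f k)" for i
  have u: "u i \<in> tensor_space E n" for i
    unfolding u_def by (intro tensor_space_sum act_in_tensor_space f)
  have "\<exists>r. \<forall>i. r i \<ge> 0 \<and> tensor_inner E n (u i) (u i) = complex_of_real (r i) \<and> (r i = 0 \<longrightarrow> u i = (\<lambda>k. 0))"
  proof (intro choice allI)
    fix i
    show "\<exists>r. r \<ge> 0 \<and> tensor_inner E n (u i) (u i) = complex_of_real r \<and> (r = 0 \<longrightarrow> u i = (\<lambda>k. 0))"
      by (rule tensor_inner_self[OF u]) auto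
  qed
  then obtain r where r: "\<And>i. r i \<ge> 0" "\<And>i. tensor_inner E n (u i) (u i) = complex_of_real (r i)"
    "\<And>i. r i = 0 \<Longrightarrow> u i = (\<lambda>k. 0)" by auto
  have quot: "(\<Sum>h\<in>?G. F (h \<circ> inv g)) = (\<Sum>\<sigma>\<in>?G. F \<sigma>)" if "g \<in> ?G" for g and F :: "(int \<Rightarrow> int) \<Rightarrow> complex"
    by (rule sum.reindex_bij_betw[OF bij_betw_hyperoct_quotient[OF that]])
  have uu: "tensor_inner E n (u i) (u i) = (\<Sum>g\<in>?G. \<Sum>h\<in>?G.
      complex_of_real (a i g * a i h) * tensor_inner E n (act g f) (act h f))" for i
  proof -
    have "tensor_inner E n (u i) (u i) = (\<Sum>g\<in>?G. complex_of_real (a i g) * tensor_inner E n (act g f) (u i))"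
      by (subst (1) u_def, subst tensor_inner_sum_left) (auto intro: u act_in_tensor_space f)
    also have "tensor_inner E n (act g f) (u i) = (\<Sum>h\<in>?G. complex_of_real (a i h) * tensor_inner E n (act g f) (act h f))"
      if "g \<in> ?G" for g
      unfolding u_def by (rule tensor_inner_sum_right) (auto intro: act_in_tensor_space f that)
    then have "(\<Sum>g\<in>?G. complex_of_real (a i g) * tensor_inner E n (act g f) (u i)) =
      (\<Sum>g\<in>?G. complex_of_real (a i g) * (\<Sum>h\<in>?G. complex_of_real (a i h) * tensor_inner E n (act g f) (act h f)))"
      by (intro sum.cong) simp_all
    finally show ?thesis by (simp only: sum_distrib_left of_real_mult mult.assoc)
  qed
  have "complex_of_real (\<Sum>i\<in>I. r i) = (\<Sum>i\<in>I. tensor_inner E n (u i) (u i))" by (simp add: r)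
  also have "\<dots> = (\<Sum>g\<in>?G. \<Sum>h\<in>?G. \<Sum>i\<in>I. complex_of_real (a i g * a i h) * tensor_inner E n (act g f) (act h f))"
    unfolding uu by (subst sum.swap, intro sum.cong refl, rule sum.swap)
  also have "\<dots> = (\<Sum>g\<in>?G. \<Sum>h\<in>?G. complex_of_real (weight qp qm n (h \<circ> inv g)) * tensor_inner E n f (act (h \<circ> inv g) f))"
  proof (intro sum.cong refl)
    fix g h assume gh: "g \<in> ?G" "h \<in> ?G"
    have "tensor_inner E n (act g f) (act h f) = tensor_inner E n f (act (h \<circ> inv g) f)"
      unfolding act_quotient(1)[OF gh, symmetric] by (rule tensor_inner_act[OF gh(1)])
    then show "(\<Sum>i\<in>I. complex_of_real (a i g * a i h) * tensor_inner E n (act g f) (act h f)) =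
        complex_of_real (weight qp qm n (h \<circ> inv g)) * tensor_inner E n f (act (h \<circ> inv g) f)"
      by (simp only: a[OF gh] of_real_sum sum_distrib_right)
  qed
  also have "\<dots> = (\<Sum>g\<in>?G. tensor_inner E n f (sym_op qp qm n f))"
    unfolding tensor_inner_sym_op[OF f f]
    by (intro sum.cong refl quot[where F = "\<lambda>\<sigma>. complex_of_real (weight qp qm n \<sigma>) * tensor_inner E n f (act \<sigma> f)"])
  also have "\<dots> = complex_of_real ?N * tensor_inner E n f (sym_op qp qm n f)" by simp
  finally have sum_r: "complex_of_real (\<Sum>i\<in>I. r i) = complex_of_real ?N * tensor_inner E n f (sym_op qp qm n f)" .
  have "complex_of_real ?N \<noteq> 0" using N by (simp only: of_real_eq_0_iff)
  then have form: "tensor_inner E n f (sym_op qp qm n f) = complex_of_real ((\<Sum>i\<in>I. r i) / ?N)"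
    unfolding of_real_divide sum_r by (rule nonzero_mult_div_cancel_left[symmetric])
  have null: "sym_op qp qm n f = (\<lambda>k. 0)" if "(\<Sum>i\<in>I. r i) / ?N = 0"
  proof
    fix k
    have "(\<Sum>i\<in>I. r i) = 0" using that N by (metis divide_eq_0_iff less_irrefl)
    then have "u i = (\<lambda>k. 0)" if "i \<in> I" for i
      using that r(1,3) I by (simp add: sum_nonneg_eq_0_iff)
    then have u0: "act (inv g) (u i) k = 0" if "i \<in> I" for i g using that by (simp add: act_def)
    have "complex_of_real ?N * sym_op qp qm n f k = (\<Sum>g\<in>?G. sym_op qp qm n f k)" by simp
    also have "\<dots> = (\<Sum>g\<in>?G. \<Sum>h\<in>?G. complex_of_real (weight qp qm n (h \<circ> inv g)) * act (h \<circ> inv g) f k)"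
      unfolding sym_op_def
      by (intro sum.cong refl quot[where F = "\<lambda>\<sigma>. complex_of_real (weight qp qm n \<sigma>) * act \<sigma> f k", symmetric])
    also have "\<dots> = (\<Sum>g\<in>?G. \<Sum>i\<in>I. complex_of_real (a i g) * act (inv g) (u i) k)"
    proof (intro sum.cong refl)
      fix g assume g: "g \<in> ?G"
      have "(\<Sum>h\<in>?G. complex_of_real (weight qp qm n (h \<circ> inv g)) * act (h \<circ> inv g) f k) =
          (\<Sum>h\<in>?G. \<Sum>i\<in>I. complex_of_real (a i g) * (complex_of_real (a i h) * act (inv g) (act h f) k))"
        using g by (intro sum.cong refl) (simp only: a act_quotient(2) of_real_sum sum_distrib_right of_real_mult mult.assoc)
      also have "\<dots> = (\<Sum>i\<in>I. complex_of_real (a i g) * (\<Sum>h\<in>?G. complex_of_real (a i h) * act (inv g) (act h f) k))"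
        unfolding sum_distrib_left by (rule sum.swap)
      also have "\<dots> = (\<Sum>i\<in>I. complex_of_real (a i g) * act (inv g) (u i) k)"
        by (simp add: u_def act_def)
      finally show "(\<Sum>h\<in>?G. complex_of_real (weight qp qm n (h \<circ> inv g)) * act (h \<circ> inv g) f k) = \<dots>" .
    qed
    also have "\<dots> = 0" by (intro sum.neutral ballI) (simp add: u0)
    finally show "sym_op qp qm n f k = 0" using N by (metis mult_eq_0_iff of_real_eq_0_iff less_irrefl)
  qed
  show ?thesis
    by (rule that[OF _ form null]) (use N r(1) in \<open>simp_all add: sum_nonneg\<close>)
qed

end

section \<open>The Fock space and the cyclic Gaussian operator\<close>

lemma cplx_inner_of: "cplx_inner (cplx_of x) (cplx_of y) = complex_of_real (inner x y)"
  by (simp add: cplx_inner_def cplx_of_def complex_eq_iff)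

lemma enclose_cplx_of:
  "enclose E (cplx_of x) (cplx_of x) n f = (\<lambda>k. if k \<in> idx E (Suc n)
     then complex_of_real (inner (k (- int (Suc n))) x) * f (restrict k (pm n)) * complex_of_real (inner (k (int (Suc n))) x)
     else 0)"
  unfolding enclose_def cplx_inner_of ..

lemma bij_betw_idx_Suc:
  "bij_betw (\<lambda>k. ((k (- int (Suc n)), restrict k (pm n)), k (int (Suc n)))) (idx E (Suc n)) ((E \<times> idx E n) \<times> E)"
proof (rule bij_betwI[where g = "\<lambda>((e, k), e'). k(- int (Suc n) := e, int (Suc n) := e')"])
  let ?N = "int (Suc n)"
  have N: "?N \<notin> pm n" "- ?N \<notin> pm n" "- ?N \<noteq> ?N" by (auto simp: pm_iff)
  show "(\<lambda>k. ((k (- ?N), restrict k (pm n)), k ?N)) \<in> idx E (Suc n) \<rightarrow> (E \<times> idx E n) \<times> E"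
    by (auto simp: idx_def pm_Suc)
  show "(\<lambda>((e, k), e'). k(- ?N := e, ?N := e')) \<in> (E \<times> idx E n) \<times> E \<rightarrow> idx E (Suc n)"
    unfolding idx_def pm_Suc by (auto simp: PiE_iff extensional_def split: if_splits)
  show "(\<lambda>((e, k), e'). k(- ?N := e, ?N := e')) ((k (- ?N), restrict k (pm n)), k ?N) = k"
    if "k \<in> idx E (Suc n)" for k
    using that by (auto simp: fun_eq_iff idx_def pm_Suc PiE_iff extensional_def)
  show "((\<lambda>k. ((k (- ?N), restrict k (pm n)), k ?N)) ((\<lambda>((e, k), e'). k(- ?N := e, ?N := e')) z)) = z"
    if "z \<in> (E \<times> idx E n) \<times> E" for z
  proof -
    obtain e k e' where z: "z = ((e, k), e')" by (metis prod.exhaust)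
    then have "k \<in> idx E n" using that by simp
    then have "restrict (k(- ?N := e, ?N := e')) (pm n) = k"
      using N by (auto simp: fun_eq_iff idx_def PiE_iff extensional_def)
    then show ?thesis using N z by simp
  qed
qed

lemma has_sum_idx_Suc:
  fixes f g h :: "_ \<Rightarrow> complex"
  assumes "(f has_sum a) E" "(g has_sum b) (idx E n)" "(h has_sum c) E"
  shows "((\<lambda>k. f (k (- int (Suc n))) * g (restrict k (pm n)) * h (k (int (Suc n)))) has_sum (a * b * c)) (idx E (Suc n))"
  using has_sum_times_complex[OF has_sum_times_complex[OF assms(1,2)] assms(3)]
  by (subst (asm) has_sum_reindex_bij_betw[OF bij_betw_idx_Suc, symmetric]) simp

text \<open>In \<tau> o swap_last the factor \<tau> acts first and leaves the two outer tensor
  factors alone. For each j, summing over \<tau> thus symmetrises f inside the enclosure, which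
  gives 0. This is what makes creation well defined on classes.\<close>

lemma sym_op_enclose_null:
  assumes null: "sym_op qp qm n f = (\<lambda>k. 0)"
  shows "sym_op qp qm (Suc n) (enclose E x y n f) = (\<lambda>k. 0)"
proof
  fix k :: "int \<Rightarrow> 'a"
  let ?F = "enclose E x y n f"
  have inner: "(\<Sum>\<tau>\<in>hyperoct n. complex_of_real (weight qp qm n \<tau>) * act \<tau> ?F k') = 0" for k'
  proof -
    let ?N = "int (Suc n)"
    have *: "act \<tau> ?F k' = (if k' \<in> idx E (Suc n) then cplx_inner (cplx_of (k' (- ?N))) x *
        act \<tau> f (restrict k' (pm n)) * cplx_inner (cplx_of (k' ?N)) y else 0)" if t: "\<tau> \<in> hyperoct n" for \<tau>
    proof -
      note ti = inv_in_hyperoct[OF t]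
      have "inv \<tau> permutes pm (Suc n)" by (rule hyperoct_permutes[OF hyperoct_mono[OF ti]])
      then have "k' \<circ> inv \<tau> \<in> idx E (Suc n) \<longleftrightarrow> k' \<in> idx E (Suc n)" by (rule idx_comp_permutes)
      moreover have "restrict (k' \<circ> inv \<tau>) (pm n) = restrict k' (pm n) \<circ> inv \<tau>"
        using hyperoct_in_iff[OF ti] by (auto simp: fun_eq_iff)
      ultimately show ?thesis
        using fixes_last[OF ti] by (simp add: act_def enclose_def del: of_nat_Suc)
    qed
    have "(\<Sum>\<tau>\<in>hyperoct n. complex_of_real (weight qp qm n \<tau>) * act \<tau> ?F k') =
      (if k' \<in> idx E (Suc n) then cplx_inner (cplx_of (k' (- ?N))) x * cplx_inner (cplx_of (k' ?N)) y *
         sym_op qp qm n f (restrict k' (pm n)) else 0)"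
      unfolding sym_op_def sum_distrib_left by (simp add: * mult_ac del: of_nat_Suc)
    then show ?thesis by (simp add: null)
  qed
  have "sym_op qp qm (Suc n) ?F k = (\<Sum>j\<in>pm (Suc n). \<Sum>\<tau>\<in>hyperoct n.
      complex_of_real (weight qp qm (Suc n) (\<tau> \<circ> swap_last n j)) * act (\<tau> \<circ> swap_last n j) ?F k)"
    unfolding sym_op_def sum_hyperoct_Suc by (rule sum.swap)
  also have "\<dots> = (\<Sum>j\<in>pm (Suc n). 0)"
  proof (rule sum.cong[OF refl])
    fix j assume j: "j \<in> pm (Suc n)"
    let ?w = "if j = int (Suc n) then 1 else if j = - int (Suc n) then qm else qp"
    have "act (\<tau> \<circ> swap_last n j) ?F k = act \<tau> ?F (k \<circ> inv (swap_last n j))" if t: "\<tau> \<in> hyperoct n" for \<tau>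
      unfolding act_comp[OF swap_last_in_hyperoct[OF j] hyperoct_mono[OF t], symmetric] by (simp only: act_def)
    then have "(\<Sum>\<tau>\<in>hyperoct n. complex_of_real (weight qp qm (Suc n) (\<tau> \<circ> swap_last n j)) * act (\<tau> \<circ> swap_last n j) ?F k) =
      (\<Sum>\<tau>\<in>hyperoct n. complex_of_real ?w * (complex_of_real (weight qp qm n \<tau>) * act \<tau> ?F (k \<circ> inv (swap_last n j))))"
      by (intro sum.cong refl) (simp only: weight_comp_swap_last[OF _ j] of_real_mult mult_ac)
    also have "\<dots> = 0" unfolding sum_distrib_left[symmetric] inner by simp
    finally show "(\<Sum>\<tau>\<in>hyperoct n. complex_of_real (weight qp qm (Suc n) (\<tau> \<circ> swap_last n j)) * act (\<tau> \<circ> swap_last n j) ?F k) = 0" .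
  qed
  finally show "sym_op qp qm (Suc n) ?F k = 0" by simp
qed

lemma enclose_diff: "enclose E x y n (\<lambda>k. f k - g k) = (\<lambda>k. enclose E x y n f k - enclose E x y n g k)"
  by (auto simp: enclose_def algebra_simps)

lemma enclose_scale: "enclose E x y n (\<lambda>k. c * f k) = (\<lambda>k. c * enclose E x y n f k)"
  by (auto simp: enclose_def)

lemma enclose_zero: "enclose E x y n (\<lambda>k. 0) = (\<lambda>k. 0)"
  by (auto simp: enclose_def)

definition power_tensor :: "'h::real_inner set \<Rightarrow> 'h \<Rightarrow> nat \<Rightarrow> 'h tvec" where
  "power_tensor E x n = simple_tensor E n (\<lambda>_. cplx_of x)"

lemma enclose_power_tensor: "enclose E (cplx_of x) (cplx_of x) n (power_tensor E x n) = power_tensor E x (Suc n)"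
  unfolding power_tensor_def enclose_simple by (rule arg_cong[where f = "simple_tensor E (Suc n)"]) auto

lemma sym_op_power_tensor:
  "sym_op qp qm n (power_tensor E x n) = (\<lambda>k. complex_of_real (\<Prod>i=1..n. rec_coeff qp qm i) * power_tensor E x n k)"
proof -
  have "act \<sigma> (power_tensor E x n) = power_tensor E x n" if "\<sigma> \<in> hyperoct n" for \<sigma>
    unfolding power_tensor_def act_simple[OF that] by (simp add: comp_def)
  then show ?thesis
    unfolding sym_op_def sum_weight[symmetric] of_real_sum sum_distrib_right by (auto intro!: ext sum.cong)
qed

context
  fixes E :: "'h::real_inner set" and x :: 'h
  assumes E: "orthonormal_basis E" and x: "norm x = 1"
begin

abbreviation "encl \<equiv> enclose E (cplx_of x) (cplx_of x)"

lemma has_sum_coordinates: "((\<lambda>e. complex_of_real (inner e x) * complex_of_real (inner e x)) has_sum 1) E"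
proof -
  have "((\<lambda>e. complex_of_real (inner e x * inner e x)) has_sum complex_of_real (inner x x)) E"
    by (rule has_sum_of_real[OF parseval[OF E]])
  moreover have "inner x x = 1" using x by (simp add: dot_square_norm)
  ultimately show ?thesis by simp
qed

text \<open>The indices split as E times \<open>idx E n\<close> times E, and each outer sum is the
  squared norm of x, namely 1.\<close>

lemma has_sum_enclose:
  assumes "f \<in> tensor_space E n" "g \<in> tensor_space E n"
  shows "((\<lambda>k. cnj (encl n f k) * encl n g k) has_sum tensor_inner E n f g) (idx E (Suc n))"
proof -
  have "((\<lambda>k. cnj (f k) * g k) has_sum tensor_inner E n f g) (idx E n)"
    unfolding tensor_inner_def by (rule has_sum_infsum[OF tensor_space_summable[OF assms]])
  note * = has_sum_idx_Suc[OF has_sum_coordinates this has_sum_coordinates]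
  show ?thesis
    by (rule has_sum_cong[THEN iffD1, OF _ *[simplified]]) (simp add: enclose_cplx_of mult_ac)
qed

lemma tensor_inner_enclose:
  assumes "f \<in> tensor_space E n" "g \<in> tensor_space E n"
  shows "tensor_inner E (Suc n) (encl n f) (encl n g) = tensor_inner E n f g"
  unfolding tensor_inner_def[of E "Suc n"] using has_sum_enclose[OF assms] by (rule infsumI)

lemma enclose_in_tensor_space:
  assumes "f \<in> tensor_space E n" shows "encl n f \<in> tensor_space E (Suc n)"
proof (rule tensor_spaceI)
  show "(\<lambda>k. cnj (encl n f k) * encl n f k) summable_on idx E (Suc n)"
    using has_sum_enclose[OF assms assms] by (rule has_sum_imp_summable)
qed (simp add: enclose_def)

lemma power_tensor_0: "power_tensor E x 0 = (\<lambda>k. if k \<in> idx E 0 then 1 else 0)"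
  by (auto simp: power_tensor_def simple_tensor_def pm_def)

lemma power_tensor_in_tensor_space: "power_tensor E x n \<in> tensor_space E n"
proof (induction n)
  case 0
  have "finite (idx E 0)" by (simp add: idx_def pm_def)
  then show ?case by (intro tensor_spaceI) (auto simp: power_tensor_0)
qed (use enclose_in_tensor_space enclose_power_tensor in metis)

lemma tensor_inner_power_tensor: "tensor_inner E n (power_tensor E x n) (power_tensor E x n) = 1"
proof (induction n)
  case 0
  have "idx E 0 = {\<lambda>_. undefined}" by (simp add: idx_def pm_def)
  then show ?case by (simp add: tensor_inner_def power_tensor_0)
next
  case (Suc n)
  then show ?case
    using tensor_inner_enclose[OF power_tensor_in_tensor_space power_tensor_in_tensor_space, of n] enclose_power_tensor
    by metis
qed

end

section \<open>Fock vectors and the quotient by null vectors\<close>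

lemma fock_tensor: "F \<in> fock E \<Longrightarrow> F n \<in> tensor_space E n"
  by (simp add: fock_def)

lemma fock_finite: "F \<in> fock E \<Longrightarrow> finite {n. F n \<noteq> (\<lambda>k. 0)}"
  by (simp add: fock_def)

lemma fockI:
  "(\<And>n. F n \<in> tensor_space E n) \<Longrightarrow> finite A \<Longrightarrow> (\<And>n. n \<notin> A \<Longrightarrow> F n = (\<lambda>k. 0)) \<Longrightarrow> F \<in> fock E"
  unfolding fock_def by (auto elim!: finite_subset[rotated])

lemma fock_diff_in_fock: "F \<in> fock E \<Longrightarrow> G \<in> fock E \<Longrightarrow> fock_diff F G \<in> fock E"
  by (rule fockI[where A = "{n. F n \<noteq> (\<lambda>k. 0)} \<union> {n. G n \<noteq> (\<lambda>k. 0)}"])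
    (auto simp: fock_diff_def fock_finite intro: tensor_space_diff fock_tensor)

lemma fock_add_in_fock: "F \<in> fock E \<Longrightarrow> G \<in> fock E \<Longrightarrow> fock_add F G \<in> fock E"
  by (rule fockI[where A = "{n. F n \<noteq> (\<lambda>k. 0)} \<union> {n. G n \<noteq> (\<lambda>k. 0)}"])
    (auto simp: fock_add_def fock_finite intro: tensor_space_add fock_tensor)

lemma fock_inner_eq:
  assumes "finite A" "{n. F n \<noteq> (\<lambda>k. 0)} \<subseteq> A"
  shows "fock_inner qp qm E F G = (\<Sum>n\<in>A. tensor_inner E n (F n) (sym_op qp qm n (G n)))"
  unfolding fock_inner_def using assms by (intro sum.mono_neutral_left) auto

locale cyclic_fock =
  fixes qp qm :: real and E :: "'h::real_inner set" and x :: 'h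
  assumes posdef: "weight_posdef qp qm" and E: "orthonormal_basis E" and x: "norm x = 1"
begin

abbreviation "qsym \<equiv> sym_op qp qm"
abbreviation "form \<equiv> fock_inner qp qm E"
abbreviation "cls \<equiv> fclass qp qm E"
abbreviation "create \<equiv> creation E (cplx_of x) (cplx_of x)"

lemma form_hermitian:
  assumes "F \<in> fock E" "G \<in> fock E"
  shows "form F G = cnj (form G F)"
proof -
  let ?A = "{n. F n \<noteq> (\<lambda>k. 0)} \<union> {n. G n \<noteq> (\<lambda>k. 0)}"
  have fin: "finite ?A" using assms fock_finite by blast
  have "tensor_inner E n (F n) (qsym n (G n)) = cnj (tensor_inner E n (G n) (qsym n (F n)))" for n
    using sym_op_self_adjoint[OF posdef fock_tensor[OF assms(1)] fock_tensor[OF assms(2)], of n]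
      tensor_inner_cnj[of E n "qsym n (F n)" "G n"] by simp
  then show ?thesis
    by (simp add: fock_inner_eq[OF fin, of F] fock_inner_eq[OF fin, of G] cnj_sum)
qed

lemma form_cong_right: "(\<And>n. qsym n (G n) = qsym n (G' n)) \<Longrightarrow> form F G = form F G'"
  by (simp add: fock_inner_def)

lemma form_cong:
  assumes "F \<in> fock E" "F' \<in> fock E" "G \<in> fock E" "G' \<in> fock E"
    and "\<And>n. qsym n (F n) = qsym n (F' n)" "\<And>n. qsym n (G n) = qsym n (G' n)"
  shows "form F G = form F' G'"
proof -
  have "form F G = cnj (form G' F)" using form_cong_right[OF assms(6)] form_hermitian assms by metis
  also have "\<dots> = cnj (form G' F')" using form_cong_right[OF assms(5)] by metis
  also have "\<dots> = form F' G'" using form_hermitian assms by metis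
  finally show ?thesis .
qed

text \<open>By \<open>sym_op_form\<close> the levels contribute nonnegative reals, each vanishing
  only on the kernel of the symmetrisation operator. Classes are therefore the fibres of
  \<open>qsym\<close>, and every check on representatives reduces to an identity of symmetrised
  vectors.\<close>

lemma null_rel_iff:
  assumes F: "F \<in> fock E" and G: "G \<in> fock E"
  shows "(F, G) \<in> null_rel qp qm E \<longleftrightarrow> (\<forall>n. qsym n (F n) = qsym n (G n))"
proof -
  define D where "D = fock_diff F G"
  have D: "D \<in> fock E" unfolding D_def by (rule fock_diff_in_fock[OF F G])
  have sD: "qsym n (D n) = (\<lambda>k. 0) \<longleftrightarrow> qsym n (F n) = qsym n (G n)" for n
    unfolding D_def fock_diff_def sym_op_diff by (auto simp: fun_eq_iff)
  let ?A = "{n. D n \<noteq> (\<lambda>k. 0)}"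
  have "form D D = 0 \<longleftrightarrow> (\<forall>n. qsym n (D n) = (\<lambda>k. 0))"
  proof
    assume 0: "form D D = 0"
    have "\<exists>r. \<forall>n. r n \<ge> 0 \<and> tensor_inner E n (D n) (qsym n (D n)) = complex_of_real (r n) \<and> (r n = 0 \<longrightarrow> qsym n (D n) = (\<lambda>k. 0))"
    proof (intro choice allI)
      fix n
      show "\<exists>r. r \<ge> 0 \<and> tensor_inner E n (D n) (qsym n (D n)) = complex_of_real r \<and> (r = 0 \<longrightarrow> qsym n (D n) = (\<lambda>k. 0))"
        by (rule sym_op_form[OF posdef fock_tensor[OF D]]) auto
    qed
    then obtain r where r: "\<And>n. r n \<ge> 0" "\<And>n. tensor_inner E n (D n) (qsym n (D n)) = complex_of_real (r n)"
      "\<And>n. r n = 0 \<Longrightarrow> qsym n (D n) = (\<lambda>k. 0)" by auto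
    have "complex_of_real (\<Sum>n\<in>?A. r n) = 0" using 0 by (simp add: fock_inner_def r)
    then have "(\<Sum>n\<in>?A. r n) = 0" by (simp only: of_real_eq_0_iff)
    then have "r n = 0" if "n \<in> ?A" for n
      using that r(1) fock_finite[OF D] by (simp add: sum_nonneg_eq_0_iff)
    then show "\<forall>n. qsym n (D n) = (\<lambda>k. 0)" using r(3) by (metis (mono_tags, lifting) mem_Collect_eq sym_op_zero)
  qed (simp add: fock_inner_def)
  then show ?thesis using F G sD by (simp add: null_rel_def D_def)
qed

lemma mem_cls: "F \<in> fock E \<Longrightarrow> G \<in> cls F \<longleftrightarrow> G \<in> fock E \<and> (\<forall>n. qsym n (F n) = qsym n (G n))"
  using null_rel_iff[of F G] by (auto simp: fclass_def null_rel_def)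

lemma cls_eqI:
  assumes "F \<in> fock E" "G \<in> fock E" "\<And>n. qsym n (F n) = qsym n (G n)"
  shows "cls F = cls G"
  using assms by (intro set_eqI) (simp add: mem_cls)

lemma repr_cls:
  assumes "F \<in> fock E"
  shows "repr (cls F) \<in> fock E" "qsym n (repr (cls F) n) = qsym n (F n)"
proof -
  have "F \<in> cls F" using assms by (simp add: mem_cls)
  then have "repr (cls F) \<in> cls F" unfolding repr_def by (rule someI[of "\<lambda>G. G \<in> cls F"])
  then show "repr (cls F) \<in> fock E" "qsym n (repr (cls F) n) = qsym n (F n)" using assms by (simp_all add: mem_cls)
qed

lemma qfock_iff: "X \<in> qfock qp qm E \<longleftrightarrow> (\<exists>F\<in>fock E. X = cls F)"
  by (auto simp: qfock_def fclass_def quotient_def)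

lemma qinner_cls: "F \<in> fock E \<Longrightarrow> G \<in> fock E \<Longrightarrow> qinner qp qm E (cls F) (cls G) = form F G"
  unfolding qinner_def by (intro form_cong repr_cls)

lemma qadd_cls:
  assumes "F \<in> fock E" "G \<in> fock E" shows "qadd qp qm E (cls F) (cls G) = cls (fock_add F G)"
  unfolding qadd_def
proof (rule cls_eqI)
  show "qsym n (fock_add (repr (cls F)) (repr (cls G)) n) = qsym n (fock_add F G n)" for n
    unfolding fock_add_def sym_op_add repr_cls(2)[OF assms(1)] repr_cls(2)[OF assms(2)] ..
qed (intro fock_add_in_fock repr_cls assms)+

lemma creation_in_fock:
  assumes F: "F \<in> fock E" shows "create F \<in> fock E"
proof (rule fockI[where A = "Suc ` {n. F n \<noteq> (\<lambda>k. 0)}"])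
  show "create F n \<in> tensor_space E n" for n
    by (cases n) (simp_all add: creation_def tensor_space_zero enclose_in_tensor_space[OF E x fock_tensor[OF F]])
  show "finite (Suc ` {n. F n \<noteq> (\<lambda>k. 0)})" using fock_finite[OF F] by simp
  show "create F n = (\<lambda>k. 0)" if "n \<notin> Suc ` {n. F n \<noteq> (\<lambda>k. 0)}" for n
    using that by (cases n) (auto simp: creation_def enclose_zero)
qed

text \<open>Independence of the representative: \<open>sym_op_enclose_null\<close> applied to the
  difference at each level.\<close>

lemma creation_cong:
  assumes eq: "\<And>n. qsym n (F n) = qsym n (G n)"
  shows "qsym n (create F n) = qsym n (create G n)"
proof (cases n)
  case (Suc m)
  let ?e = "enclose E (cplx_of x) (cplx_of x) m"
  have "qsym m (\<lambda>k. F m k - G m k) = (\<lambda>k. 0)" by (simp add: sym_op_diff eq)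
  then have "qsym (Suc m) (?e (\<lambda>k. F m k - G m k)) = (\<lambda>k. 0)" by (rule sym_op_enclose_null)
  then have "(\<lambda>k. qsym (Suc m) (?e (F m)) k - qsym (Suc m) (?e (G m)) k) = (\<lambda>k. 0)"
    by (simp only: enclose_diff sym_op_diff)
  then show ?thesis by (simp add: Suc creation_def fun_eq_iff)
qed (simp add: creation_def)

lemma qcreation_cls:
  assumes F: "F \<in> fock E" shows "qcreation qp qm E (cplx_of x) (cplx_of x) (cls F) = cls (create F)"
  unfolding qcreation_def
  by (intro cls_eqI creation_in_fock repr_cls F creation_cong)

section \<open>Creation and annihilation on finite combinations of tensor powers of x\<close>

definition power_vec :: "(nat \<Rightarrow> real) \<Rightarrow> 'h fvec" where
  "power_vec a = (\<lambda>n k. complex_of_real (a n) * power_tensor E x n k)"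

definition fin_supp :: "(nat \<Rightarrow> real) \<Rightarrow> bool" where
  "fin_supp a \<longleftrightarrow> finite {n. a n \<noteq> 0}"

lemma fin_suppI: "finite A \<Longrightarrow> (\<And>n. n \<notin> A \<Longrightarrow> a n = 0) \<Longrightarrow> fin_supp a"
  unfolding fin_supp_def by (auto elim!: finite_subset[rotated])

lemma power_vec_in_fock: "fin_supp a \<Longrightarrow> power_vec a \<in> fock E"
  by (rule fockI[where A = "{n. a n \<noteq> 0}"])
    (auto simp: power_vec_def fin_supp_def intro: tensor_space_scale power_tensor_in_tensor_space[OF E x])

definition raise :: "(nat \<Rightarrow> real) \<Rightarrow> nat \<Rightarrow> real" where
  "raise a n = (case n of 0 \<Rightarrow> 0 | Suc m \<Rightarrow> a m)"

text \<open>Annihilation in coordinates. The factor lam(n+1) is what multiplies the eigenvalue of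
  the symmetrisation operator on the powers of x between levels n and n+1.\<close>

definition lower :: "(nat \<Rightarrow> real) \<Rightarrow> nat \<Rightarrow> real" where
  "lower a n = rec_coeff qp qm (Suc n) * a (Suc n)"

lemma jacobi_step_eq: "jacobi_step (rec_coeff qp qm) a = (\<lambda>n. lower a n + raise a n)"
  by (simp add: jacobi_step_def lower_def raise_def fun_eq_iff)

lemma fin_supp_raise: "fin_supp a \<Longrightarrow> fin_supp (raise a)"
  by (rule fin_suppI[where A = "Suc ` {n. a n \<noteq> 0}"]) (auto simp: fin_supp_def raise_def split: nat.split)

lemma fin_supp_lower:
  assumes "fin_supp a" shows "fin_supp (lower a)"
proof (rule fin_suppI)
  show "finite (Suc -` {n. a n \<noteq> 0})" using assms unfolding fin_supp_def by (rule finite_vimageI) simp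
qed (simp add: lower_def)

lemma creation_power_vec: "create (power_vec a) = power_vec (raise a)"
  by (auto simp: fun_eq_iff creation_def power_vec_def raise_def enclose_scale enclose_power_tensor split: nat.split)

lemma add_power_vec: "fock_add (power_vec a) (power_vec b) = power_vec (\<lambda>n. a n + b n)"
  by (simp add: fun_eq_iff fock_add_def power_vec_def distrib_right)

text \<open>Self-adjointness moves the symmetrisation from the arbitrary vector to the powers of x,
  where it is a scalar.\<close>

lemma form_power_vec:
  assumes H: "H \<in> fock E" and A: "finite A" "{n. a n \<noteq> 0} \<subseteq> A"
  shows "form (power_vec a) H = (\<Sum>n\<in>A. complex_of_real (a n * (\<Prod>i=1..n. rec_coeff qp qm i)) * tensor_inner E n (power_tensor E x n) (H n))"
proof -
  let ?v = "power_tensor E x"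
  have "tensor_inner E n (power_vec a n) (qsym n (H n)) =
      complex_of_real (a n * (\<Prod>i=1..n. rec_coeff qp qm i)) * tensor_inner E n (?v n) (H n)" for n
  proof -
    have v: "?v n \<in> tensor_space E n" by (rule power_tensor_in_tensor_space[OF E x])
    have sc: "tensor_inner E n (\<lambda>k. complex_of_real c * ?v n k) h = complex_of_real c * tensor_inner E n (?v n) h" for c h
      by (subst (1 2) tensor_inner_cnj) (simp add: tensor_inner_scale_right)
    have "tensor_inner E n (power_vec a n) (qsym n (H n)) = complex_of_real (a n) * tensor_inner E n (qsym n (?v n)) (H n)"
      unfolding power_vec_def sc sym_op_self_adjoint[OF posdef v fock_tensor[OF H]] ..
    also have "\<dots> = complex_of_real (a n) * (complex_of_real (\<Prod>i=1..n. rec_coeff qp qm i) * tensor_inner E n (?v n) (H n))"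
      unfolding sym_op_power_tensor sc ..
    finally show ?thesis by (simp only: of_real_mult mult.assoc)
  qed
  moreover have "{n. power_vec a n \<noteq> (\<lambda>k. 0)} \<subseteq> A" using A(2) by (auto simp: power_vec_def)
  ultimately show ?thesis by (subst fock_inner_eq[OF A(1)]) simp_all
qed

text \<open>Removing both outer factors x preserves the plain inner product, so passing from level
  n+1 to level n costs only the ratio of the eigenvalues, which is the factor in
  \<open>lower\<close>.\<close>

lemma form_lower:
  assumes a: "fin_supp a" and H: "H \<in> fock E"
  shows "form (power_vec (lower a)) H = form (power_vec a) (create H)"
proof -
  obtain N where N: "{n. a n \<noteq> 0} \<subseteq> {..N}" using a unfolding fin_supp_def by (meson finite_nat_iff_bounded_le)
  let ?v = "power_tensor E x" and ?S = "\<lambda>n. \<Prod>i=1..n. rec_coeff qp qm i"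
  have supp: "{n. lower a n \<noteq> 0} \<subseteq> {..<N}" using N by (auto simp: lower_def Suc_le_eq)
  have S: "?S (Suc n) = ?S n * rec_coeff qp qm (Suc n)" for n by simp
  have "form (power_vec a) (create H) = (\<Sum>n\<le>N. complex_of_real (a n * ?S n) * tensor_inner E n (?v n) (create H n))"
    by (rule form_power_vec[OF creation_in_fock[OF H] _ N]) simp
  \<comment> \<open>The term at level 0 drops out because creation has no component there.\<close>
  also have "\<dots> = (\<Sum>n<N. complex_of_real (a (Suc n) * ?S (Suc n)) * tensor_inner E (Suc n) (?v (Suc n)) (create H (Suc n)))"
    unfolding lessThan_Suc_atMost[symmetric] sum.lessThan_Suc_shift by (simp add: creation_def del: prod.cl_ivl_Suc)
  also have "\<dots> = (\<Sum>n<N. complex_of_real (lower a n * ?S n) * tensor_inner E n (?v n) (H n))"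
  proof (rule sum.cong[OF refl])
    fix n
    have "tensor_inner E (Suc n) (?v (Suc n)) (create H (Suc n)) = tensor_inner E n (?v n) (H n)"
      unfolding enclose_power_tensor[symmetric] creation_def
      by (simp add: tensor_inner_enclose[OF E x power_tensor_in_tensor_space[OF E x] fock_tensor[OF H]])
    then show "complex_of_real (a (Suc n) * ?S (Suc n)) * tensor_inner E (Suc n) (?v (Suc n)) (create H (Suc n)) =
       complex_of_real (lower a n * ?S n) * tensor_inner E n (?v n) (H n)"
      unfolding S lower_def by (simp only: mult_ac)
  qed
  also have "\<dots> = form (power_vec (lower a)) H"
    by (rule form_power_vec[OF H _ supp, symmetric]) simp
  finally show ?thesis ..
qed

lemma form_diff_left:
  assumes F: "F \<in> fock E" and G: "G \<in> fock E" and H: "H \<in> fock E"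
  shows "form (fock_diff F G) H = form F H - form G H"
proof -
  let ?A = "{n. F n \<noteq> (\<lambda>k. 0)} \<union> {n. G n \<noteq> (\<lambda>k. 0)}"
  have fin: "finite ?A" using F G fock_finite by blast
  have "tensor_inner E n (fock_diff F G n) (qsym n (H n)) =
      tensor_inner E n (F n) (qsym n (H n)) - tensor_inner E n (G n) (qsym n (H n))" for n
  proof -
    have "tensor_inner E n (qsym n (H n)) (fock_diff F G n) =
      tensor_inner E n (qsym n (H n)) (F n) - tensor_inner E n (qsym n (H n)) (G n)"
      unfolding fock_diff_def
      by (intro tensor_inner_diff_right sym_op_in_tensor_space fock_tensor F G H)
    then show ?thesis
      by (subst (1 2 3) tensor_inner_cnj) simp
  qed
  then show ?thesis
    by (subst fock_inner_eq[OF fin], force simp: fock_diff_def, subst (1 2) fock_inner_eq[OF fin])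
      (auto simp: sum_subtractf)
qed

text \<open>Existence is \<open>form_lower\<close>. For uniqueness, two representatives of the same
  functional differ by a vector whose form with every Fock vector is 0, in particular with itself,
  so the difference is null.\<close>

lemma qannihilation_power_vec:
  assumes a: "fin_supp a"
  shows "qannihilation qp qm E (cplx_of x) (cplx_of x) (cls (power_vec a)) = cls (power_vec (lower a))"
  unfolding qannihilation_def
proof (rule the_equality)
  note va = power_vec_in_fock[OF a] and vl = power_vec_in_fock[OF fin_supp_lower[OF a]]
  have rhs: "qinner qp qm E (cls (power_vec a)) (qcreation qp qm E (cplx_of x) (cplx_of x) (cls H)) = form (power_vec (lower a)) H"
    if H: "H \<in> fock E" for H
    unfolding qcreation_cls[OF H] qinner_cls[OF va creation_in_fock[OF H]] form_lower[OF a H] ..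
  show "cls (power_vec (lower a)) \<in> qfock qp qm E \<and> (\<forall>Y\<in>qfock qp qm E.
      qinner qp qm E (cls (power_vec (lower a))) Y = qinner qp qm E (cls (power_vec a)) (qcreation qp qm E (cplx_of x) (cplx_of x) Y))"
    using vl by (auto simp: qfock_iff rhs qinner_cls)
  fix Z assume Z: "Z \<in> qfock qp qm E \<and> (\<forall>Y\<in>qfock qp qm E.
      qinner qp qm E Z Y = qinner qp qm E (cls (power_vec a)) (qcreation qp qm E (cplx_of x) (cplx_of x) Y))"
  then obtain F where F: "F \<in> fock E" "Z = cls F" by (auto simp: qfock_iff)
  have eq: "form F H = form (power_vec (lower a)) H" if H: "H \<in> fock E" for H
  proof -
    have "cls H \<in> qfock qp qm E" using H by (auto simp: qfock_iff)
    then have "qinner qp qm E (cls F) (cls H) = form (power_vec (lower a)) H" using Z F(2) rhs[OF H] by simp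
    then show ?thesis using qinner_cls[OF F(1) H] by simp
  qed
  let ?D = "fock_diff F (power_vec (lower a))"
  have "form ?D ?D = 0"
    using form_diff_left[OF F(1) vl fock_diff_in_fock[OF F(1) vl]] eq[OF fock_diff_in_fock[OF F(1) vl]] by simp
  then have "(F, power_vec (lower a)) \<in> null_rel qp qm E" using F vl by (simp add: null_rel_def)
  then show "Z = cls (power_vec (lower a))"
    unfolding F(2) using null_rel_iff[OF F(1) vl] by (intro cls_eqI F vl) simp
qed

lemma cyclic_gaussian_power_vec:
  assumes a: "fin_supp a"
  shows "cyclic_gaussian qp qm E x (cls (power_vec a)) = cls (power_vec (jacobi_step (rec_coeff qp qm) a))"
  unfolding cyclic_gaussian_def qannihilation_power_vec[OF a] qcreation_cls[OF power_vec_in_fock[OF a]]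
    creation_power_vec jacobi_step_eq
  by (subst qadd_cls) (simp_all add: add_power_vec power_vec_in_fock fin_supp_lower fin_supp_raise a)

lemma fin_supp_jacobi_coeff: "fin_supp (jacobi_coeff lam n)"
  by (rule fin_suppI[where A = "{..n}"]) (auto intro: jacobi_coeff_eq_0)

lemma vacuum_eq: "vacuum E = power_vec (jacobi_coeff (rec_coeff qp qm) 0)"
  using power_tensor_0[OF E x]
  by (auto simp: fun_eq_iff vacuum_def power_vec_def jacobi_coeff_0)

lemma cyclic_gaussian_power:
  "(cyclic_gaussian qp qm E x ^^ n) (cls (vacuum E)) = cls (power_vec (jacobi_coeff (rec_coeff qp qm) n))"
  by (induction n) (simp_all add: vacuum_eq cyclic_gaussian_power_vec fin_supp_jacobi_coeff jacobi_coeff_Suc)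

lemma vacuum_moment_eq: "vacuum_moment qp qm E x n = complex_of_real (jacobi_moment (rec_coeff qp qm) n)"
proof -
  let ?c = "jacobi_coeff (rec_coeff qp qm)"
  have v: "power_vec (?c k) \<in> fock E" for k by (intro power_vec_in_fock fin_supp_jacobi_coeff)
  have "vacuum_moment qp qm E x n = form (power_vec (?c 0)) (power_vec (?c n))"
    unfolding vacuum_moment_def Let_def cyclic_gaussian_power unfolding vacuum_eq by (rule qinner_cls[OF v v])
  \<comment> \<open>The vacuum lives at level 0, where the eigenvalue is the empty product.\<close>
  also have "\<dots> = (\<Sum>k\<in>{0}. complex_of_real (?c 0 k * (\<Prod>i=1..k. rec_coeff qp qm i)) * tensor_inner E k (power_tensor E x k) (power_vec (?c n) k))"
    by (rule form_power_vec[OF v]) (auto simp: jacobi_coeff_0)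
  also have "\<dots> = complex_of_real (?c n 0)"
    by (simp add: jacobi_coeff_0 power_vec_def tensor_inner_scale_right tensor_inner_power_tensor[OF E x])
  finally show ?thesis by (simp add: jacobi_moment_def)
qed

end

section \<open>The distribution of the cyclic Gaussian operator\<close>

text \<open>In the first family lam(k) = 2 (M + \<epsilon> (k - 1)) / (M + N). For \<epsilon> = 1
  this is positive unless M = 0, when already lam(1) = 0; for \<epsilon> = -1 it is positive up to k
  = M and zero at M + 1. For \<open>qp\<close> = 0 it is the constant 1 + \<open>qm\<close>. No
  coefficient is thus negative before the first zero.\<close>

lemma rec_coeff_cases:
  assumes "(\<exists>(M::nat) (N::nat) (\<epsilon>::real). M + N \<noteq> 0 \<and> \<epsilon> \<in> {1, -1} \<and>
          qp = \<epsilon> / (real M + real N) \<and> qm = (real M - real N) / (real M + real N))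
       \<or> (qp = 0 \<and> -1 \<le> qm \<and> qm \<le> 1)"
  obtains (infinite) "\<And>k. 0 < k \<Longrightarrow> rec_coeff qp qm k > 0"
    | (finite) n where "\<And>k. 0 < k \<Longrightarrow> k \<le> n \<Longrightarrow> rec_coeff qp qm k > 0" "rec_coeff qp qm (Suc n) = 0"
  using assms
proof (elim disjE exE conjE)
  fix M N :: nat and \<epsilon> :: real
  assume MN: "M + N \<noteq> 0" and e: "\<epsilon> \<in> {1, -1}" and q: "qp = \<epsilon> / (real M + real N)" "qm = (real M - real N) / (real M + real N)"
  have D: "real M + real N > 0" using MN by linarith
  have lam: "rec_coeff qp qm k = 2 * (real M + \<epsilon> * (real k - 1)) / (real M + real N)" for k
  proof -
    define d where "d = real M + real N"
    have "d \<noteq> 0" using D by (simp add: d_def)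
    then have "rec_coeff qp qm k = (d + 2 * (real k - 1) * \<epsilon> + (real M - real N)) / d"
      unfolding rec_coeff_def q d_def[symmetric] by (simp add: add_divide_distrib)
    also have "d + 2 * (real k - 1) * \<epsilon> + (real M - real N) = 2 * (real M + \<epsilon> * (real k - 1))"
      by (simp add: d_def algebra_simps)
    finally show ?thesis by (simp only: d_def)
  qed
  consider "\<epsilon> = 1" "M > 0" | "\<epsilon> = 1" "M = 0" | "\<epsilon> = - 1" using e by auto
  then show thesis
  proof cases
    case 1
    show ?thesis by (rule infinite) (use 1 D in \<open>simp add: lam zero_less_divide_iff\<close>)
  next
    case 2
    show ?thesis by (rule finite[of 0]) (use 2 in \<open>simp_all add: lam\<close>)
  next
    case 3
    show ?thesis by (rule finite[of M]) (use 3 D in \<open>simp_all add: lam zero_less_divide_iff\<close>)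
  qed
next
  assume q: "qp = 0" "- 1 \<le> qm" "qm \<le> 1"
  show thesis
  proof (cases "qm = - 1")
    case True
    show ?thesis by (rule finite[of 0]) (use True q in \<open>simp_all add: rec_coeff_def\<close>)
  next
    case False
    show ?thesis by (rule infinite) (use False q in \<open>simp add: rec_coeff_def\<close>)
  qed
qed

lemma abs_rec_coeff_le:
  assumes "k > 0" shows "\<bar>rec_coeff qp qm k\<bar> \<le> (1 + \<bar>qm\<bar> + 2 * \<bar>qp\<bar>) * real k"
proof -
  have k: "1 \<le> real k" using assms by simp
  have "\<bar>rec_coeff qp qm k\<bar> \<le> \<bar>1 + qm\<bar> + \<bar>2 * (real k - 1) * qp\<bar>"
    unfolding rec_coeff_def by linarith
  also have "\<bar>2 * (real k - 1) * qp\<bar> = 2 * (real k - 1) * \<bar>qp\<bar>" using k by (simp add: abs_mult)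
  also have "\<dots> \<le> 2 * real k * \<bar>qp\<bar>" by (intro mult_right_mono) auto
  also have "\<bar>1 + qm\<bar> \<le> (1 + \<bar>qm\<bar>) * real k"
    using mult_left_mono[OF k, of "1 + \<bar>qm\<bar>"] by simp
  finally show ?thesis by (simp add: algebra_simps)
qed

lemma weight_posdef_params:
  assumes "(\<exists>(M::nat) (N::nat) (\<epsilon>::real). M + N \<noteq> 0 \<and> \<epsilon> \<in> {1, -1} \<and>
          qp = \<epsilon> / (real M + real N) \<and> qm = (real M - real N) / (real M + real N))
       \<or> (qp = 0 \<and> -1 \<le> qm \<and> qm \<le> 1)"
  shows "weight_posdef qp qm"
  using assms
proof (elim disjE exE conjE)
  fix M N :: nat and \<epsilon> :: real
  assume MN: "M + N \<noteq> 0" and e: "\<epsilon> \<in> {1, -1}" and q: "qp = \<epsilon> / (real M + real N)" "qm = (real M - real N) / (real M + real N)"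
  show ?thesis
    using e weight_posdef_trace[OF MN] weight_posdef_uminus[OF weight_posdef_trace[OF MN]] by (auto simp: q)
qed (use weight_posdef_signs in simp)

text \<open>From orthogonality to Q_0 = 1 the Q_k with k > 0 integrate to 0; beyond a vanishing
  coefficient this follows from divisibility. Conversely, the moments give orthogonality, and at the
  first vanishing coefficient Q_(n+1) has squared norm 0, hence vanishes almost everywhere.\<close>

lemma is_recursion_measure_iff:
  assumes cases: "(\<forall>k>0. rec_coeff qp qm k > 0) \<or>
    (\<exists>n. (\<forall>k. 0 < k \<and> k \<le> n \<longrightarrow> rec_coeff qp qm k > 0) \<and> rec_coeff qp qm (Suc n) = 0)"
  shows "is_recursion_measure qp qm \<mu> \<longleftrightarrow> has_jacobi_moments (rec_coeff qp qm) \<mu>"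
proof -
  let ?l = "rec_coeff qp qm" and ?q = "jacobi_poly (rec_coeff qp qm) :: nat \<Rightarrow> real poly"
  have q: "rec_poly qp qm = ?q" using rec_poly_eq by blast
  have integral_0: "integral\<^sup>L \<mu> (poly (?q k)) = 0" if "orthogonal_polys_on I ?q \<mu>" "0 \<in> I" "k \<in> I" "k > 0" for I k
  proof -
    have "integral\<^sup>L \<mu> (\<lambda>t. poly (?q 0) t * poly (?q k) t) = 0"
      using bspec[OF bspec[OF conjunct1[OF that(1)[unfolded orthogonal_polys_on_def]] that(2)] that(3)] that(4)
      by simp
    then show ?thesis by simp
  qed
  have orth: "orthogonal_polys_on I ?q \<mu>"
    if M: "has_jacobi_moments ?l \<mu>" and pos: "\<And>k. k \<in> I \<Longrightarrow> jacobi_norm ?l k > 0" for I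
    unfolding orthogonal_polys_on_def power2_eq_square using jacobi_orthogonal[OF M] pos by simp
  from cases show ?thesis
  proof
    assume pos: "\<forall>k>0. ?l k > 0"
    then have no: "\<not> (\<exists>n\<ge>1. ?l n = 0)" by (metis less_irrefl less_le_trans zero_less_one)
    have "jacobi_norm ?l k > 0" for k using jacobi_norm_pos[of k ?l k] pos by simp
    then show ?thesis
      unfolding is_recursion_measure_def if_not_P[OF no] q
      using orth[of UNIV] has_jacobi_momentsI[of \<mu> ?l] integral_0[of UNIV]
      by (auto simp: has_jacobi_moments_def)
  next
    assume "\<exists>n. (\<forall>k. 0 < k \<and> k \<le> n \<longrightarrow> ?l k > 0) \<and> ?l (Suc n) = 0"
    then obtain n where pos: "\<And>k. 0 < k \<Longrightarrow> k \<le> n \<Longrightarrow> ?l k > 0" and 0: "?l (Suc n) = 0" by blast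
    have ex: "\<exists>n\<ge>1. ?l n = 0" using 0 by (intro exI[of _ "Suc n"]) simp
    have least: "(LEAST n. n \<ge> 1 \<and> ?l n = 0) = Suc n"
    proof (rule Least_equality)
      show "Suc n \<le> k" if "1 \<le> k \<and> ?l k = 0" for k
        using that pos[of k] by (cases "k \<le> n") auto
    qed (use 0 in simp)
    have norm: "jacobi_norm ?l k > 0" if "k \<le> n" for k using jacobi_norm_pos[of n ?l k] pos that by simp
    show ?thesis
      unfolding is_recursion_measure_def if_P[OF ex] Let_def least q
    proof
      assume R: "real_distribution \<mu> \<and> (\<forall>n. integrable \<mu> (\<lambda>t. t ^ n)) \<and> orthogonal_polys_on {..<Suc n} ?q \<mu> \<and>
        (AE t in \<mu>. poly (?q (Suc n)) t = 0)"
      have "integral\<^sup>L \<mu> (poly (?q k)) = 0" if "k > 0" for k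
        using that R integral_0[of "{..<Suc n}" k] integral_jacobi_beyond[of ?l n \<mu> k] 0 by (cases "k \<le> n") auto
      then show "has_jacobi_moments ?l \<mu>" using R by (intro has_jacobi_momentsI) auto
    next
      assume M: "has_jacobi_moments ?l \<mu>"
      then have int: "integrable \<mu> (poly p)" for p using integrable_poly by (auto simp: has_jacobi_moments_def)
      have sq: "poly (?q (Suc n) * ?q (Suc n)) = (\<lambda>t. poly (?q (Suc n)) t * poly (?q (Suc n)) t)"
        by (simp only: fun_eq_iff poly_mult) simp
      have "integral\<^sup>L \<mu> (\<lambda>t. poly (?q (Suc n)) t * poly (?q (Suc n)) t) = 0"
        unfolding jacobi_orthogonal[OF M] by (simp add: jacobi_norm_Suc 0)
      then have "AE t in \<mu>. poly (?q (Suc n)) t * poly (?q (Suc n)) t = 0"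
        using int[of "?q (Suc n) * ?q (Suc n)"] unfolding sq by (subst (asm) integral_nonneg_eq_0_iff_AE) auto
      then have "AE t in \<mu>. poly (?q (Suc n)) t = 0" by (simp del: jacobi_poly.simps)
      moreover have "orthogonal_polys_on {..<Suc n} ?q \<mu>" by (rule orth[OF M]) (simp add: norm)
      ultimately show "real_distribution \<mu> \<and> (\<forall>n. integrable \<mu> (\<lambda>t. t ^ n)) \<and> orthogonal_polys_on {..<Suc n} ?q \<mu> \<and>
        (AE t in \<mu>. poly (?q (Suc n)) t = 0)"
        using M by (auto simp: has_jacobi_moments_def)
    qed
  qed
qed

text \<open>The tensor has two factors, as \<open>pm 1\<close> = {-1, 1}. This turns the
  normalisation in the theorem into \<open>norm x\<close> = 1.\<close>

lemma tensor_norm_square: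
  assumes E: "orthonormal_basis E"
  shows "tensor_norm E 1 (simple_tensor E 1 (\<lambda>i. cplx_of x)) = (norm x)\<^sup>2"
proof -
  have "card (pm 1) = 2" by (simp add: card_pm)
  then have "tensor_inner E 1 (simple_tensor E 1 (\<lambda>i. cplx_of x)) (simple_tensor E 1 (\<lambda>i. cplx_of x)) =
      complex_of_real ((inner x x)\<^sup>2)"
    unfolding tensor_inner_simple[OF E] prod_constant cplx_inner_of by simp
  then have "tensor_norm E 1 (simple_tensor E 1 (\<lambda>i. cplx_of x)) = sqrt ((inner x x)\<^sup>2)"
    unfolding tensor_norm_def by (simp only: Re_complex_of_real)
  also have "\<dots> = (norm x)\<^sup>2" by (simp only: real_sqrt_abs abs_of_nonneg inner_ge_zero power2_norm_eq_inner)
  finally show ?thesis .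
qed

theorem theorem4p17:
  fixes qp qm :: real
    and E :: "'h::{real_inner,complete_space,second_countable_topology} set"
    and x :: 'h
  assumes E: "orthonormal_basis E"
    and params:
      "(\<exists>(M::nat) (N::nat) (\<epsilon>::real). M + N \<noteq> 0 \<and> \<epsilon> \<in> {1, -1} \<and>
          qp = \<epsilon> / (real M + real N) \<and> qm = (real M - real N) / (real M + real N))
       \<or> (qp = 0 \<and> -1 \<le> qm \<and> qm \<le> 1)"
    and x: "tensor_norm E 1 (simple_tensor E 1 (\<lambda>i. cplx_of x)) = 1"
  shows "(\<exists>!\<kappa>. is_vacuum_distribution qp qm E x \<kappa>) \<and>
         (\<exists>!\<mu>. is_recursion_measure qp qm \<mu>) \<and>
         (\<forall>\<kappa> \<mu>. is_vacuum_distribution qp qm E x \<kappa> \<longrightarrow> is_recursion_measure qp qm \<mu> \<longrightarrow> \<kappa> = \<mu>)"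
proof -
  let ?lam = "rec_coeff qp qm"
  have "(norm x)\<^sup>2 = 1" using x by (simp only: tensor_norm_square[OF E])
  then have "norm x = 1" using power2_eq_1_iff[of "norm x"] norm_ge_zero[of x] by auto
  then interpret cyclic_fock qp qm E x
    using weight_posdef_params[OF params] E by unfold_locales
  have ex: "\<exists>M. has_jacobi_moments ?lam M"
    using params by (cases rule: rec_coeff_cases)
      (auto intro: jacobi_measure_exists_infinite jacobi_measure_exists_finite)
  have uniq: "M = M'" if "has_jacobi_moments ?lam M" "has_jacobi_moments ?lam M'" for M M'
    using abs_rec_coeff_le that by (rule jacobi_measure_unique)
  \<comment> \<open>Both predicates become \<open>has_jacobi_moments\<close>, so the three claims
    reduce to existence and uniqueness of one measure.\<close>
  have vac: "is_vacuum_distribution qp qm E x = has_jacobi_moments ?lam"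
    by (simp add: fun_eq_iff is_vacuum_distribution_def has_jacobi_moments_def vacuum_moment_eq)
  have "(\<forall>k>0. ?lam k > 0) \<or> (\<exists>n. (\<forall>k. 0 < k \<and> k \<le> n \<longrightarrow> ?lam k > 0) \<and> ?lam (Suc n) = 0)"
    using params by (cases rule: rec_coeff_cases) blast+
  then have rec: "is_recursion_measure qp qm = has_jacobi_moments ?lam"
    by (intro ext is_recursion_measure_iff)
  show ?thesis unfolding vac rec using ex uniq by blast
qed

end
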